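(* Let $P_1$ and $P_2$ be distinct places in the function field $F/K$ of genus $g$. Then $$\sum_{0\leq k}(k+1)\left(\sum_{k<k_1}|\Gamma_{k_1,0}|\right)^2\leq |G_0(P_1,P_2)|\leq \sum_{0\leq k}(k+1)\left(\sum_{k\leq k_1}|\Gamma_{k_1,0}|\right)^2-g.$$
   Context: $K$ is the algebraic closure of a finite field $\mathbb{F}_q$ and $F/K$ is a function field of one variable of genus $g$. $\mathbb{N}$ is the set of positive integers and $\mathbb{N}_0=\mathbb{N}\cup\{0\}$. $\ell(D)$ is the $K$-dimension of the Riemann-Roch space of a divisor $D$, and $(z)_\infty$ is the pole divisor of $z\in F$. A pair $(s_1,s_2)\in\mathbb{N}_0^2$ is a pure gap at $P_1,P_2$ if $\ell(s_1P_1+s_2P_2)=\ell(s_1P_1+s_2P_2-P_j)$ for all $j\in\{1,2\}$; $G_0(P_1,P_2)$ is the set of pure gaps. For a place $P$, $H(P)=\{s\in\mathbb{N}_0:(z)_\infty=sP\text{ for some }z\in F\}$ and $G(P)=\mathbb{N}_0\setminus H(P)$. $H(P_1,P_2)=\{(s_1,s_2)\in\mathbb{N}_0^2:(z)_\infty=s_1P_1+s_2P_2\text{ for some }z\in F\}$. For $\beta\in G(P_1)$, $\tau_{P_1,P_2}(\beta)=\min\{\gamma\in\mathbb{N}_0:(\beta,\gamma)\in H(P_1,P_2)\}$ (known to be a well-defined bijection $G(P_1)\to G(P_2)$), and $\Gamma(P_1,P_2)=\{(\beta,\tau_{P_1,P_2}(\beta)):\beta\in G(P_1)\}$. The period is $\pi=\min\{k\in\mathbb{N}:k(P_1-P_2)\text{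 is a principal divisor}\}$. For $k_1,k_2\in\mathbb{N}_0$, $\Gamma_{k_1,k_2}=\Gamma(P_1,P_2)\cap\left((k_1\pi,(k_1+1)\pi]\times(k_2\pi,(k_2+1)\pi]\right)$. All sums range over integers $k\ge 0$ and $k_1$, and have finitely many non-zero terms because $\Gamma(P_1,P_2)$ is finite. *)

theory Defs
  imports
    "HOL-Computational_Algebra.Polynomial"
    "HOL-Library.Groups_Big_Fun"
    "HOL-Algebra.Algebraic_Closure_Type"
begin

text \<open>
  A field extension \<open>F/K\<close> is given by two field types \<open>'k\<close> (for \<open>K\<close>) and \<open>'f\<close> (for \<open>F\<close>) and a
  field embedding \<open>\<iota> :: 'k \<Rightarrow> 'f\<close>. Valuation rings, places, divisors and the genus follow
  Stichtenoth, \<open>Algebraic Function Fields and Codes\<close>, Chapter 1.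
\<close>

definition field_embedding :: "('k::field \<Rightarrow> 'f::field) \<Rightarrow> bool" where
  "field_embedding \<iota> \<longleftrightarrow> \<iota> 1 = 1 \<and> (\<forall>x y. \<iota> (x + y) = \<iota> x + \<iota> y) \<and> (\<forall>x y. \<iota> (x * y) = \<iota> x * \<iota> y)"

definition transcendental_over :: "('k::field \<Rightarrow> 'f::field) \<Rightarrow> 'f \<Rightarrow> bool" where
  "transcendental_over \<iota> x \<longleftrightarrow> (\<forall>p. p \<noteq> 0 \<longrightarrow> Polynomial.poly (map_poly \<iota> p) x \<noteq> 0)"

text \<open>The subfield \<open>K(x)\<close> of \<open>F\<close>.\<close>

definition simple_ext :: "('k::field \<Rightarrow> 'f::field) \<Rightarrow> 'f \<Rightarrow> 'f set" where
  "simple_ext \<iota> x =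
     {Polynomial.poly (map_poly \<iota> p) x / Polynomial.poly (map_poly \<iota> q) x | p q.
        Polynomial.poly (map_poly \<iota> q) x \<noteq> 0}"

definition function_field :: "('k::field \<Rightarrow> 'f::field) \<Rightarrow> bool" where
  "function_field \<iota> \<longleftrightarrow> field_embedding \<iota> \<and>
     (\<exists>x. transcendental_over \<iota> x \<and>
        (\<exists>B. finite B \<and> (\<forall>z. \<exists>c. c ` B \<subseteq> simple_ext \<iota> x \<and> z = (\<Sum>b\<in>B. c b * b))))"

definition dim_over :: "('k::field \<Rightarrow> 'f::field) \<Rightarrow> 'f set \<Rightarrow> nat" where
  "dim_over \<iota> V = vector_space.dim (\<lambda>c z. \<iota> c * z) V"


subsection \<open>Places\<close>

definition valuation_ring :: "('k::field \<Rightarrow> 'f::field) \<Rightarrow> 'f set \<Rightarrow> bool" where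
  "valuation_ring \<iota> R \<longleftrightarrow>
     (\<forall>x\<in>R. \<forall>y\<in>R. x - y \<in> R \<and> x * y \<in> R) \<and>
     range \<iota> \<subset> R \<and> R \<subset> UNIV \<and>
     (\<forall>z. z \<noteq> 0 \<longrightarrow> z \<in> R \<or> inverse z \<in> R)"

definition ideal_of :: "'f::field set \<Rightarrow> 'f set \<Rightarrow> bool" where
  "ideal_of R I \<longleftrightarrow> I \<subseteq> R \<and> 0 \<in> I \<and> (\<forall>x\<in>I. \<forall>y\<in>I. x + y \<in> I) \<and> (\<forall>a\<in>R. \<forall>x\<in>I. a * x \<in> I)"

definition maximal_ideal_of :: "'f::field set \<Rightarrow> 'f set \<Rightarrow> bool" where
  "maximal_ideal_of R P \<longleftrightarrow> ideal_of R P \<and> P \<noteq> R \<and>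
     (\<forall>J. ideal_of R J \<longrightarrow> P \<subseteq> J \<longrightarrow> J = P \<or> J = R)"

definition is_place :: "('k::field \<Rightarrow> 'f::field) \<Rightarrow> 'f set \<Rightarrow> bool" where
  "is_place \<iota> P \<longleftrightarrow> (\<exists>R. valuation_ring \<iota> R \<and> maximal_ideal_of R P)"

text \<open>
  The valuation ring \<open>O\<^sub>P = {z. 1/z \<notin> P}\<close> of a place \<open>P\<close>. The element \<open>0\<close> is included explicitly,
  since \<open>inverse 0 = 0\<close> lies in \<open>P\<close>.
\<close>

definition place_ring :: "'f::field set \<Rightarrow> 'f set" where
  "place_ring P = {z. z = 0 \<or> inverse z \<notin> P}"

text \<open>
  The normalized discrete valuation \<open>v\<^sub>P\<close> at a nonzero element: if \<open>P = t O\<^sub>P\<close> and \<open>z = t\<^sup>n u\<close> with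
  a unit \<open>u\<close> of \<open>O\<^sub>P\<close>, then \<open>v\<^sub>P(z) = n\<close>. The value at \<open>0\<close>, which should be infinite, is not
  meaningful; every use below is restricted to nonzero elements.
\<close>

definition place_val :: "'f::field set \<Rightarrow> 'f \<Rightarrow> int" where
  "place_val P z = (THE n. \<exists>t u. P = {t * a | a. a \<in> place_ring P} \<and>
     u \<noteq> 0 \<and> u \<in> place_ring P \<and> inverse u \<in> place_ring P \<and> z = t powi n * u)"

text \<open>The degree of \<open>P\<close> is the dimension over \<open>K\<close> of \<open>O\<^sub>P/P\<close>; \<open>B\<close> represents a basis.\<close>

definition residue_basis :: "('k::field \<Rightarrow> 'f::field) \<Rightarrow> 'f set \<Rightarrow> 'f set \<Rightarrow> bool" where
  "residue_basis \<iota> P B \<longleftrightarrow> finite B \<and> B \<subseteq> place_ring P \<and>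
     (\<forall>c. (\<Sum>b\<in>B. \<iota> (c b) * b) \<in> P \<longrightarrow> (\<forall>b\<in>B. c b = 0)) \<and>
     (\<forall>z\<in>place_ring P. \<exists>c. z - (\<Sum>b\<in>B. \<iota> (c b) * b) \<in> P)"

definition place_degree :: "('k::field \<Rightarrow> 'f::field) \<Rightarrow> 'f set \<Rightarrow> nat" where
  "place_degree \<iota> P = (THE n. \<exists>B. residue_basis \<iota> P B \<and> card B = n)"


subsection \<open>Divisors, Riemann-Roch spaces, genus\<close>

text \<open>A divisor is a finitely supported integer-valued function on the places, extended by \<open>0\<close>.\<close>

definition divisor :: "('k::field \<Rightarrow> 'f::field) \<Rightarrow> ('f set \<Rightarrow> int) \<Rightarrow> bool" where
  "divisor \<iota> D \<longleftrightarrow> finite {P. D P \<noteq> 0} \<and> (\<forall>P. D P \<noteq> 0 \<longrightarrow> is_place \<iota> P)"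

definition divisor_degree :: "('k::field \<Rightarrow> 'f::field) \<Rightarrow> ('f set \<Rightarrow> int) \<Rightarrow> int" where
  "divisor_degree \<iota> D = (\<Sum>P | D P \<noteq> 0. D P * int (place_degree \<iota> P))"

definition point_divisor :: "'f set \<Rightarrow> 'f set \<Rightarrow> int" where
  "point_divisor P = (\<lambda>Q. if Q = P then 1 else 0)"

definition two_point_divisor :: "'f set \<Rightarrow> 'f set \<Rightarrow> int \<Rightarrow> int \<Rightarrow> 'f set \<Rightarrow> int" where
  "two_point_divisor P\<^sub>1 P\<^sub>2 a b = (\<lambda>Q. a * point_divisor P\<^sub>1 Q + b * point_divisor P\<^sub>2 Q)"

definition principal_divisor :: "('k::field \<Rightarrow> 'f::field) \<Rightarrow> 'f \<Rightarrow> 'f set \<Rightarrow> int" where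
  "principal_divisor \<iota> z = (\<lambda>P. if is_place \<iota> P then place_val P z else 0)"

definition pole_divisor :: "('k::field \<Rightarrow> 'f::field) \<Rightarrow> 'f \<Rightarrow> 'f set \<Rightarrow> int" where
  "pole_divisor \<iota> z = (\<lambda>P. if is_place \<iota> P \<and> place_val P z < 0 then - place_val P z else 0)"

definition riemann_roch_space :: "('k::field \<Rightarrow> 'f::field) \<Rightarrow> ('f set \<Rightarrow> int) \<Rightarrow> 'f set" where
  "riemann_roch_space \<iota> D = {z. z = 0 \<or> (\<forall>P. is_place \<iota> P \<longrightarrow> place_val P z \<ge> - D P)}"

definition ell :: "('k::field \<Rightarrow> 'f::field) \<Rightarrow> ('f set \<Rightarrow> int) \<Rightarrow> nat" where
  "ell \<iota> D = dim_over \<iota> (riemann_roch_space \<iota> D)"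

definition genus :: "('k::field \<Rightarrow> 'f::field) \<Rightarrow> int" where
  "genus \<iota> = (GREATEST g. \<exists>D. divisor \<iota> D \<and> g = divisor_degree \<iota> D - int (ell \<iota> D) + 1)"


subsection \<open>Weierstrass semigroups, gaps and pure gaps\<close>

definition pure_gaps :: "('k::field \<Rightarrow> 'f::field) \<Rightarrow> 'f set \<Rightarrow> 'f set \<Rightarrow> (nat \<times> nat) set" where
  "pure_gaps \<iota> P\<^sub>1 P\<^sub>2 = {(s\<^sub>1, s\<^sub>2).
     ell \<iota> (two_point_divisor P\<^sub>1 P\<^sub>2 (int s\<^sub>1) (int s\<^sub>2)) =
       ell \<iota> (two_point_divisor P\<^sub>1 P\<^sub>2 (int s\<^sub>1 - 1) (int s\<^sub>2)) \<and>
     ell \<iota> (two_point_divisor P\<^sub>1 P\<^sub>2 (int s\<^sub>1) (int s\<^sub>2)) =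
       ell \<iota> (two_point_divisor P\<^sub>1 P\<^sub>2 (int s\<^sub>1) (int s\<^sub>2 - 1))}"

definition pole_numbers :: "('k::field \<Rightarrow> 'f::field) \<Rightarrow> 'f set \<Rightarrow> nat set" where
  "pole_numbers \<iota> P = {s. \<exists>z. z \<noteq> 0 \<and> pole_divisor \<iota> z = (\<lambda>Q. int s * point_divisor P Q)}"

definition gaps :: "('k::field \<Rightarrow> 'f::field) \<Rightarrow> 'f set \<Rightarrow> nat set" where
  "gaps \<iota> P = - pole_numbers \<iota> P"

definition pole_pairs :: "('k::field \<Rightarrow> 'f::field) \<Rightarrow> 'f set \<Rightarrow> 'f set \<Rightarrow> (nat \<times> nat) set" where
  "pole_pairs \<iota> P\<^sub>1 P\<^sub>2 = {(s\<^sub>1, s\<^sub>2). \<exists>z. z \<noteq> 0 \<and>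
     pole_divisor \<iota> z = two_point_divisor P\<^sub>1 P\<^sub>2 (int s\<^sub>1) (int s\<^sub>2)}"

definition tau :: "('k::field \<Rightarrow> 'f::field) \<Rightarrow> 'f set \<Rightarrow> 'f set \<Rightarrow> nat \<Rightarrow> nat" where
  "tau \<iota> P\<^sub>1 P\<^sub>2 \<beta> = (LEAST \<gamma>. (\<beta>, \<gamma>) \<in> pole_pairs \<iota> P\<^sub>1 P\<^sub>2)"

definition Gamma :: "('k::field \<Rightarrow> 'f::field) \<Rightarrow> 'f set \<Rightarrow> 'f set \<Rightarrow> (nat \<times> nat) set" where
  "Gamma \<iota> P\<^sub>1 P\<^sub>2 = {(\<beta>, tau \<iota> P\<^sub>1 P\<^sub>2 \<beta>) | \<beta>. \<beta> \<in> gaps \<iota> P\<^sub>1}"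

definition period :: "('k::field \<Rightarrow> 'f::field) \<Rightarrow> 'f set \<Rightarrow> 'f set \<Rightarrow> nat" where
  "period \<iota> P\<^sub>1 P\<^sub>2 = (LEAST k. k > 0 \<and>
     (\<exists>z. z \<noteq> 0 \<and> two_point_divisor P\<^sub>1 P\<^sub>2 (int k) (- int k) = principal_divisor \<iota> z))"

definition Gamma_block ::
    "('k::field \<Rightarrow> 'f::field) \<Rightarrow> 'f set \<Rightarrow> 'f set \<Rightarrow> nat \<Rightarrow> nat \<Rightarrow> (nat \<times> nat) set" where
  "Gamma_block \<iota> P\<^sub>1 P\<^sub>2 k\<^sub>1 k\<^sub>2 = (let \<pi> = period \<iota> P\<^sub>1 P\<^sub>2 in
     Gamma \<iota> P\<^sub>1 P\<^sub>2 \<inter> ({k\<^sub>1 * \<pi> <.. (k\<^sub>1 + 1) * \<pi>} \<times> {k\<^sub>2 * \<pi> <.. (k\<^sub>2 + 1) * \<pi>}))"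

end

theory Submission
  imports Defs
begin

text \<open>
  Write \<open>\<ell>(a, b)\<close> for the dimension of \<open>L(a P\<^sub>1 + b P\<^sub>2)\<close>. For every integer \<open>a\<close> there is a least \<open>T a\<close> such
  that some function has pole order exactly \<open>a\<close> at \<open>P\<^sub>1\<close>, at most \<open>T a\<close> at \<open>P\<^sub>2\<close>, and no other poles. Then
  \<open>T\<close> is a bijection of the integers, it extends \<open>\<tau>\<close>, and a pair \<open>(s, t)\<close> is a pure gap if and only if
  \<open>s < T\<^sup>-\<^sup>1 t\<close> and \<open>t < T s\<close>. So pure gaps correspond to the inversions of \<open>T\<close> on the set of gaps of \<open>P\<^sub>1\<close>,
  which has \<open>g\<close> elements by Riemann's theorem.

  A function with divisor \<open>\<pi> (P\<^sub>1 - P\<^sub>2)\<close> gives \<open>T (a + \<pi>) = T a - \<pi>\<close>, hence \<open>\<Gamma>\<^bsub>i,j\<^esub>\<close> has as many elements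
  as \<open>\<Gamma>\<^bsub>i+j,0\<^esub>\<close>. Two points of \<open>\<Gamma>\<close> form an inversion if their block indices are inverted strictly, and only
  if they are inverted weakly; counting pairs of blocks gives the two sums. The \<open>g\<close> pairs of equal points
  are inverted weakly but are not inversions.

  That the period exists is a form of the finiteness of the class number: an iterate of the Frobenius
  automorphism of \<open>K\<close> extends to \<open>F\<close> so that every place has a finite orbit, and there are only finitely
  many invariant effective divisors of bounded degree.
\<close>

text \<open>One finiteness fact carries the general theory: for every z in F, families independent
  over K(z) have bounded size. Discreteness of places, residue field K, finiteness of zeros and the
  equality of the numbers of zeros and poles all come from exhibiting independent families. As K is
  algebraically closed, every place has degree one, so raising one coefficient of a divisor by one
  changes the dimension by 0 or 1. This rigidity makes T bijective: in a unit square of values of l,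
  a jump in one direction at a corner forces one in the other.

  The finite base field matters for the period: over a general algebraically closed field no
  multiple of \<open>P\<^sub>1 - P\<^sub>2\<close> need be principal.

  A residue class modulo the period contributes a chain of gaps in the blocks (0, s), (1, s - 1),
  ..., (s, 0), and only its last point lies in a block with second index 0. An ordered pair of
  chains with parameters s and s' has 1 + 2 + ... + min(s, s') strictly inverted pairs of points;
  sorting these sums by level k yields the weights k + 1 and the squares. Weak inversion replaces s
  and s' by s + 1 and s' + 1.\<close>

locale alg_closed_function_field =
  fixes \<iota> :: "'k::alg_closed_field \<Rightarrow> 'f::field"
  assumes function_field: "function_field \<iota>"
begin

subsection \<open>Independence over \<open>K(x)\<close>\<close>

lemma field_embedding: "field_embedding \<iota>"
  using function_field by (simp add: function_field_def)

lemma emb_1 [simp]: "\<iota> 1 = 1"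
  and emb_add [simp]: "\<iota> (a + b) = \<iota> a + \<iota> b"
  and emb_mult [simp]: "\<iota> (a * b) = \<iota> a * \<iota> b"
  using field_embedding by (auto simp: field_embedding_def)

lemma emb_0 [simp]: "\<iota> 0 = 0"
  using emb_add[of 0 0] unfolding add_0_right by (metis add_cancel_right_right)

lemma emb_minus [simp]: "\<iota> (- a) = - \<iota> a"
  using emb_add[of a "- a"] by (simp del: emb_add add: eq_neg_iff_add_eq_0 add.commute)

lemma emb_diff [simp]: "\<iota> (a - b) = \<iota> a - \<iota> b"
  using emb_add[of a "- b"] by (simp del: emb_add)

lemma emb_eq_0_iff [simp]: "\<iota> a = 0 \<longleftrightarrow> a = 0"
proof
  show "a = 0" if "\<iota> a = 0"
  proof (rule ccontr)
    assume "a \<noteq> 0"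
    then have "\<iota> a * \<iota> (inverse a) = 1"
      by (simp flip: emb_mult)
    then show False using that by simp
  qed
qed simp

lemma emb_eq_iff [simp]: "\<iota> a = \<iota> b \<longleftrightarrow> a = b"
  using emb_eq_0_iff[of "a - b"] by (simp del: emb_eq_0_iff)

lemma emb_inverse [simp]: "\<iota> (inverse a) = inverse (\<iota> a)"
proof (cases "a = 0")
  case False
  then have "\<iota> a * \<iota> (inverse a) = 1"
    by (simp flip: emb_mult)
  then show ?thesis by (metis inverse_unique)
qed simp

sublocale vs: vector_space "\<lambda>c z. \<iota> c * z"
  by unfold_locales (auto simp: algebra_simps)

declare vs.scale_scale [simp del]

section \<open>Evaluation of polynomials over K at elements of F\<close>

definition ev :: "'k poly \<Rightarrow> 'f \<Rightarrow> 'f" where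
  "ev p z = Polynomial.poly (map_poly \<iota> p) z"

lemma ev_pCons [simp]: "ev (pCons a p) z = \<iota> a + z * ev p z"
  by (simp add: ev_def map_poly_pCons)

lemma ev_0 [simp]: "ev 0 z = 0"
  by (simp add: ev_def)

lemma ev_1 [simp]: "ev 1 z = 1"
  by (simp add: one_pCons)

lemma ev_smult [simp]: "ev (Polynomial.smult c p) z = \<iota> c * ev p z"
  by (induction p) (auto simp: algebra_simps)

lemma ev_add [simp]: "ev (p + q) z = ev p z + ev q z"
proof (induction p arbitrary: q)
  case (pCons a p)
  then show ?case by (cases q) (auto simp: algebra_simps)
qed simp

lemma ev_mult [simp]: "ev (p * q) z = ev p z * ev q z"
  by (induction p) (auto simp: algebra_simps)

lemma ev_minus [simp]: "ev (- p) z = - ev p z"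
  by (induction p) auto

lemma ev_diff [simp]: "ev (p - q) z = ev p z - ev q z"
  using ev_add[of p "- q"] by (simp del: ev_add)

lemma ev_power [simp]: "ev (p ^ n) z = ev p z ^ n"
  by (induction n) auto

lemma ev_monom [simp]: "ev (Polynomial.monom c n) z = \<iota> c * z ^ n"
  by (induction n) (auto simp: monom_0 monom_Suc)

lemma ev_sum: "ev (sum h A) z = (\<Sum>a\<in>A. ev (h a) z)"
  by (induction A rule: infinite_finite_induct) auto

lemma ev_altdef: "Polynomial.degree p \<le> n \<Longrightarrow> ev p z = (\<Sum>i\<le>n. \<iota> (Polynomial.coeff p i) * z ^ i)"
proof (induction p arbitrary: n)
  case (pCons a p)
  show ?case
  proof (cases n)
    case 0
    then have "p = 0" using pCons.prems by (auto split: if_splits)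
    then show ?thesis using 0 by simp
  next
    case (Suc m)
    then have "Polynomial.degree p \<le> m" using pCons.prems by (auto split: if_splits)
    from pCons.IH[OF this] show ?thesis
      unfolding Suc sum.atMost_Suc_shift by (simp add: sum_distrib_left mult_ac)
  qed
qed simp

text \<open>Linear independence over K(x) with denominators cleared, so that only polynomial
  coefficients occur. For constant x every nonempty family is dependent, so bounds on the size of
  independent families hold there trivially.\<close>

definition indep_over :: "'f \<Rightarrow> ('i \<Rightarrow> 'f) \<Rightarrow> 'i set \<Rightarrow> bool" where
  "indep_over x h I \<longleftrightarrow> (\<forall>p. (\<Sum>i\<in>I. ev (p i) x * h i) = 0 \<longrightarrow> (\<forall>i\<in>I. p i = 0))"

definition indep_family :: "('i \<Rightarrow> 'f) \<Rightarrow> 'i set \<Rightarrow> bool" where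
  "indep_family h I \<longleftrightarrow> (\<forall>c. (\<Sum>i\<in>I. \<iota> (c i) * h i) = 0 \<longrightarrow> (\<forall>i\<in>I. c i = 0))"

lemma indep_family_inj:
  assumes "finite I" "indep_family h I"
  shows "inj_on h I"
proof (rule inj_onI, rule ccontr)
  fix i j assume *: "i \<in> I" "j \<in> I" "h i = h j" "i \<noteq> j"
  let ?c = "\<lambda>k. if k = i then 1 else if k = j then -1 else (0::'k)"
  have "(\<Sum>k\<in>I. \<iota> (?c k) * h k) = (\<Sum>k\<in>{i,j}. \<iota> (?c k) * h k)"
    using * assms(1) by (intro sum.mono_neutral_right) auto
  also have "\<dots> = 0" using * by simp
  finally have "\<forall>k\<in>I. ?c k = 0"
    using assms(2) unfolding indep_family_def by (elim allE[of _ ?c]) blast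
  with *(1) show False by auto
qed

lemma indep_family_independent:
  assumes "finite I" "indep_family h I"
  shows "vs.independent (h ` I)"
proof -
  note inj = indep_family_inj[OF assms]
  show ?thesis
    unfolding vs.dependent_finite[OF finite_imageI[OF assms(1)]]
  proof (intro notI, elim exE conjE bexE)
    fix u v assume v: "v \<in> h ` I" "u v \<noteq> 0" and s: "(\<Sum>v\<in>h ` I. \<iota> (u v) * v) = 0"
    have "(\<Sum>i\<in>I. \<iota> (u (h i)) * h i) = 0"
      using s by (simp add: sum.reindex[OF inj])
    with assms(2) have "\<forall>i\<in>I. u (h i) = 0"
      unfolding indep_family_def by (auto dest: spec[where x = "\<lambda>i. u (h i)"])
    with v show False by auto
  qed
qed

lemma indep_family_card_le:
  assumes "finite I" "indep_family h I" "finite T" "h ` I \<subseteq> vs.span T"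
  shows "card I \<le> card T"
  using vs.independent_span_bound[OF assms(3) indep_family_independent[OF assms(1,2)] assms(4)]
    card_image[OF indep_family_inj[OF assms(1,2)]] by metis

text \<open>A K-linear relation among the products \<open>x ^ j * h i\<close>, collected by
  \<open>i\<close>, is a relation among the \<open>h i\<close> with polynomial coefficients. This
  converts independence over K(x) into K-dimensions that grow linearly in \<open>m\<close>.\<close>

lemma indep_over_powers:
  assumes "finite I" "indep_over x h I"
  shows "indep_family (\<lambda>(i, j). x ^ j * h i) (I \<times> {..m})"
  unfolding indep_family_def
proof (intro allI impI ballI)
  fix c ij assume z: "(\<Sum>k\<in>I \<times> {..m}. \<iota> (c k) * (case k of (i, j) \<Rightarrow> x ^ j * h i)) = 0"
    and ij: "ij \<in> I \<times> {..m}"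
  define p where "p i = (\<Sum>j\<le>m. Polynomial.monom (c (i, j)) j)" for i
  have "(\<Sum>i\<in>I. ev (p i) x * h i) = (\<Sum>i\<in>I. \<Sum>j\<le>m. \<iota> (c (i, j)) * (x ^ j * h i))"
    by (simp add: p_def ev_sum sum_distrib_right mult.assoc)
  also have "\<dots> = 0" using z by (simp add: sum.cartesian_product case_prod_unfold)
  finally have "\<forall>i\<in>I. p i = 0"
    using assms(2) unfolding indep_over_def by blast
  with ij obtain i j where ij': "ij = (i, j)" "i \<in> I" "j \<le> m" "p i = 0" by auto
  have "Polynomial.coeff (p i) j = c (i, j)"
    unfolding p_def coeff_sum using ij'(3) by (simp add: sum.delta)
  then show "c ij = 0" using ij' by simp
qed

end

text \<open>The dimension over \<open>K\<close> of the space \<open>W e\<close> below grows linearly in \<open>e\<close> with slope \<open>card B\<close>.\<close>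

locale function_field_generators = alg_closed_function_field \<iota>
  for \<iota> :: "'k::alg_closed_field \<Rightarrow> 'f::field" +
  fixes x :: 'f and B :: "'f set"
  assumes transcendental: "transcendental_over \<iota> x"
    and finite_B: "finite B"
    and spanning: "\<exists>c. c ` B \<subseteq> simple_ext \<iota> x \<and> z = (\<Sum>b\<in>B. c b * b)"
begin

lemma ev_x_eq_0_iff [simp]: "ev p x = 0 \<longleftrightarrow> p = 0"
  using transcendental by (auto simp: transcendental_over_def ev_def)

lemma common_denominator:
  assumes "finite I"
  shows "\<exists>d p. d \<noteq> 0 \<and> (\<forall>i\<in>I. ev d x * h i = (\<Sum>b\<in>B. ev (p i b) x * b))"
proof -
  have single: "\<exists>d p. d \<noteq> 0 \<and> ev d x * z = (\<Sum>b\<in>B. ev (p b) x * b)" for z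
  proof -
    obtain c where c: "c ` B \<subseteq> simple_ext \<iota> x" and z: "z = (\<Sum>b\<in>B. c b * b)"
      using spanning by blast
    have "\<forall>b\<in>B. \<exists>pq. c b = ev (fst pq) x / ev (snd pq) x \<and> ev (snd pq) x \<noteq> 0"
      using c by (force simp: simple_ext_def ev_def)
    then obtain pq where pq: "\<forall>b\<in>B. c b = ev (fst (pq b)) x / ev (snd (pq b)) x \<and> ev (snd (pq b)) x \<noteq> 0"
      by metis
    define d where "d = (\<Prod>b\<in>B. snd (pq b))"
    have d: "d \<noteq> 0" using pq finite_B by (auto simp: d_def)
    have "ev d x * c b = ev ((\<Prod>b'\<in>B - {b}. snd (pq b')) * fst (pq b)) x" if "b \<in> B" for b
    proof -
      have "d = snd (pq b) * (\<Prod>b'\<in>B - {b}. snd (pq b'))"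
        unfolding d_def using finite_B that by (rule prod.remove)
      then show ?thesis using pq that by (simp add: field_simps)
    qed
    then have "ev d x * z = (\<Sum>b\<in>B. ev ((\<Prod>b'\<in>B - {b}. snd (pq b')) * fst (pq b)) x * b)"
      unfolding z sum_distrib_left by (intro sum.cong refl) (simp add: mult.assoc[symmetric] del: ev_mult)
    with d show ?thesis
      by (intro exI[of _ d] exI[of _ "\<lambda>b. (\<Prod>b'\<in>B - {b}. snd (pq b')) * fst (pq b)"]) simp
  qed
  show ?thesis using assms
  proof (induction I)
    case empty
    show ?case by (rule exI[of _ 1]) auto
  next
    case (insert j I)
    obtain d p where d: "d \<noteq> 0" "\<forall>i\<in>I. ev d x * h i = (\<Sum>b\<in>B. ev (p i b) x * b)"
      using insert.IH by blast
    obtain e q where e: "e \<noteq> 0" "ev e x * h j = (\<Sum>b\<in>B. ev (q b) x * b)"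
      using single by blast
    let ?p = "\<lambda>i b. if i = j then d * q b else e * p i b"
    have "ev (d * e) x * h i = (\<Sum>b\<in>B. ev (?p i b) x * b)" if "i \<in> insert j I" for i
    proof (cases "i = j")
      case True
      have "ev (d * e) x * h j = ev d x * (\<Sum>b\<in>B. ev (q b) x * b)"
        by (simp add: e(2)[symmetric])
      then show ?thesis using True by (simp add: sum_distrib_left mult_ac)
    next
      case False
      then have "ev (d * e) x * h i = ev e x * (\<Sum>b\<in>B. ev (p i b) x * b)"
        using that d(2) by (simp add: mult_ac flip: d(2))
      then show ?thesis using False by (simp add: sum_distrib_left mult_ac)
    qed
    with d(1) e(1) show ?case
      by (intro exI[of _ "d * e"] exI[of _ ?p]) auto
  qed
qed

definition W :: "nat \<Rightarrow> 'f set" where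
  "W e = {\<Sum>b\<in>B. ev (p b) x * b | p. \<forall>b. Polynomial.degree (p b) \<le> e}"

lemma W_I: "(\<And>b. b \<in> B \<Longrightarrow> Polynomial.degree (p b) \<le> e) \<Longrightarrow> (\<Sum>b\<in>B. ev (p b) x * b) \<in> W e"
  unfolding W_def
  by (intro CollectI exI[of _ "\<lambda>b. if b \<in> B then p b else 0"]) (auto intro!: sum.cong)

lemma W_span: "W e \<subseteq> vs.span ((\<lambda>(i, b). x ^ i * b) ` ({..e} \<times> B))"
proof
  fix z assume "z \<in> W e"
  then obtain p where p: "\<forall>b. Polynomial.degree (p b) \<le> e" and z: "z = (\<Sum>b\<in>B. ev (p b) x * b)"
    by (auto simp: W_def)
  have eq: "z = (\<Sum>b\<in>B. \<Sum>i\<le>e. \<iota> (Polynomial.coeff (p b) i) * (x ^ i * b))"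
    unfolding z using p by (intro sum.cong refl) (simp add: ev_altdef[of _ e] sum_distrib_right mult.assoc)
  then show "z \<in> vs.span ((\<lambda>(i, b). x ^ i * b) ` ({..e} \<times> B))"
    unfolding eq by (intro vs.span_sum vs.span_scale vs.span_base) force
qed

lemma W_mult:
  assumes "w \<in> W e" "Polynomial.degree q \<le> c"
  shows "ev q x * w \<in> W (e + c)"
proof -
  obtain p where p: "\<forall>b. Polynomial.degree (p b) \<le> e" and w: "w = (\<Sum>b\<in>B. ev (p b) x * b)"
    using assms(1) by (auto simp: W_def)
  have eq: "ev q x * w = (\<Sum>b\<in>B. ev (q * p b) x * b)"
    unfolding w by (simp add: sum_distrib_left mult_ac)
  have "Polynomial.degree (q * p b) \<le> e + c" for b
    using degree_mult_le[of q "p b"] p assms(2) by (smt (verit) add.commute add_mono order_trans)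
  then show ?thesis unfolding eq by (intro W_I)
qed

text \<open>Multiplication by z is given on \<open>B\<close> by a matrix over K(x); \<open>d\<close>
  clears its denominators and \<open>c\<close> bounds the degrees that result. Both are independent
  of \<open>e\<close>, so iterating raises the degree linearly.\<close>

lemma W_mult_elem: "\<exists>d c. d \<noteq> 0 \<and> Polynomial.degree d \<le> c \<and> (\<forall>e. \<forall>w\<in>W e. ev d x * (z * w) \<in> W (e + c))"
proof -
  obtain d q where d: "d \<noteq> 0" and q: "\<forall>b'\<in>B. ev d x * (z * b') = (\<Sum>b\<in>B. ev (q b' b) x * b)"
    using common_denominator[OF finite_B, of "\<lambda>b. z * b"] by blast
  define c where "c = Max (insert (Polynomial.degree d) ((\<lambda>(b', b). Polynomial.degree (q b' b)) ` (B \<times> B)))"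
  have c: "Polynomial.degree d \<le> c" "b' \<in> B \<Longrightarrow> b \<in> B \<Longrightarrow> Polynomial.degree (q b' b) \<le> c" for b b'
    unfolding c_def using finite_B by (auto intro!: Max_ge)
  have "ev d x * (z * w) \<in> W (e + c)" if w_in: "w \<in> W e" for e w
  proof -
    obtain p where p: "\<forall>b. Polynomial.degree (p b) \<le> e" and w: "w = (\<Sum>b\<in>B. ev (p b) x * b)"
      using w_in by (auto simp: W_def)
    have "ev d x * (z * w) = (\<Sum>b'\<in>B. ev (p b') x * (ev d x * (z * b')))"
      unfolding w by (simp add: sum_distrib_left mult_ac)
    also have "\<dots> = (\<Sum>b'\<in>B. \<Sum>b\<in>B. ev (p b' * q b' b) x * b)"
    proof (intro sum.cong refl)
      fix b' assume "b' \<in> B"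
      then show "ev (p b') x * (ev d x * (z * b')) = (\<Sum>b\<in>B. ev (p b' * q b' b) x * b)"
        using q by (simp add: sum_distrib_left mult.assoc)
    qed
    also have "\<dots> = (\<Sum>b\<in>B. ev (\<Sum>b'\<in>B. p b' * q b' b) x * b)"
      by (subst sum.swap) (simp add: ev_sum sum_distrib_right)
    also have "\<dots> \<in> W (e + c)"
      using p c finite_B
      by (intro W_I degree_sum_le) (auto intro!: order_trans[OF degree_mult_le] add_mono)
    finally show ?thesis .
  qed
  with d c(1) show ?thesis by blast
qed

text \<open>After multiplication by one common factor, the elements \<open>z ^ j * h i\<close> with
  \<open>j \<le> m\<close> all lie in \<open>W (e0 + c * m)\<close>. They number
  \<open>card I * (m + 1)\<close>, the dimension of that space is at most
  \<open>card B * (e0 + c * m + 1)\<close>, and for large \<open>m\<close> this forces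
  \<open>card I \<le> card B * c\<close>.\<close>

lemma indep_over_bounded':
  "\<exists>N. \<forall>(I::'i set) h. finite I \<longrightarrow> indep_over z h I \<longrightarrow> card I \<le> N"
proof -
  obtain d c where d: "d \<noteq> 0" "Polynomial.degree d \<le> c"
    and step: "\<And>e w. w \<in> W e \<Longrightarrow> ev d x * (z * w) \<in> W (e + c)"
    using W_mult_elem by meson
  have "card I \<le> card B * c" if I: "finite I" "indep_over z h I" for I :: "'i set" and h
  proof (rule ccontr)
    assume "\<not> card I \<le> card B * c"
    then have big: "card B * c + 1 \<le> card I" by simp
    obtain d0 p where d0: "d0 \<noteq> 0" "\<forall>i\<in>I. ev d0 x * h i = (\<Sum>b\<in>B. ev (p i b) x * b)"
      using common_denominator[OF I(1)] by blast
    define e0 where "e0 = Max (insert 0 ((\<lambda>(i, b). Polynomial.degree (p i b)) ` (I \<times> B)))"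
    have base: "ev d0 x * h i \<in> W e0" if "i \<in> I" for i
      using d0 that I(1) finite_B by (auto simp: e0_def intro!: W_I Max_ge)
    \<comment> \<open>The full power \<open>m\<close> of \<open>d\<close> is used even when
      \<open>j < m\<close>, so that the same factor serves all exponents at once.\<close>
    have pow: "ev d x ^ m * (z ^ j * w) \<in> W (e + c * m)" if "w \<in> W e" "j \<le> m" for m j w e
      using that
    proof (induction m arbitrary: j)
      case (Suc m)
      show ?case
      proof (cases j)
        case 0
        have "ev d x * (ev d x ^ m * w) \<in> W (e + c * m + c)"
          using Suc.IH[of 0] Suc.prems d(2) by (intro W_mult) auto
        then show ?thesis using 0 by (simp add: algebra_simps)
      next
        case (Suc j')
        have "ev d x * (z * (ev d x ^ m * (z ^ j' * w))) \<in> W (e + c * m + c)"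
          using Suc.IH[of j'] Suc.prems Suc by (intro step) auto
        then show ?thesis using Suc by (simp add: algebra_simps)
      qed
    qed simp
    have "card I * (m + 1) \<le> card B * (e0 + c * m + 1)" for m
    proof -
      let ?T = "(\<lambda>(i, b). x ^ i * b) ` ({..e0 + c * m} \<times> B)"
      let ?u = "ev d0 x * ev d x ^ m"
      let ?g = "\<lambda>k. ?u * (case k of (i, j) \<Rightarrow> z ^ j * h i)"
      have u: "?u \<noteq> 0" using d(1) d0(1) by simp
      have "indep_family ?g (I \<times> {..m})"
        unfolding indep_family_def
      proof (intro allI impI)
        fix a assume "(\<Sum>k\<in>I \<times> {..m}. \<iota> (a k) * ?g k) = 0"
        moreover have "(\<Sum>k\<in>I \<times> {..m}. \<iota> (a k) * ?g k) =
            ?u * (\<Sum>k\<in>I \<times> {..m}. \<iota> (a k) * (case k of (i, j) \<Rightarrow> z ^ j * h i))"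
          by (simp add: sum_distrib_left mult.left_commute)
        ultimately have "(\<Sum>k\<in>I \<times> {..m}. \<iota> (a k) * (case k of (i, j) \<Rightarrow> z ^ j * h i)) = 0"
          using u by (metis mult_eq_0_iff)
        then show "\<forall>k\<in>I \<times> {..m}. a k = 0"
          using indep_over_powers[OF I] unfolding indep_family_def by blast
      qed
      moreover have "?g ` (I \<times> {..m}) \<subseteq> vs.span ?T"
      proof -
        have "?g (i, j) \<in> W (e0 + c * m)" if "i \<in> I" "j \<le> m" for i j
          using pow[OF base[OF that(1)] that(2)] by (simp add: mult_ac)
        then show ?thesis using W_span by fastforce
      qed
      ultimately have "card (I \<times> {..m}) \<le> card ?T"
        using I(1) finite_B by (intro indep_family_card_le) auto
      also have "\<dots> \<le> card ({..e0 + c * m} \<times> B)"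
        using finite_B by (intro card_image_le) auto
      finally show ?thesis by (simp add: card_cartesian_product mult_ac)
    qed
    \<comment> \<open>The two sides have slopes \<open>card I\<close> and \<open>card B * c\<close>
      in \<open>m\<close>. This \<open>m\<close> equals the constant term on the right, which
      suffices to refute a larger slope on the left.\<close>
    from this[of "card B * (e0 + 1)"]
    have "card I * (card B * (e0 + 1) + 1) \<le> card B * (e0 + 1) + card B * c * (card B * (e0 + 1))"
      by (simp add: algebra_simps)
    moreover have "(card B * c + 1) * (card B * (e0 + 1) + 1) \<le> card I * (card B * (e0 + 1) + 1)"
      using big by (intro mult_right_mono) auto
    ultimately show False by (simp add: algebra_simps)
  qed
  then show ?thesis by blast
qed

end

context alg_closed_function_field
begin

lemma ex_generators: "\<exists>x B. function_field_generators \<iota> x B"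
proof -
  obtain x B where "transcendental_over \<iota> x" "finite B"
    "\<forall>z. \<exists>c. c ` B \<subseteq> simple_ext \<iota> x \<and> z = (\<Sum>b\<in>B. c b * b)"
    using function_field by (auto simp: function_field_def)
  then have "function_field_generators \<iota> x B"
    by unfold_locales auto
  then show ?thesis by blast
qed

text \<open>For nonconstant z this is the finiteness of F over K(z), now for every z and not only
  for the x that presents F.\<close>

lemma indep_over_bounded:
  "\<exists>N. \<forall>(I::'i set) h. finite I \<longrightarrow> indep_over z h I \<longrightarrow> card I \<le> N"
proof -
  obtain x B where "function_field_generators \<iota> x B"
    using ex_generators by blast
  then interpret function_field_generators \<iota> x B .
  show ?thesis by (rule indep_over_bounded')
qed

text \<open>A nontrivial relation can be divided by x until some coefficient has a nonzero constant
  term, so only relations of that kind have to be excluded.\<close>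

lemma indep_overI:
  assumes "x \<noteq> 0" "finite I"
    and nz: "\<And>p i. i \<in> I \<Longrightarrow> Polynomial.coeff (p i) 0 \<noteq> 0 \<Longrightarrow> (\<Sum>i\<in>I. ev (p i) x * h i) \<noteq> 0"
  shows "indep_over x h I"
proof -
  have key: "\<forall>i\<in>I. p i = 0"
    if "\<forall>i\<in>I. p i = 0 \<or> Polynomial.degree (p i) < n" "(\<Sum>i\<in>I. ev (p i) x * h i) = 0" for p n
    using that
  proof (induction n arbitrary: p)
    case (Suc n)
    have "\<forall>i. \<exists>q. i \<in> I \<longrightarrow> p i = pCons 0 q"
    proof
      fix i
      show "\<exists>q. i \<in> I \<longrightarrow> p i = pCons 0 q"
        using nz[of i p] Suc.prems(2) by (cases "p i") auto
    qed
    then obtain q where q: "\<And>i. i \<in> I \<Longrightarrow> p i = pCons 0 (q i)" by metis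
    have "x * (\<Sum>i\<in>I. ev (q i) x * h i) = (\<Sum>i\<in>I. ev (p i) x * h i)"
      unfolding sum_distrib_left by (intro sum.cong refl) (simp add: q mult.assoc)
    then have "(\<Sum>i\<in>I. ev (q i) x * h i) = 0"
      using Suc.prems(2) assms(1) by (metis mult_eq_0_iff)
    moreover have "\<forall>i\<in>I. q i = 0 \<or> Polynomial.degree (q i) < n"
    proof
      fix i assume "i \<in> I"
      with Suc.prems(1) have "p i = 0 \<or> Polynomial.degree (p i) < Suc n" by blast
      then show "q i = 0 \<or> Polynomial.degree (q i) < n"
        by (auto simp: q[OF \<open>i \<in> I\<close>] degree_pCons_eq_if split: if_splits)
    qed
    ultimately have "\<forall>i\<in>I. q i = 0"
      using Suc.IH[of q] by blast
    then show ?case using q by simp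
  qed simp
  show ?thesis
    unfolding indep_over_def
  proof (intro allI impI)
    fix p assume "(\<Sum>i\<in>I. ev (p i) x * h i) = 0"
    moreover have "\<forall>i\<in>I. p i = 0 \<or> Polynomial.degree (p i) < Suc (Max ((\<lambda>i. Polynomial.degree (p i)) ` I))"
      using assms(2) by (simp add: less_Suc_eq_le)
    ultimately show "\<forall>i\<in>I. p i = 0" by (rule key[rotated])
  qed
qed

subsection \<open>Valuation rings\<close>

lemma
  assumes "valuation_ring \<iota> R"
  shows vr_diff: "z \<in> R \<Longrightarrow> w \<in> R \<Longrightarrow> z - w \<in> R"
    and vr_mult: "z \<in> R \<Longrightarrow> w \<in> R \<Longrightarrow> z * w \<in> R"
    and vr_emb: "\<iota> c \<in> R"
    and vr_proper: "\<exists>z. z \<notin> R"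
    and vr_or: "z \<in> R \<or> inverse z \<in> R"
    and vr_0: "0 \<in> R"
    and vr_1: "1 \<in> R"
proof -
  note a = assms[unfolded valuation_ring_def]
  show "z \<in> R \<Longrightarrow> w \<in> R \<Longrightarrow> z - w \<in> R" "z \<in> R \<Longrightarrow> w \<in> R \<Longrightarrow> z * w \<in> R" "\<iota> c \<in> R" "\<exists>z. z \<notin> R"
    using a by blast+
  have "\<iota> 0 \<in> R" "\<iota> 1 \<in> R" using a by blast+
  then show "0 \<in> R" "1 \<in> R" by simp_all
  then show "z \<in> R \<or> inverse z \<in> R"
    using a by (cases "z = 0") auto
qed

lemma vr_minus: "valuation_ring \<iota> R \<Longrightarrow> z \<in> R \<Longrightarrow> - z \<in> R"
  using vr_diff[of R 0 z] vr_0 by auto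

lemma vr_add: "valuation_ring \<iota> R \<Longrightarrow> z \<in> R \<Longrightarrow> w \<in> R \<Longrightarrow> z + w \<in> R"
  using vr_diff[of R z "- w"] vr_minus by auto

lemma vr_power: "valuation_ring \<iota> R \<Longrightarrow> z \<in> R \<Longrightarrow> z ^ n \<in> R"
  by (induction n) (auto simp: vr_1 vr_mult)

lemma vr_ev: "valuation_ring \<iota> R \<Longrightarrow> z \<in> R \<Longrightarrow> ev p z \<in> R"
  by (induction p) (auto simp: vr_0 vr_add vr_mult vr_emb)

text \<open>Of two nonzero elements of F one divides the other in \<open>R\<close>, so a sum of two
  nonunits is a multiple of one of them.\<close>

lemma ideal_of_nonunits:
  assumes "valuation_ring \<iota> R"
  shows "ideal_of R {z. z = 0 \<or> inverse z \<notin> R}" (is "ideal_of R ?N")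
proof -
  note R = vr_0[OF assms] vr_1[OF assms] vr_mult[OF assms] vr_add[OF assms]
  have sub: "?N \<subseteq> R" using vr_or[OF assms] R(1) by auto
  have mult: "a * z \<in> ?N" if "a \<in> R" "z \<in> ?N" for a z
  proof (cases "a = 0 \<or> z = 0")
    case False
    then have "inverse z = a * inverse (a * z)" by (simp add: field_simps)
    then have "inverse (a * z) \<in> R \<Longrightarrow> inverse z \<in> R" using that(1) R(3) by metis
    with that(2) False show ?thesis by blast
  qed auto
  have add': "z + w \<in> ?N" if "z \<in> ?N" "w \<in> ?N" "w / z \<in> R" "z \<noteq> 0" for z w
  proof -
    have "z + w = (1 + w / z) * z" using that by (simp add: field_simps)
    then show ?thesis using mult[of "1 + w / z" z] that R by auto
  qed
  have "z + w \<in> ?N" if "z \<in> ?N" "w \<in> ?N" for z w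
  proof (cases "z = 0 \<or> w = 0")
    case False
    have "w / z \<in> R \<or> z / w \<in> R"
      using vr_or[OF assms, of "w / z"] by simp
    then show ?thesis using add'[of z w] add'[of w z] that False by (auto simp: add.commute)
  qed (use that in auto)
  with sub mult show ?thesis by (auto simp: ideal_of_def)
qed

text \<open>A proper ideal contains no unit, hence lies in the ideal of nonunits, which is therefore
  the only maximal one. In this way a place and its valuation ring determine each other.\<close>

lemma maximal_ideal_of_nonunits:
  assumes "valuation_ring \<iota> R"
  shows "maximal_ideal_of R P \<longleftrightarrow> P = {z. z = 0 \<or> inverse z \<notin> R}" (is "_ \<longleftrightarrow> P = ?N")
proof -
  note R = vr_0[OF assms] vr_1[OF assms] vr_mult[OF assms] vr_add[OF assms]
  have full: "J = R" if "ideal_of R J" "u \<in> J" "u \<noteq> 0" "inverse u \<in> R" for J u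
  proof -
    have "inverse u * u \<in> J" using that unfolding ideal_of_def by blast
    then have "1 \<in> J" using that by simp
    then have "a * 1 \<in> J" if "a \<in> R" for a using that \<open>ideal_of R J\<close> unfolding ideal_of_def by blast
    then show ?thesis using that(1) by (auto simp: ideal_of_def)
  qed
  have "1 \<notin> ?N" using R(2) by simp
  then have N: "?N \<noteq> R" using R(2) by blast
  show ?thesis
  proof
    assume P: "maximal_ideal_of R P"
    then have "P \<subseteq> ?N" using full[of P] by (auto simp: maximal_ideal_of_def)
    with P ideal_of_nonunits[OF assms] N show "P = ?N"
      unfolding maximal_ideal_of_def by metis
  next
    assume P: "P = ?N"
    have "J = P \<or> J = R" if "ideal_of R J" "P \<subseteq> J" for J
      using full[OF that(1)] that(2) P by auto
    then show "maximal_ideal_of R P"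
      using P N ideal_of_nonunits[OF assms] unfolding maximal_ideal_of_def by auto
  qed
qed

lemma is_place_nonunits: "valuation_ring \<iota> R \<Longrightarrow> is_place \<iota> {z. z = 0 \<or> inverse z \<notin> R}"
  unfolding is_place_def using maximal_ideal_of_nonunits by blast

lemma place_ring_nonunits:
  "valuation_ring \<iota> R \<Longrightarrow> place_ring {z. z = 0 \<or> inverse z \<notin> R} = R"
  using vr_or vr_0 by (fastforce simp: place_ring_def)

lemma
  assumes "is_place \<iota> P"
  shows valuation_ring_place_ring: "valuation_ring \<iota> (place_ring P)"
    and place_eq_nonunits: "z \<in> P \<longleftrightarrow> z = 0 \<or> inverse z \<notin> place_ring P"
proof -
  obtain R where R: "valuation_ring \<iota> R" "maximal_ideal_of R P"
    using assms by (auto simp: is_place_def)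
  then have P: "P = {z. z = 0 \<or> inverse z \<notin> R}"
    using maximal_ideal_of_nonunits by blast
  then have "place_ring P = R"
    using place_ring_nonunits[OF R(1)] by simp
  with R(1) P show "valuation_ring \<iota> (place_ring P)"
    "z \<in> P \<longleftrightarrow> z = 0 \<or> inverse z \<notin> place_ring P"
    by auto
qed

lemma
  assumes "is_place \<iota> P"
  shows place_subset: "z \<in> P \<Longrightarrow> z \<in> place_ring P"
    and place_0: "0 \<in> P"
    and place_add: "z \<in> P \<Longrightarrow> w \<in> P \<Longrightarrow> z + w \<in> P"
    and place_mult: "a \<in> place_ring P \<Longrightarrow> z \<in> P \<Longrightarrow> a * z \<in> P"
    and place_mult': "a \<in> place_ring P \<Longrightarrow> z \<in> P \<Longrightarrow> z * a \<in> P"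
    and emb_place_iff: "\<iota> c \<in> P \<longleftrightarrow> c = 0"
    and ex_place_nonzero: "\<exists>x\<in>P. x \<noteq> 0"
proof -
  note vr = valuation_ring_place_ring[OF assms]
  have P: "P = {z. z = 0 \<or> inverse z \<notin> place_ring P}"
    using place_eq_nonunits[OF assms] by blast
  have "ideal_of (place_ring P) P"
    using ideal_of_nonunits[OF vr] P by simp
  then show "z \<in> P \<Longrightarrow> z \<in> place_ring P" "0 \<in> P" "z \<in> P \<Longrightarrow> w \<in> P \<Longrightarrow> z + w \<in> P"
    "a \<in> place_ring P \<Longrightarrow> z \<in> P \<Longrightarrow> a * z \<in> P" "a \<in> place_ring P \<Longrightarrow> z \<in> P \<Longrightarrow> z * a \<in> P"
    unfolding ideal_of_def by (auto simp: mult.commute)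
  show "\<iota> c \<in> P \<longleftrightarrow> c = 0"
    using place_eq_nonunits[OF assms, of "\<iota> c"] vr_emb[OF vr, of "inverse c"] by auto
  obtain z where "z \<notin> place_ring P" using vr_proper[OF vr] by blast
  then have "inverse z \<in> P" "inverse z \<noteq> 0"
    using place_eq_nonunits[OF assms, of "inverse z"] vr_0[OF vr] by auto
  then show "\<exists>x\<in>P. x \<noteq> 0" by blast
qed

lemma place_sum: "is_place \<iota> P \<Longrightarrow> (\<And>i. i \<in> I \<Longrightarrow> h i \<in> P) \<Longrightarrow> sum h I \<in> P"
  by (induction I rule: infinite_finite_induct) (auto simp: place_0 place_add)

lemma place_minus: "is_place \<iota> P \<Longrightarrow> z \<in> P \<Longrightarrow> - z \<in> P"
  using place_mult[of P "-1" z] vr_minus vr_1 valuation_ring_place_ring by fastforce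

text \<open>If no \<open>u - c\<close> with \<open>c \<in> K\<close> lies in \<open>P\<close>, then all powers of \<open>u\<close> are independent over
  \<open>K(x)\<close> for \<open>x \<in> P\<close>, because \<open>K\<close> is algebraically closed.\<close>

lemma residue_exists:
  assumes P: "is_place \<iota> P" and u: "u \<in> place_ring P"
  shows "\<exists>c. u - \<iota> c \<in> P"
proof (rule ccontr)
  assume no: "\<nexists>c. u - \<iota> c \<in> P"
  note vr = valuation_ring_place_ring[OF P]
  obtain x where x: "x \<in> P" "x \<noteq> 0" using ex_place_nonzero[OF P] by blast
  have not_P: "ev q u \<notin> P" if "q \<noteq> 0" for q
    using that
  proof (induction "Polynomial.degree q" arbitrary: q)
    case 0
    then obtain a where "q = [:a:]" "a \<noteq> 0" by (metis degree_0_id pCons_eq_0_iff)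
    then show ?case using emb_place_iff[OF P] by simp
  next
    case (Suc n)
    then obtain a where "Polynomial.poly q a = 0"
      using alg_closed_imp_poly_has_root[of q] by auto
    then obtain q' where q': "q = [:- a, 1:] * q'"
      by (metis dvdE poly_eq_0_iff_dvd)
    with Suc.prems have "q' \<noteq> 0" by auto
    moreover have "n = Polynomial.degree q'"
      using Suc.hyps(2) \<open>q' \<noteq> 0\<close> unfolding q' by (subst (asm) degree_mult_eq) auto
    ultimately have "ev q' u \<notin> P" using Suc.hyps(1) by blast
    moreover have "u - \<iota> a \<notin> P" using no by blast
    ultimately have "inverse (ev q' u) * inverse (u - \<iota> a) \<in> place_ring P" "ev q' u \<noteq> 0" "u - \<iota> a \<noteq> 0"
      using place_eq_nonunits[OF P] vr_mult[OF vr] by blast+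
    moreover have "ev q u = ev q' u * (u - \<iota> a)"
      unfolding q' ev_mult by (simp add: mult.commute)
    ultimately show ?case using place_eq_nonunits[OF P, of "ev q u"] by simp
  qed
  have "indep_over x (\<lambda>i. u ^ i) {..<n}" for n
  proof (rule indep_overI)
    fix p :: "nat \<Rightarrow> 'k poly" and i assume i: "i \<in> {..<n}" "Polynomial.coeff (p i) 0 \<noteq> 0"
    \<comment> \<open>\<open>q\<close> collects the constant terms of the coefficients. As x lies in
      \<open>P\<close>, the whole relation is congruent to \<open>ev q u\<close> modulo
      \<open>P\<close>.\<close>
    define q where "q = (\<Sum>i<n. Polynomial.monom (Polynomial.coeff (p i) 0) i)"
    have "Polynomial.coeff q i \<noteq> 0"
      using i unfolding q_def coeff_sum by (simp add: sum.delta)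
    then have "q \<noteq> 0" by auto
    have "\<exists>r. \<forall>i. p i = pCons (Polynomial.coeff (p i) 0) (r i)"
      by (rule choice) (metis coeff_pCons_0 pCons_cases)
    then obtain r where r: "\<And>i. p i = pCons (Polynomial.coeff (p i) 0) (r i)" by blast
    have "ev (p i) x = \<iota> (Polynomial.coeff (p i) 0) + x * ev (r i) x" for i
      by (subst r) simp
    then have "(\<Sum>i<n. ev (p i) x * u ^ i) = ev q u + (\<Sum>i<n. x * (ev (r i) x * u ^ i))"
      unfolding q_def by (simp add: ev_sum distrib_right sum.distrib mult.assoc)
    moreover have "(\<Sum>i<n. x * (ev (r i) x * u ^ i)) \<in> P"
      using x(1) u by (intro place_sum[OF P] place_mult'[OF P] vr_mult[OF vr] vr_ev[OF vr] vr_power[OF vr])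
        (auto intro: place_subset[OF P])
    ultimately show "(\<Sum>i<n. ev (p i) x * u ^ i) \<noteq> 0"
      using not_P[OF \<open>q \<noteq> 0\<close>] place_minus[OF P] by (metis eq_neg_iff_add_eq_0)
  qed (use x in auto)
  moreover obtain N where "\<forall>(I::nat set) h. finite I \<longrightarrow> indep_over x h I \<longrightarrow> card I \<le> N"
    using indep_over_bounded by blast
  ultimately have "card {..<Suc N} \<le> N" by blast
  then show False by simp
qed

text \<open>Discreteness before any valuation is available: \<open>y i / y (Suc i) \<in> P\<close>
  says that the orders strictly decrease along the chain while staying positive. Such a chain is
  independent over K(x), because in a relation the last term whose coefficient has a nonzero
  constant term dominates all others.\<close>

lemma place_chain_bounded:
  assumes P: "is_place \<iota> P"
  shows "\<exists>N. \<forall>y n. y 0 = x \<longrightarrow> (\<forall>i<n. y i \<in> P \<and> y i \<noteq> 0) \<longrightarrow>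
      (\<forall>i. Suc i < n \<longrightarrow> y i / y (Suc i) \<in> P) \<longrightarrow> n \<le> N"
proof -
  note vr = valuation_ring_place_ring[OF P]
  obtain N where N: "\<And>(I::nat set) h. finite I \<Longrightarrow> indep_over x h I \<Longrightarrow> card I \<le> N"
    using indep_over_bounded by blast
  have "n \<le> N" if y: "y 0 = x" "\<And>i. i < n \<Longrightarrow> y i \<in> P" "\<And>i. i < n \<Longrightarrow> y i \<noteq> 0"
    "\<And>i. Suc i < n \<Longrightarrow> y i / y (Suc i) \<in> P" for y n
  proof (cases "n = 0")
    case False
    then have x: "x \<in> P" "x \<noteq> 0" using y(1) y(2,3)[of 0] by auto
    have ratio: "y i / y j \<in> P" if "i < j" "j < n" for i j
      using that
    proof (induction j)
      case (Suc j)
      show ?case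
      proof (cases "i = j")
        case True
        then show ?thesis using y(4) Suc.prems by simp
      next
        case False
        then have "y i / y j \<in> P" "y j / y (Suc j) \<in> P" "y j \<noteq> 0" using Suc y(3,4) by auto
        then have "(y i / y j) * (y j / y (Suc j)) \<in> P"
          using place_mult[OF P] place_subset[OF P] by blast
        then show ?thesis using \<open>y j \<noteq> 0\<close> by simp
      qed
    qed simp
    have "indep_over x y {..<n}"
    proof (rule indep_overI)
      fix p :: "nat \<Rightarrow> 'k poly" and i0 assume i0: "i0 \<in> {..<n}" "Polynomial.coeff (p i0) 0 \<noteq> 0"
      let ?J = "{i. i < n \<and> Polynomial.coeff (p i) 0 \<noteq> 0}"
      define j where "j = Max ?J"
      have fin: "finite ?J" by simp
      have "j \<in> ?J" unfolding j_def using fin i0 by (intro Max_in) auto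
      then have j: "j < n" "Polynomial.coeff (p j) 0 \<noteq> 0" by auto
      have j_max: "Polynomial.coeff (p i) 0 = 0" if "j < i" "i < n" for i
        using that Max_ge[OF fin] unfolding j_def by fastforce
      have "\<exists>r. \<forall>i. p i = pCons (Polynomial.coeff (p i) 0) (r i)"
        by (rule choice) (metis coeff_pCons_0 pCons_cases)
      then obtain r where r: "\<And>i. p i = pCons (Polynomial.coeff (p i) 0) (r i)" by blast
      have ev_p: "ev (p i) x = \<iota> (Polynomial.coeff (p i) 0) + x * ev (r i) x" for i
        by (subst r) simp
      have xO: "x \<in> place_ring P" using x place_subset[OF P] by blast
      have other: "ev (p i) x * (y i / y j) \<in> P" if "i < n" "i \<noteq> j" for i
      proof (cases "i < j")
        case True
        then show ?thesis using ratio[OF True j(1)] vr_ev[OF vr xO] place_mult[OF P] by blast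
      next
        case False
        \<comment> \<open>Beyond \<open>j\<close> the coefficients are divisible by x, and
          \<open>x / y j\<close> is integral because x heads the chain.\<close>
        then have "ev (p i) x * (y i / y j) = ev (r i) x * ((x / y j) * y i)"
          using j_max that by (simp add: ev_p)
        moreover have "x / y j \<in> place_ring P"
          using ratio[of 0 j] j(1) y(1) y(3)[of j] place_subset[OF P] vr_1[OF vr] by (cases "j = 0") auto
        ultimately show ?thesis
          using y(2)[OF that(1)] vr_ev[OF vr xO] place_mult[OF P] by metis
      qed
      show "(\<Sum>i<n. ev (p i) x * y i) \<noteq> 0"
      proof
        assume "(\<Sum>i<n. ev (p i) x * y i) = 0"
        then have "(\<Sum>i<n. ev (p i) x * (y i / y j)) = 0"
          by (simp flip: sum_divide_distrib)
        then have "ev (p j) x + (\<Sum>i\<in>{..<n} - {j}. ev (p i) x * (y i / y j)) = 0"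
          using j(1) y(3)[OF j(1)] by (subst (asm) sum.remove[of _ j]) auto
        moreover have "(\<Sum>i\<in>{..<n} - {j}. ev (p i) x * (y i / y j)) \<in> P"
          using other by (intro place_sum[OF P]) auto
        ultimately have "ev (p j) x \<in> P"
          using place_minus[OF P] by (metis eq_neg_iff_add_eq_0)
        moreover have "x * ev (r j) x \<in> P"
          using x(1) vr_ev[OF vr xO] place_mult'[OF P] by blast
        ultimately have "ev (p j) x + - (x * ev (r j) x) \<in> P"
          using place_add[OF P] place_minus[OF P] by blast
        then show False using emb_place_iff[OF P] j(2) by (simp add: ev_p)
      qed
    qed (use x in auto)
    from N[OF _ this] show ?thesis by simp
  qed simp
  then show ?thesis by (intro exI[of _ N]) blast
qed

text \<open>If no element of \<open>P\<close> divided all the others, every nonzero element would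
  have a proper divisor in \<open>P\<close>, and iteration would give arbitrarily long chains
  starting at x.\<close>

lemma uniformizer_exists:
  assumes P: "is_place \<iota> P"
  shows "\<exists>t. t \<noteq> 0 \<and> P = {t * a | a. a \<in> place_ring P}"
proof -
  note vr = valuation_ring_place_ring[OF P]
  obtain x where x: "x \<in> P" "x \<noteq> 0" using ex_place_nonzero[OF P] by blast
  obtain N where N: "\<And>y n. y 0 = x \<Longrightarrow> (\<And>i. i < n \<Longrightarrow> y i \<in> P \<and> y i \<noteq> 0) \<Longrightarrow>
      (\<And>i. Suc i < n \<Longrightarrow> y i / y (Suc i) \<in> P) \<Longrightarrow> n \<le> N"
    using place_chain_bounded[OF P, of x] by metis
  have "\<exists>t\<in>P. t \<noteq> 0 \<and> (\<forall>z\<in>P. z / t \<in> place_ring P)"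
  proof (rule ccontr)
    assume no: "\<not> ?thesis"
    have "\<exists>w. (w \<in> P \<and> w \<noteq> 0) \<and> t / w \<in> P" if t: "t \<in> P" "t \<noteq> 0" for t
    proof -
      obtain z where z: "z \<in> P" "z / t \<notin> place_ring P" using no t by blast
      then have "z \<noteq> 0" using vr_0[OF vr] by auto
      moreover have "t / z \<in> P" using z place_eq_nonunits[OF P, of "t / z"] by simp
      ultimately show ?thesis using z by blast
    qed
    then obtain nxt where nxt: "\<And>t. t \<in> P \<Longrightarrow> t \<noteq> 0 \<Longrightarrow> nxt t \<in> P \<and> nxt t \<noteq> 0 \<and> t / nxt t \<in> P"
      by metis
    define y where "y i = (nxt ^^ i) x" for i
    have y: "y i \<in> P \<and> y i \<noteq> 0" for i
      by (induction i) (use x nxt in \<open>auto simp: y_def\<close>)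
    then have "y i / y (Suc i) \<in> P" for i
      using nxt[of "y i"] by (simp add: y_def)
    with y N[of y "Suc N"] show False by (auto simp: y_def)
  qed
  then obtain t where t: "t \<in> P" "t \<noteq> 0" "\<And>z. z \<in> P \<Longrightarrow> z / t \<in> place_ring P" by blast
  have "P = {t * a | a. a \<in> place_ring P}"
  proof (intro equalityI subsetI)
    fix z assume "z \<in> P"
    then show "z \<in> {t * a | a. a \<in> place_ring P}"
      using t by (intro CollectI exI[of _ "z / t"]) auto
  next
    fix z assume "z \<in> {t * a | a. a \<in> place_ring P}"
    then show "z \<in> P" using t place_mult'[OF P] by blast
  qed
  with t(2) show ?thesis by blast
qed

section \<open>The normalized discrete valuation of a place\<close>

definition place_unit :: "'f set \<Rightarrow> 'f \<Rightarrow> bool" where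
  "place_unit P u \<longleftrightarrow> u \<noteq> 0 \<and> u \<in> place_ring P \<and> inverse u \<in> place_ring P"

lemma place_unit_iff: "is_place \<iota> P \<Longrightarrow> place_unit P u \<longleftrightarrow> u \<in> place_ring P \<and> u \<notin> P"
  using place_eq_nonunits by (auto simp: place_unit_def)

lemma place_unit_mult: "is_place \<iota> P \<Longrightarrow> place_unit P u \<Longrightarrow> place_unit P w \<Longrightarrow> place_unit P (u * w)"
  using valuation_ring_place_ring vr_mult by (auto simp: place_unit_def)

lemma place_unit_inverse: "place_unit P u \<Longrightarrow> place_unit P (inverse u)"
  by (auto simp: place_unit_def)

lemma place_unit_powi: "is_place \<iota> P \<Longrightarrow> place_unit P u \<Longrightarrow> place_unit P (u powi n)"
  by (auto simp: place_unit_def power_int_def simp flip: power_inverse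
      intro!: vr_power valuation_ring_place_ring)

lemma uniformizer_powi:
  assumes "is_place \<iota> P" "t \<in> P" "t \<noteq> 0" "n > 0"
  shows "t powi n \<in> P"
proof -
  obtain m where "nat n = Suc m" using assms(4) by (metis Suc_pred zero_less_nat_eq)
  then have "t powi n = t ^ m * t" using assms(4) by (simp add: power_int_def mult.commute)
  then show ?thesis
    using assms place_mult place_subset vr_power valuation_ring_place_ring by metis
qed

lemma uniformizer_powi_unit:
  assumes P: "is_place \<iota> P" "t \<in> P" "t \<noteq> 0" "place_unit P (t powi n)"
  shows "n = 0"
proof (rule ccontr)
  assume "n \<noteq> 0"
  then consider "n > 0" | "- n > 0" by linarith
  then show False
  proof cases
    case 1
    then show ?thesis using uniformizer_powi[OF P(1-3)] P(4) place_unit_iff[OF P(1)] by blast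
  next
    case 2
    have "place_unit P (t powi (- n))"
      using place_unit_inverse[OF P(4)] by (simp add: power_int_minus)
    then show ?thesis using uniformizer_powi[OF P(1-3) 2] place_unit_iff[OF P(1)] by blast
  qed
qed

definition uniformizer :: "'f set \<Rightarrow> 'f" where
  "uniformizer P = (SOME t. t \<noteq> 0 \<and> P = {t * a | a. a \<in> place_ring P})"

lemma
  assumes P: "is_place \<iota> P"
  shows uniformizer_nonzero: "uniformizer P \<noteq> 0"
    and uniformizer_generates: "P = {uniformizer P * a | a. a \<in> place_ring P}"
    and uniformizer_in: "uniformizer P \<in> P"
proof -
  have *: "uniformizer P \<noteq> 0 \<and> P = {uniformizer P * a | a. a \<in> place_ring P}"
    unfolding uniformizer_def using someI_ex[OF uniformizer_exists[OF P]] .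
  then show "uniformizer P \<noteq> 0" "P = {uniformizer P * a | a. a \<in> place_ring P}" by blast+
  have "uniformizer P * 1 \<in> {uniformizer P * a | a. a \<in> place_ring P}"
    using vr_1[OF valuation_ring_place_ring[OF P]] by blast
  then show "uniformizer P \<in> P" using * by simp
qed

text \<open>The chain bound yields a largest power of the uniformizer dividing an element of
  \<open>P\<close>, and the quotient is a unit. Elements outside the valuation ring are handled
  through their inverses.\<close>

lemma uniformizer_decomposition:
  assumes P: "is_place \<iota> P" and z: "z \<noteq> 0"
  shows "\<exists>n u. place_unit P u \<and> z = uniformizer P powi n * u"
proof -
  note vr = valuation_ring_place_ring[OF P]
  define t where "t = uniformizer P"
  have t: "t \<noteq> 0" "t \<in> P" "P = {t * a | a. a \<in> place_ring P}"
    using uniformizer_nonzero[OF P] uniformizer_in[OF P] uniformizer_generates[OF P] by (auto simp: t_def)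
  have in_P: "\<exists>n u. place_unit P u \<and> z = t powi n * u" if z: "z \<in> P" "z \<noteq> 0" for z
  proof -
    obtain N where N: "\<And>y n. y 0 = z \<Longrightarrow> (\<And>i. i < n \<Longrightarrow> y i \<in> P \<and> y i \<noteq> 0) \<Longrightarrow>
      (\<And>i. Suc i < n \<Longrightarrow> y i / y (Suc i) \<in> P) \<Longrightarrow> n \<le> N"
      using place_chain_bounded[OF P, of z] by metis
    have "\<exists>n. z / t ^ n \<in> place_ring P \<and> z / t ^ Suc n \<notin> place_ring P"
    proof (rule ccontr)
      assume no: "\<not> ?thesis"
      have all: "z / t ^ n \<in> place_ring P" for n
      proof (induction n)
        case 0
        then show ?case using z place_subset[OF P] by simp
      next
        case (Suc n)
        then show ?case using no by blast
      qed
      \<comment> \<open>If all powers of \<open>t\<close> divided z, then z,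
        \<open>t ^ (n - 1)\<close>, ..., \<open>t\<close> would be a chain of length
        \<open>N + 2\<close>. Its first quotient is in \<open>P\<close> because even
        \<open>t ^ n\<close> divides z.\<close>
      define n where "n = Suc (Suc N)"
      define y where "y i = (if i = 0 then z else t ^ (n - i))" for i
      have tP: "t ^ Suc k \<in> P" for k
        using place_mult'[OF P vr_power[OF vr place_subset[OF P t(2)]] t(2)] by simp
      have "y i \<in> P \<and> y i \<noteq> 0" if i: "i < n" for i
      proof (cases "i = 0")
        case False
        then obtain k where "n - i = Suc k" using i by (metis Suc_diff_Suc)
        then show ?thesis using tP[of k] t(1) False unfolding y_def by simp
      qed (use z in \<open>simp add: y_def\<close>)
      moreover have "y i / y (Suc i) \<in> P" if i: "Suc i < n" for i
      proof (cases "i = 0")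
        case True
        have "z / t ^ Suc N = t * (z / t ^ n)" using t(1) by (simp add: n_def)
        then show ?thesis using True place_mult'[OF P all[of n] t(2)] by (simp add: y_def n_def)
      next
        case False
        have "n - i = Suc (n - Suc i)" using i by simp
        then show ?thesis using False t(1,2) by (simp add: y_def)
      qed
      ultimately have "n \<le> N" using N[of y n] by (simp add: y_def)
      then show False by (simp add: n_def)
    qed
    then obtain n where n: "z / t ^ n \<in> place_ring P" "z / t ^ Suc n \<notin> place_ring P" by blast
    have "z / t ^ n \<notin> P"
    proof
      assume "z / t ^ n \<in> P"
      then obtain a where "z / t ^ n = t * a" "a \<in> place_ring P" using t(3) by blast
      then have "z / t ^ Suc n = a" using t(1) by (simp add: field_simps)
      with n(2) \<open>a \<in> place_ring P\<close> show False by simp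
    qed
    then have "place_unit P (z / t ^ n)" using n(1) place_unit_iff[OF P] by blast
    moreover have "z = t powi int n * (z / t ^ n)" using t(1) by simp
    ultimately show ?thesis by blast
  qed
  consider "z \<in> P" | "place_unit P z" | "inverse z \<in> P"
    using place_unit_iff[OF P] place_eq_nonunits[OF P, of "inverse z"] z by fastforce
  then show ?thesis
  proof cases
    case 1
    then show ?thesis using in_P z unfolding t_def by blast
  next
    case 2
    have "z = uniformizer P powi 0 * z" by simp
    with 2 show ?thesis by blast
  next
    case 3
    then obtain n u where "place_unit P u" "inverse z = t powi n * u" using in_P z by force
    then have "place_unit P (inverse u)" "z = t powi (- n) * inverse u"
      using place_unit_inverse by (auto simp: power_int_minus, metis inverse_inverse_eq inverse_mult_distrib)
    then show ?thesis unfolding t_def by blast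
  qed
qed

lemma place_val_eqI:
  assumes P: "is_place \<iota> P" and t: "P = {t * a | a. a \<in> place_ring P}" and u: "place_unit P u"
  shows "place_val P (t powi n * u) = n"
proof -
  have "t * 1 \<in> P" using t vr_1[OF valuation_ring_place_ring[OF P]] by blast
  then have tP: "t \<in> P" by simp
  have "t \<noteq> 0" using uniformizer_in[OF P] uniformizer_nonzero[OF P] t by force
  note t = \<open>t \<noteq> 0\<close> tP t
  have uniq: "m = n" if t': "P = {t' * a | a. a \<in> place_ring P}" and w: "place_unit P w"
    and eq: "t powi n * u = t' powi m * w" for t' w m
  proof -
    obtain a where a: "t = t' * a" "a \<in> place_ring P" using t(2) t' by blast
    have "t' * 1 \<in> P"
      using t' vr_1[OF valuation_ring_place_ring[OF P]] by blast
    then obtain b where b: "t' = t * b" "b \<in> place_ring P" using t(3) by force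
    have "t * (b * a) = t" using a(1) b(1) by (simp add: mult.assoc)
    then have ba: "b * a = 1" using t(1) by simp
    then have "inverse b = a" by (metis inverse_unique)
    moreover have "b \<noteq> 0" using ba by auto
    ultimately have "place_unit P b" using a b by (simp add: place_unit_def)
    have "t powi n * u = t powi m * (b powi m * w)"
      using eq b(1) by (simp add: power_int_mult_distrib mult.assoc)
    then have "t powi (n - m) = (b powi m * w) * inverse u"
      using t(1) u by (simp add: power_int_diff field_simps place_unit_def)
    moreover have "place_unit P ((b powi m * w) * inverse u)"
      using \<open>place_unit P b\<close> w u P by (intro place_unit_mult place_unit_powi place_unit_inverse) auto
    ultimately show "m = n"
      using uniformizer_powi_unit[OF P t(2) t(1), of "n - m"] by simp
  qed
  show ?thesis
    unfolding place_val_def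
  proof (rule the_equality)
    show "\<exists>t' w. P = {t' * a | a. a \<in> place_ring P} \<and> w \<noteq> 0 \<and> w \<in> place_ring P \<and>
        inverse w \<in> place_ring P \<and> t powi n * u = t' powi n * w"
      using t(3) u unfolding place_unit_def by blast
  next
    fix m assume "\<exists>t' w. P = {t' * a | a. a \<in> place_ring P} \<and> w \<noteq> 0 \<and> w \<in> place_ring P \<and>
        inverse w \<in> place_ring P \<and> t powi n * u = t' powi m * w"
    then show "m = n" using uniq unfolding place_unit_def by blast
  qed
qed

lemmas place_val_unique = place_val_eqI[OF _ uniformizer_generates]

lemma place_val_decomposition:
  assumes "is_place \<iota> P" "z \<noteq> 0"
  shows "\<exists>u. place_unit P u \<and> z = uniformizer P powi place_val P z * u"
  using uniformizer_decomposition[OF assms] place_val_unique[OF assms(1) assms(1)] by metis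

lemma
  assumes P: "is_place \<iota> P"
  shows place_val_mult: "z \<noteq> 0 \<Longrightarrow> w \<noteq> 0 \<Longrightarrow> place_val P (z * w) = place_val P z + place_val P w"
    and place_val_uniformizer: "place_val P (uniformizer P) = 1"
    and place_val_inverse: "z \<noteq> 0 \<Longrightarrow> place_val P (inverse z) = - place_val P z"
proof -
  have t: "uniformizer P \<noteq> 0" by (rule uniformizer_nonzero[OF P])
  show mult: "place_val P (z * w) = place_val P z + place_val P w" if "z \<noteq> 0" "w \<noteq> 0" for z w
  proof -
    obtain u where u: "place_unit P u" "z = uniformizer P powi place_val P z * u"
      using place_val_decomposition[OF P \<open>z \<noteq> 0\<close>] by blast
    obtain u' where u': "place_unit P u'" "w = uniformizer P powi place_val P w * u'"
      using place_val_decomposition[OF P \<open>w \<noteq> 0\<close>] by blast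
    have "z * w = uniformizer P powi (place_val P z + place_val P w) * (u * u')"
      using t by (subst u(2), subst u'(2)) (simp add: power_int_add mult_ac)
    then show ?thesis using place_val_unique[OF P P place_unit_mult[OF P u(1) u'(1)]] by metis
  qed
  have unit: "place_val P u = 0" if "place_unit P u" for u
    using place_val_unique[OF P P that, of 0] by simp
  have one: "place_unit P 1"
    using vr_1[OF valuation_ring_place_ring[OF P]] by (simp add: place_unit_def)
  show "place_val P (uniformizer P) = 1"
    using place_val_unique[OF P P one, of 1] by simp
  show "place_val P (inverse z) = - place_val P z" if "z \<noteq> 0" for z
    using mult[of z "inverse z"] unit[OF one] that by simp
qed

lemma place_val_nonneg_iff:
  assumes P: "is_place \<iota> P" and z: "z \<noteq> 0"
  shows "place_val P z \<ge> 0 \<longleftrightarrow> z \<in> place_ring P"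
proof -
  note vr = valuation_ring_place_ring[OF P]
  define t where "t = uniformizer P"
  have t: "t \<noteq> 0" "t \<in> P"
    using uniformizer_nonzero[OF P] uniformizer_in[OF P] by (auto simp: t_def)
  obtain u where u: "place_unit P u" "z = t powi place_val P z * u"
    using place_val_decomposition[OF P z] unfolding t_def by blast
  show ?thesis
  proof
    assume "place_val P z \<ge> 0"
    then have "t powi place_val P z \<in> place_ring P"
      using vr_power[OF vr place_subset[OF P t(2)]] by (simp add: power_int_def)
    then show "z \<in> place_ring P" using u vr_mult[OF vr] unfolding place_unit_def by metis
  next
    assume zO: "z \<in> place_ring P"
    show "place_val P z \<ge> 0"
    proof (rule ccontr)
      assume "\<not> place_val P z \<ge> 0"
      then have "t powi (- place_val P z) \<in> P"
        using uniformizer_powi[OF P t(2) t(1), of "- place_val P z"] by simp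
      then have "t powi place_val P z \<notin> place_ring P"
        using place_eq_nonunits[OF P] t(1) by (simp add: power_int_minus)
      moreover have "t powi place_val P z = z * inverse u"
        by (subst (2) u(2)) (use u(1) in \<open>simp add: place_unit_def\<close>)
      ultimately show False using zO u(1) vr_mult[OF vr] by (simp add: place_unit_def)
    qed
  qed
qed

lemma place_val_pos_iff:
  assumes P: "is_place \<iota> P" and z: "z \<noteq> 0"
  shows "place_val P z > 0 \<longleftrightarrow> z \<in> P"
  using place_val_nonneg_iff[OF P, of "inverse z"] place_val_inverse[OF P z] place_eq_nonunits[OF P, of z] z
  by auto

lemma place_val_emb: "is_place \<iota> P \<Longrightarrow> c \<noteq> 0 \<Longrightarrow> place_val P (\<iota> c) = 0"
  using place_val_nonneg_iff[of P "\<iota> c"] place_val_pos_iff[of P "\<iota> c"] emb_place_iff[of P c]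
    vr_emb[OF valuation_ring_place_ring, of P c] by (metis emb_eq_0_iff order.order_iff_strict)

text \<open>Unlike \<open>place_val\<close>, this predicate treats \<open>0\<close> as having infinite valuation.\<close>

definition val_ge :: "'f set \<Rightarrow> int \<Rightarrow> 'f \<Rightarrow> bool" where
  "val_ge P n z \<longleftrightarrow> z = 0 \<or> place_val P z \<ge> n"

lemma val_ge_0 [simp]: "val_ge P n 0"
  by (simp add: val_ge_def)

lemma val_ge_mono: "val_ge P m z \<Longrightarrow> n \<le> m \<Longrightarrow> val_ge P n z"
  by (auto simp: val_ge_def)

lemma val_ge_place_val: "val_ge P (place_val P z) z"
  by (simp add: val_ge_def)

lemma
  assumes P: "is_place \<iota> P"
  shows val_ge_0_iff: "val_ge P 0 z \<longleftrightarrow> z \<in> place_ring P"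
    and val_ge_1_iff: "val_ge P 1 z \<longleftrightarrow> z \<in> P"
  using place_val_nonneg_iff[OF P, of z] place_val_pos_iff[OF P, of z] place_0[OF P]
    vr_0[OF valuation_ring_place_ring[OF P]]
  by (cases "z = 0"; auto simp: val_ge_def)+

lemma val_ge_emb: "is_place \<iota> P \<Longrightarrow> val_ge P 0 (\<iota> c)"
  by (simp add: val_ge_0_iff vr_emb valuation_ring_place_ring)

lemma val_ge_mult:
  assumes "is_place \<iota> P" "val_ge P m z" "val_ge P n w"
  shows "val_ge P (m + n) (z * w)"
  using assms place_val_mult[OF assms(1), of z w] by (cases "z = 0 \<or> w = 0") (auto simp: val_ge_def)

lemma val_ge_mult': "is_place \<iota> P \<Longrightarrow> val_ge P 0 z \<Longrightarrow> val_ge P n w \<Longrightarrow> val_ge P n (z * w)"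
  using val_ge_mult[of P 0 z n w] by simp

lemma val_ge_scale: "is_place \<iota> P \<Longrightarrow> val_ge P n z \<Longrightarrow> val_ge P n (\<iota> c * z)"
  using val_ge_mult' val_ge_emb by blast

lemma val_ge_iff_quotient:
  assumes P: "is_place \<iota> P" and "t \<noteq> 0"
  shows "val_ge P (place_val P t) z \<longleftrightarrow> z / t \<in> place_ring P"
proof (cases "z = 0")
  case False
  then have "place_val P (z / t) = place_val P z - place_val P t"
    using assms by (simp add: divide_inverse place_val_mult place_val_inverse)
  with False show ?thesis
    using place_val_nonneg_iff[OF P, of "z / t"] assms(2) by (auto simp: val_ge_def)
qed (use P in \<open>simp add: vr_0 valuation_ring_place_ring\<close>)

lemma uniformizer_power_val:
  assumes P: "is_place \<iota> P"
  shows "uniformizer P powi n \<noteq> 0" "place_val P (uniformizer P powi n) = n"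
proof -
  have "place_unit P 1" using P by (simp add: place_unit_def vr_1 valuation_ring_place_ring)
  then show "place_val P (uniformizer P powi n) = n"
    using place_val_unique[OF P P, of 1 n] by simp
  show "uniformizer P powi n \<noteq> 0" using uniformizer_nonzero[OF P] by simp
qed

text \<open>Division by the \<open>n\<close>-th power of the uniformizer reduces the claim to
  additive closure of the valuation ring.\<close>

lemma val_ge_add:
  assumes P: "is_place \<iota> P" and "val_ge P n z" "val_ge P n w"
  shows "val_ge P n (z + w)"
proof -
  note t = uniformizer_power_val[OF P, of n]
  have "val_ge P n y \<longleftrightarrow> y / uniformizer P powi n \<in> place_ring P" for y
    using val_ge_iff_quotient[OF P t(1)] t(2) by simp
  then show ?thesis
    using assms vr_add[OF valuation_ring_place_ring[OF P]] by (simp add: add_divide_distrib)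
qed

lemma val_ge_minus [simp]: "is_place \<iota> P \<Longrightarrow> val_ge P n (- z) \<longleftrightarrow> val_ge P n z"
  using val_ge_scale[of P n z "-1"] val_ge_scale[of P n "- z" "-1"] by auto

lemma val_ge_diff: "is_place \<iota> P \<Longrightarrow> val_ge P n z \<Longrightarrow> val_ge P n w \<Longrightarrow> val_ge P n (z - w)"
  using val_ge_add[of P n z "- w"] by simp

lemma val_ge_sum: "is_place \<iota> P \<Longrightarrow> (\<And>i. i \<in> I \<Longrightarrow> val_ge P n (h i)) \<Longrightarrow> val_ge P n (sum h I)"
  by (induction I rule: infinite_finite_induct) (auto simp: val_ge_add)

lemma val_ge_ev: "is_place \<iota> P \<Longrightarrow> val_ge P 0 z \<Longrightarrow> val_ge P 0 (ev p z)"
  by (simp add: val_ge_0_iff vr_ev valuation_ring_place_ring)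

lemma place_val_power: "is_place \<iota> P \<Longrightarrow> z \<noteq> 0 \<Longrightarrow> place_val P (z ^ n) = int n * place_val P z"
proof (induction n)
  case 0
  then show ?case using place_val_emb[of P 1] by simp
qed (simp add: place_val_mult algebra_simps)

lemma val_ge_power: "is_place \<iota> P \<Longrightarrow> val_ge P n z \<Longrightarrow> val_ge P (int k * n) (z ^ k)"
  by (induction k) (auto simp: algebra_simps val_ge_mult val_ge_emb[of P 1, simplified])

lemma place_val_add_dominant:
  assumes P: "is_place \<iota> P" and "z \<noteq> 0" "val_ge P (place_val P z + 1) w"
  shows "z + w \<noteq> 0" "place_val P (z + w) = place_val P z"
proof -
  have *: "\<not> val_ge P (place_val P z + 1) (z + w)"
  proof
    assume "val_ge P (place_val P z + 1) (z + w)"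
    then have "val_ge P (place_val P z + 1) (z + w - w)"
      using assms val_ge_diff by blast
    then show False using assms by (simp add: val_ge_def)
  qed
  moreover have "val_ge P (place_val P z) (z + w)"
    using assms val_ge_mono[OF assms(3)] by (intro val_ge_add val_ge_place_val) auto
  ultimately show "z + w \<noteq> 0" "place_val P (z + w) = place_val P z"
    by (auto simp: val_ge_def)
qed

text \<open>The quotient \<open>z / w\<close> is congruent to a constant because the residue field
  is K. Every one-dimensionality argument about Riemann-Roch spaces rests on this
  cancellation.\<close>

lemma leading_coefficient:
  assumes P: "is_place \<iota> P" and "w \<noteq> 0" "val_ge P (place_val P w) z"
  shows "\<exists>c. val_ge P (place_val P w + 1) (z - \<iota> c * w)"
proof -
  have "z / w \<in> place_ring P" using assms val_ge_iff_quotient by blast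
  then obtain c where "z / w - \<iota> c \<in> P" using residue_exists[OF P] by blast
  then have "val_ge P (1 + place_val P w) ((z / w - \<iota> c) * w)"
    using P by (intro val_ge_mult val_ge_place_val) (auto simp: val_ge_1_iff)
  moreover have "(z / w - \<iota> c) * w = z - \<iota> c * w" using assms(2) by (simp add: field_simps)
  ultimately show ?thesis by (auto simp: add.commute)
qed

subsection \<open>Weak approximation\<close>

text \<open>Valuation rings of places are maximal proper subrings: if z has negative order at
  \<open>P\<close>, then every w becomes integral at \<open>P\<close> after division by a high power
  of z. So a larger ring containing z would be all of F.\<close>

lemma place_ring_subset_imp_eq:
  assumes P: "is_place \<iota> P" and Q: "is_place \<iota> Q" and sub: "place_ring P \<subseteq> place_ring Q"
  shows "P = Q"
proof -
  note vrP = valuation_ring_place_ring[OF P] and vrQ = valuation_ring_place_ring[OF Q]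
  have "place_ring Q \<subseteq> place_ring P"
  proof (rule ccontr)
    assume "\<not> ?thesis"
    then obtain z where z: "z \<in> place_ring Q" "z \<notin> place_ring P" by blast
    then have "z \<noteq> 0" using vr_0[OF vrP] by auto
    with z have neg: "place_val P z < 0" using place_val_nonneg_iff[OF P, of z] by auto
    have "w \<in> place_ring Q" for w
    proof (cases "w = 0")
      case False
      let ?n = "nat \<bar>place_val P w\<bar>"
      have "place_val P (w * inverse z ^ ?n) = place_val P w - int ?n * place_val P z"
        using False \<open>z \<noteq> 0\<close> P by (simp add: place_val_mult place_val_power place_val_inverse)
      moreover have "int ?n * place_val P z \<le> int ?n * (-1)"
        using neg by (intro mult_left_mono) auto
      ultimately have "place_val P (w * inverse z ^ ?n) \<ge> 0" by linarith
      then have "w * inverse z ^ ?n \<in> place_ring P"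
        using place_val_nonneg_iff[OF P, of "w * inverse z ^ ?n"] False \<open>z \<noteq> 0\<close> by auto
      then have "w * inverse z ^ ?n * z ^ ?n \<in> place_ring Q"
        using sub z(1) vr_mult[OF vrQ] vr_power[OF vrQ] by blast
      then show ?thesis using \<open>z \<noteq> 0\<close> by (simp add: power_inverse mult.assoc)
    qed (simp add: vr_0[OF vrQ])
    then show False using vr_proper[OF vrQ] by blast
  qed
  with sub show ?thesis
    using place_eq_nonunits[OF P] place_eq_nonunits[OF Q] by blast
qed

text \<open>For two places, divide a function that is integral at \<open>P\<close> only by one that
  is integral at \<open>Q\<close> only. For more places, add a high power of a function separating
  \<open>P\<close> from the new place.\<close>

lemma separate_places:
  assumes P: "is_place \<iota> P" and S: "finite S" "\<And>Q. Q \<in> S \<Longrightarrow> is_place \<iota> Q" "P \<notin> S"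
  shows "\<exists>u. u \<noteq> 0 \<and> place_val P u > 0 \<and> (\<forall>Q\<in>S. place_val Q u < 0)"
proof -
  have pair: "\<exists>z. z \<noteq> 0 \<and> place_val P z > 0 \<and> place_val Q z < 0" if Q: "is_place \<iota> Q" "Q \<noteq> P" for Q
  proof -
    have *: "\<exists>z. z \<noteq> 0 \<and> place_val P z \<ge> 0 \<and> place_val Q z < 0"
      if "is_place \<iota> P" "is_place \<iota> Q" "Q \<noteq> P" for P Q
    proof -
      have "\<not> place_ring P \<subseteq> place_ring Q"
        using that(3) place_ring_subset_imp_eq[OF that(1,2)] by auto
      then have "\<exists>z. z \<in> place_ring P \<and> z \<notin> place_ring Q" by blast
      then show ?thesis
        using place_val_nonneg_iff[OF that(1)] place_val_nonneg_iff[OF that(2)]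
          vr_0[OF valuation_ring_place_ring[OF that(2)]] by (metis linorder_not_less)
    qed
    obtain z where z: "z \<noteq> 0" "place_val P z \<ge> 0" "place_val Q z < 0"
      using *[OF P Q] by blast
    obtain w where w: "w \<noteq> 0" "place_val Q w \<ge> 0" "place_val P w < 0"
      using *[OF Q(1) P Q(2)[symmetric]] by blast
    have "place_val P (z * inverse w) > 0" "place_val Q (z * inverse w) < 0"
      using z w P Q by (simp_all add: place_val_mult place_val_inverse)
    then show ?thesis using z(1) w(1) by (intro exI[of _ "z * inverse w"]) auto
  qed
  show ?thesis using S
  proof (induction S)
    case empty
    show ?case
      using uniformizer_nonzero[OF P] place_val_uniformizer[OF P] by (intro exI[of _ "uniformizer P"]) auto
  next
    case (insert Q S)
    then obtain y where y: "y \<noteq> 0" "place_val P y > 0" "\<forall>Q\<in>S. place_val Q y < 0" by auto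
    have Q: "is_place \<iota> Q" "Q \<noteq> P" using insert by auto
    obtain z where z: "z \<noteq> 0" "place_val P z > 0" "place_val Q z < 0"
      using pair[OF Q] by blast
    show ?case
    proof (cases "place_val Q y < 0")
      case True
      with y show ?thesis by auto
    next
      case False
      \<comment> \<open>\<open>r\<close> exceeds every \<open>\<bar>place_val Q y\<bar>\<close> on
        \<open>S\<close>. Hence at a pole of z in \<open>S\<close> the power \<open>z ^ r\<close>
        dominates y, at the other places of \<open>S\<close> y dominates, and the poles never
        cancel.\<close>
      define r where "r = Suc (\<Sum>Q\<in>S. nat \<bar>place_val Q y\<bar>)"
      define u where "u = y + z ^ r"
      have big: "int r > \<bar>place_val Q' y\<bar>" if "Q' \<in> S" for Q'
        using member_le_sum[of Q' S "\<lambda>Q. nat \<bar>place_val Q y\<bar>"] that insert.hyps(1)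
        unfolding r_def by linarith
      have r: "r > 0" by (simp add: r_def)
      have vz: "z ^ r \<noteq> 0" "is_place \<iota> Q' \<Longrightarrow> place_val Q' (z ^ r) = int r * place_val Q' z" for Q'
        using z(1) place_val_power by auto
      have uQ: "u \<noteq> 0 \<and> place_val Q u < 0"
      proof -
        have neg: "int r * place_val Q z < 0" using r z(3) by (simp add: mult_less_0_iff)
        then have "val_ge Q (place_val Q (z ^ r) + 1) y"
          using False vz(2)[OF Q(1)] by (simp add: val_ge_def)
        from place_val_add_dominant[OF Q(1) vz(1) this] show ?thesis
          using neg vz(2)[OF Q(1)] unfolding u_def by (simp add: add.commute)
      qed
      have "place_val Q' u < 0" if "Q' \<in> S" for Q'
      proof -
        have Q': "is_place \<iota> Q'" using insert.prems that by blast
        have yneg: "place_val Q' y < 0" using y that by blast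
        consider "place_val Q' z \<ge> 0" | "place_val Q' z < 0" by linarith
        then show ?thesis
        proof cases
          case 1
          then have "int r * place_val Q' z \<ge> 0" by simp
          then have "val_ge Q' (place_val Q' y + 1) (z ^ r)"
            using yneg vz(2)[OF Q'] by (simp add: val_ge_def)
          from place_val_add_dominant[OF Q' y(1) this] show ?thesis
            using yneg unfolding u_def by simp
        next
          case 2
          then have "int r * place_val Q' z \<le> int r * (- 1)"
            by (intro mult_left_mono) auto
          then have neg: "place_val Q' (z ^ r) + 1 \<le> place_val Q' y"
            using big[OF that] vz(2)[OF Q'] by simp
          then have "val_ge Q' (place_val Q' (z ^ r) + 1) y" by (simp add: val_ge_def)
          from place_val_add_dominant[OF Q' vz(1) this] show ?thesis
            using yneg neg unfolding u_def by (simp add: add.commute)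
        qed
      qed
      moreover have "place_val P u > 0"
      proof -
        have "int r * place_val P z > 0" using r z(2) by simp
        then have "val_ge P 1 (z ^ r)" using vz(2)[OF P] by (simp add: val_ge_def)
        moreover have "val_ge P 1 y" using y(2) by (simp add: val_ge_def)
        ultimately have "val_ge P 1 u" unfolding u_def using val_ge_add[OF P] by blast
        then show ?thesis using uQ by (simp add: val_ge_def)
      qed
      ultimately show ?thesis using uQ by blast
    qed
  qed
qed

text \<open>The function is \<open>1 / (1 + u ^ n)\<close>, where u has a zero at \<open>P\<close>
  and poles on \<open>S\<close>: the power \<open>u ^ n\<close> is negligible at \<open>P\<close>
  and dominates the 1 at the places of \<open>S\<close>.\<close>

lemma weak_approximation:
  assumes P: "is_place \<iota> P" and S: "finite S" "\<And>Q. Q \<in> S \<Longrightarrow> is_place \<iota> Q" "P \<notin> S" and n: "n > 0"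
  shows "\<exists>w. val_ge P (int n) (w - 1) \<and> (\<forall>Q\<in>S. val_ge Q (int n) w)"
proof -
  obtain u where u: "u \<noteq> 0" "place_val P u > 0" "\<forall>Q\<in>S. place_val Q u < 0"
    using separate_places[OF P S] by blast
  define v where "v = 1 + u ^ n"
  have one: "place_val R 1 = 0" if "is_place \<iota> R" for R
    using place_val_emb[OF that, of 1] by simp
  have un: "u ^ n \<noteq> 0" using u by simp
  have vP: "int n \<le> place_val P (u ^ n)"
    using u(2) n unfolding place_val_power[OF P u(1)] by (simp add: mult_le_cancel_left1)
  then have "val_ge P (place_val P 1 + 1) (u ^ n)" using n one[OF P] by (simp add: val_ge_def)
  note v = place_val_add_dominant[OF P one_neq_zero this, folded v_def]
  have "inverse v - 1 = - (u ^ n * inverse v)" using v(1) by (simp add: v_def field_simps)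
  moreover have "val_ge P (int n + 0) (u ^ n * inverse v)"
    using vP v one[OF P] P by (intro val_ge_mult) (auto simp: val_ge_def place_val_inverse)
  ultimately have "val_ge P (int n) (inverse v - 1)" using P by simp
  moreover have "val_ge Q (int n) (inverse v)" if "Q \<in> S" for Q
  proof -
    have Q: "is_place \<iota> Q" using S that by blast
    have "int n * place_val Q u \<le> int n * (- 1)"
      using u(3) that by (intro mult_left_mono) auto
    then have vQ: "place_val Q (u ^ n) \<le> - int n" by (simp add: place_val_power[OF Q u(1)])
    then have "val_ge Q (place_val Q (u ^ n) + 1) 1" using one[OF Q] n by (simp add: val_ge_def)
    from place_val_add_dominant[OF Q un this] have "place_val Q v \<le> - int n"
      using vQ by (simp add: v_def add.commute)
    then show ?thesis using place_val_inverse[OF Q v(1)] by (simp add: val_ge_def)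
  qed
  ultimately show ?thesis by blast
qed

text \<open>A zero \<open>P\<close> of x contributes functions of exact orders 0, ...,
  \<open>e P - 1\<close> at \<open>P\<close> that vanish to order \<open>e Q\<close> at the other
  zeros \<open>Q\<close>. Together they show that the number of zeros, with multiplicity, is at most
  the degree of F over K(x). Only a lower bound on the multiplicity is assumed, so \<open>e\<close>
  may also be constantly 1.\<close>

lemma zero_family:
  assumes S: "finite S" "\<And>P. P \<in> S \<Longrightarrow> is_place \<iota> P" and x: "x \<noteq> 0"
    and e: "\<And>P. P \<in> S \<Longrightarrow> int (e P) \<le> place_val P x"
  shows "\<exists>h. indep_over x h (Sigma S (\<lambda>P. {..<e P})) \<and> (\<forall>i\<in>Sigma S (\<lambda>P. {..<e P}). h i \<noteq> 0)"
proof -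
  have "\<exists>z. z \<noteq> 0 \<and> place_val P z = int a \<and> (\<forall>Q\<in>S - {P}. val_ge Q (int (e Q)) z)"
    if PS: "P \<in> S" for P a
  proof -
    have P: "is_place \<iota> P" using S PS by blast
    define y where "y = uniformizer P ^ a"
    have y: "y \<noteq> 0" "place_val P y = int a"
      using uniformizer_power_val[OF P, of "int a"] by (auto simp: y_def)
    \<comment> \<open>Large enough for a zero of order \<open>n\<close> to outweigh a pole of y at
      \<open>Q\<close> and still leave order \<open>e Q\<close>.\<close>
    define n where "n = Suc (\<Sum>Q\<in>S. e Q + nat \<bar>place_val Q y\<bar>)"
    obtain w where w: "val_ge P (int n) (w - 1)" "\<forall>Q\<in>S - {P}. val_ge Q (int n) w"
      using weak_approximation[OF P, of "S - {P}" n] S by (auto simp: n_def)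
    have one: "place_val P 1 = 0" using place_val_emb[OF P, of 1] by simp
    have "val_ge P (place_val P 1 + 1) (w - 1)"
      by (rule val_ge_mono[OF w(1)]) (simp only: one, simp add: n_def del: of_nat_sum)
    from place_val_add_dominant[OF P one_neq_zero this] have w0: "w \<noteq> 0" "place_val P w = 0"
      using one by auto
    have "val_ge Q (int (e Q)) (y * w)" if Q: "Q \<in> S - {P}" for Q
    proof -
      have "e Q + nat \<bar>place_val Q y\<bar> \<le> n"
        using member_le_sum[of Q S "\<lambda>Q. e Q + nat \<bar>place_val Q y\<bar>"] Q S(1) unfolding n_def by simp
      then have "int (e Q) \<le> place_val Q y + int n" by linarith
      moreover have "val_ge Q (place_val Q y + int n) (y * w)"
        using Q S w by (intro val_ge_mult val_ge_place_val) auto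
      ultimately show ?thesis using val_ge_mono by blast
    qed
    then show ?thesis
      using y w0 P by (intro exI[of _ "y * w"]) (auto simp: place_val_mult)
  qed
  then obtain H where H: "\<And>P a. P \<in> S \<Longrightarrow> H P a \<noteq> 0 \<and> place_val P (H P a) = int a \<and>
      (\<forall>Q\<in>S - {P}. val_ge Q (int (e Q)) (H P a))" by metis
  define h where "h = (\<lambda>(P, a). H P a)"
  let ?I = "Sigma S (\<lambda>P. {..<e P})"
  have fin: "finite ?I" using S by simp
  have "indep_over x h ?I"
  proof (rule indep_overI[OF x fin])
    fix p :: "_ \<Rightarrow> 'k poly" and i assume i: "i \<in> ?I" "Polynomial.coeff (p i) 0 \<noteq> 0"
    obtain P a0 where Pa0: "i = (P, a0)" "P \<in> S" "a0 < e P" using i by auto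
    have P: "is_place \<iota> P" using S Pa0 by blast
    \<comment> \<open>The term with the smallest index at \<open>P\<close> whose constant term is
      nonzero has order exactly \<open>a\<close>. At smaller indices the coefficient is divisible by
      x and so has order at least \<open>e P\<close>, which exceeds \<open>a\<close>; the functions
      belonging to other zeros have that order themselves.\<close>
    define a where "a = (LEAST a. Polynomial.coeff (p (P, a)) 0 \<noteq> 0)"
    have a: "Polynomial.coeff (p (P, a)) 0 \<noteq> 0" "a \<le> a0"
      using i(2) unfolding a_def Pa0(1)
      by (rule LeastI[where P = "\<lambda>a. Polynomial.coeff (p (P, a)) 0 \<noteq> 0"], rule Least_le)
    have a_min: "Polynomial.coeff (p (P, b)) 0 = 0" if "b < a" for b
      using not_less_Least[of b "\<lambda>a. Polynomial.coeff (p (P, a)) 0 \<noteq> 0"] that unfolding a_def by blast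
    have Pa: "(P, a) \<in> ?I" using a(2) Pa0 by auto
    have vx: "val_ge P (int (e P)) x" using e[OF Pa0(2)] by (simp add: val_ge_def)
    then have vx1: "val_ge P 1 x" and vx0: "val_ge P 0 x" using Pa0(3) by (auto elim!: val_ge_mono)
    have split: "ev q x = \<iota> (Polynomial.coeff q 0) + x * ev r x" if "q = pCons (Polynomial.coeff q 0) r" for q r
      by (subst that) simp
    have small: "val_ge P (int (e P)) (ev q x)" if "Polynomial.coeff q 0 = 0" for q
    proof -
      obtain r where r: "q = pCons (Polynomial.coeff q 0) r" by (metis coeff_pCons_0 pCons_cases)
      have "val_ge P (int (e P) + 0) (x * ev r x)"
        using vx vx0 P by (intro val_ge_mult val_ge_ev) auto
      then show ?thesis using split[OF r] that by simp
    qed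
    have main: "ev (p (P, a)) x \<noteq> 0 \<and> place_val P (ev (p (P, a)) x) = 0"
    proof -
      obtain r where r: "p (P, a) = pCons (Polynomial.coeff (p (P, a)) 0) r" by (metis coeff_pCons_0 pCons_cases)
      have "val_ge P (1 + 0) (x * ev r x)"
        using vx1 vx0 P by (intro val_ge_mult val_ge_ev) auto
      then show ?thesis
        using place_val_add_dominant[OF P, of "\<iota> (Polynomial.coeff (p (P, a)) 0)" "x * ev r x"] a(1)
        unfolding split[OF r] by (simp add: place_val_emb[OF P])
    qed
    let ?m = "ev (p (P, a)) x * h (P, a)"
    have m: "?m \<noteq> 0" "place_val P ?m = int a"
      using main H[OF Pa0(2), of a] P by (auto simp: h_def place_val_mult)
    have rest: "val_ge P (int a + 1) (ev (p j) x * h j)" if j: "j \<in> ?I - {(P, a)}" for j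
    proof -
      obtain Q b where Qb: "j = (Q, b)" "Q \<in> S" "b < e Q" using j by auto
      have ea: "int a + 1 \<le> int (e P)" using a(2) Pa0 by simp
      show ?thesis
      proof (cases "Q = P")
        case False
        then have "val_ge P (int (e P)) (h j)" using H[OF Qb(2), of b] Pa0 by (simp add: h_def Qb)
        then have "val_ge P (int (e P)) (ev (p j) x * h j)"
          using vx0 P by (intro val_ge_mult' val_ge_ev) auto
        then show ?thesis using ea val_ge_mono by blast
      next
        case True
        have hb: "val_ge P (int b) (h j)" using H[OF Pa0(2), of b] Qb True by (simp add: h_def val_ge_def)
        consider "b < a" | "b > a" using j Qb True by fastforce
        then show ?thesis
        proof cases
          case 1
          have "val_ge P (int (e P) + int b) (ev (p j) x * h j)"
            using hb small[of "p j"] a_min[OF 1] P Qb True by (intro val_ge_mult) auto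
          then show ?thesis by (rule val_ge_mono) (use ea in simp)
        next
          case 2
          have "val_ge P (int b) (ev (p j) x * h j)"
            using hb vx0 P by (intro val_ge_mult' val_ge_ev) auto
          then show ?thesis by (rule val_ge_mono) (use 2 in simp)
        qed
      qed
    qed
    have rest_sum: "val_ge P (place_val P ?m + 1) (\<Sum>j\<in>?I - {(P, a)}. ev (p j) x * h j)"
      unfolding m(2) using rest by (intro val_ge_sum[OF P]) auto
    have "(\<Sum>i\<in>?I. ev (p i) x * h i) = ?m + (\<Sum>j\<in>?I - {(P, a)}. ev (p j) x * h j)"
      using fin Pa by (rule sum.remove)
    also have "\<dots> \<noteq> 0"
      by (rule place_val_add_dominant(1)[OF P m(1) rest_sum])
    finally show "(\<Sum>i\<in>?I. ev (p i) x * h i) \<noteq> 0" .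
  qed
  moreover have "\<forall>i\<in>?I. h i \<noteq> 0" using H by (auto simp: h_def)
  ultimately show ?thesis by blast
qed

text \<open>One function per zero already gives an independent family, so the number of zeros is
  bounded.\<close>

lemma finite_zeros:
  assumes x: "x \<noteq> 0"
  shows "finite {P. is_place \<iota> P \<and> place_val P x > 0}"
proof -
  obtain N where N: "\<And>(I::('f set \<times> nat) set) h. finite I \<Longrightarrow> indep_over x h I \<Longrightarrow> card I \<le> N"
    using indep_over_bounded by blast
  have "card S \<le> N" if S: "finite S" "S \<subseteq> {P. is_place \<iota> P \<and> place_val P x > 0}" for S
  proof -
    obtain h where "indep_over x h (Sigma S (\<lambda>P. {..<1::nat}))"
      using zero_family[OF S(1) _ x, of "\<lambda>_. 1"] S(2) by fastforce
    from N[OF _ this] show ?thesis using S(1) by simp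
  qed
  then show ?thesis
    by (meson finite_if_finite_subsets_card_bdd)
qed

lemma finite_support:
  assumes x: "x \<noteq> 0"
  shows "finite {P. is_place \<iota> P \<and> place_val P x \<noteq> 0}"
proof (rule finite_subset)
  show "{P. is_place \<iota> P \<and> place_val P x \<noteq> 0} \<subseteq>
      {P. is_place \<iota> P \<and> place_val P x > 0} \<union> {P. is_place \<iota> P \<and> place_val P (inverse x) > 0}"
    using place_val_inverse x by auto
qed (use finite_zeros x in auto)

subsection \<open>Existence of poles\<close>

lemma algebraic_imp_constant:
  assumes "ev q z = 0" "q \<noteq> 0"
  shows "z \<in> range \<iota>"
  using assms
proof (induction "Polynomial.degree q" arbitrary: q)
  case 0
  then obtain a where "q = [:a:]" "a \<noteq> 0" by (metis degree_0_id pCons_eq_0_iff)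
  then show ?case using 0 by simp
next
  case (Suc n)
  then obtain a where "Polynomial.poly q a = 0"
    using alg_closed_imp_poly_has_root[of q] by auto
  then obtain q' where q': "q = [:- a, 1:] * q'"
    by (metis dvdE poly_eq_0_iff_dvd)
  with Suc.prems have "q' \<noteq> 0" by auto
  moreover have "n = Polynomial.degree q'"
    using Suc.hyps(2) \<open>q' \<noteq> 0\<close> unfolding q' by (subst (asm) degree_mult_eq) auto
  moreover have "(z - \<iota> a) * ev q' z = 0"
    using Suc.prems unfolding q' ev_mult by simp
  ultimately show ?case using Suc.hyps(1)[of q'] by auto
qed

section \<open>Construction of a valuation ring that avoids a given nonconstant function\<close>

definition subring_over :: "'f set \<Rightarrow> bool" where
  "subring_over R \<longleftrightarrow> (\<forall>a\<in>R. \<forall>b\<in>R. a - b \<in> R \<and> a * b \<in> R) \<and> range \<iota> \<subseteq> R"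

lemma
  assumes "subring_over R"
  shows subring_diff: "a \<in> R \<Longrightarrow> b \<in> R \<Longrightarrow> a - b \<in> R"
    and subring_mult: "a \<in> R \<Longrightarrow> b \<in> R \<Longrightarrow> a * b \<in> R"
    and subring_emb: "\<iota> c \<in> R"
    and subring_0: "0 \<in> R"
    and subring_1: "1 \<in> R"
    and subring_add: "a \<in> R \<Longrightarrow> b \<in> R \<Longrightarrow> a + b \<in> R"
    and subring_power: "a \<in> R \<Longrightarrow> a ^ n \<in> R"
proof -
  note R = assms[unfolded subring_over_def]
  show *: "a \<in> R \<Longrightarrow> b \<in> R \<Longrightarrow> a - b \<in> R" "a \<in> R \<Longrightarrow> b \<in> R \<Longrightarrow> a * b \<in> R" "\<iota> c \<in> R" for a b c
    using R by blast+
  show 0: "0 \<in> R" and 1: "1 \<in> R" using *(3)[of 0] *(3)[of 1] by simp_all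
  show "a \<in> R \<Longrightarrow> b \<in> R \<Longrightarrow> a + b \<in> R" using *(1)[of a "0 - b"] *(1)[of 0 b] 0 by simp
  show "a \<in> R \<Longrightarrow> a ^ n \<in> R" by (induction n) (use * 1 in auto)
qed

lemma subring_sum: "subring_over R \<Longrightarrow> (\<And>i. i \<in> I \<Longrightarrow> h i \<in> R) \<Longrightarrow> sum h I \<in> R"
  by (induction I rule: infinite_finite_induct) (auto simp: subring_0 subring_add)

text \<open>A subring of \<open>F\<close> containing \<open>K\<close> and \<open>1/w\<close> and maximal with respect to avoiding \<open>w\<close> is a
  valuation ring.\<close>

lemma ex_valuation_ring_avoiding:
  assumes w: "w \<notin> range \<iota>"
  shows "\<exists>R. valuation_ring \<iota> R \<and> w \<notin> R"
proof -
  define y where "y = inverse w"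
  have w0: "w \<noteq> 0" using w emb_0 by (metis rangeI)
  then have yw: "y * w = 1" "y \<noteq> 0" by (auto simp: y_def)
  have y: "y \<notin> range \<iota>"
  proof
    assume "y \<in> range \<iota>"
    then obtain c where "y = \<iota> c" by blast
    then have "w = \<iota> (inverse c)" by (metis emb_inverse inverse_inverse_eq y_def)
    with w show False by blast
  qed
  define \<A> where "\<A> = {R. subring_over R \<and> y \<in> R \<and> w \<notin> R}"
  \<comment> \<open>The ring K[y] avoids w: from \<open>w = ev p y\<close> it would follow that
    \<open>y * ev p y = 1\<close>, making y algebraic over K and hence constant.\<close>
  have "range (\<lambda>p. ev p y) \<in> \<A>"
  proof -
    have "subring_over (range (\<lambda>p. ev p y))"
      unfolding subring_over_def
    proof (intro conjI ballI)
      show "range \<iota> \<subseteq> range (\<lambda>p. ev p y)"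
      proof
        fix z assume "z \<in> range \<iota>"
        then obtain c where "z = \<iota> c" by blast
        then have "z = ev [:c:] y" by simp
        then show "z \<in> range (\<lambda>p. ev p y)" by (rule range_eqI)
      qed
    next
      fix a b assume "a \<in> range (\<lambda>p. ev p y)" "b \<in> range (\<lambda>p. ev p y)"
      then obtain p q where "a = ev p y" "b = ev q y" by blast
      then have "a - b = ev (p - q) y" "a * b = ev (p * q) y" by simp_all
      then show "a - b \<in> range (\<lambda>p. ev p y)" "a * b \<in> range (\<lambda>p. ev p y)" by blast+
    qed
    moreover have "y = ev [:0, 1:] y" by simp
    then have "y \<in> range (\<lambda>p. ev p y)" by (rule range_eqI)
    moreover have "w \<notin> range (\<lambda>p. ev p y)"
    proof
      assume "w \<in> range (\<lambda>p. ev p y)"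
      then obtain p where "w = ev p y" by blast
      then have "ev (pCons (- 1) p) y = 0" using yw(1) by simp
      then show False using algebraic_imp_constant[of "pCons (- 1) p" y] y by simp
    qed
    ultimately show ?thesis by (simp add: \<A>_def)
  qed
  moreover have "\<Union>\<C> \<in> \<A>" if \<C>: "\<C> \<noteq> {}" "subset.chain \<A> \<C>" for \<C>
  proof -
    have mem: "subring_over R" "y \<in> R" "w \<notin> R" if "R \<in> \<C>" for R
      using \<C>(2) that unfolding subset_chain_def \<A>_def by auto
    have pair: "\<exists>R\<in>\<C>. a \<in> R \<and> b \<in> R" if ab: "a \<in> \<Union>\<C>" "b \<in> \<Union>\<C>" for a b
    proof -
      obtain A B where AB: "A \<in> \<C>" "a \<in> A" "B \<in> \<C>" "b \<in> B" using ab by blast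
      then have "A \<subseteq> B \<or> B \<subseteq> A" using \<C>(2) unfolding subset_chain_def by blast
      with AB show ?thesis by blast
    qed
    have "subring_over (\<Union>\<C>)"
      unfolding subring_over_def
    proof (intro conjI ballI)
      show "range \<iota> \<subseteq> \<Union>\<C>" using \<C>(1) subring_emb[OF mem(1)] by blast
    next
      fix a b assume "a \<in> \<Union>\<C>" "b \<in> \<Union>\<C>"
      then obtain R where R: "R \<in> \<C>" "a \<in> R" "b \<in> R" using pair by blast
      then have "a - b \<in> R" "a * b \<in> R"
        using subring_diff[OF mem(1)] subring_mult[OF mem(1)] by blast+
      with R(1) show "a - b \<in> \<Union>\<C>" "a * b \<in> \<Union>\<C>" by blast+
    qed
    with mem \<C>(1) show ?thesis unfolding \<A>_def by blast
  qed
  ultimately obtain M where "M \<in> \<A>" and max: "\<And>R. R \<in> \<A> \<Longrightarrow> M \<subseteq> R \<Longrightarrow> R = M"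
    using subset_Zorn_nonempty[of \<A>] by blast
  then have M: "subring_over M" "y \<in> M" "w \<notin> M" by (auto simp: \<A>_def)
  note sub = subring_diff[OF M(1)] subring_mult[OF M(1)] subring_0[OF M(1)] subring_1[OF M(1)]
    subring_add[OF M(1)] subring_power[OF M(1)] subring_sum[OF M(1)]
  have adjoin: "\<exists>p. (\<forall>i. Polynomial.coeff p i \<in> M) \<and> Polynomial.poly p z = w" if z: "z \<notin> M" for z
  proof -
    let ?R = "{Polynomial.poly p z | p. \<forall>i. Polynomial.coeff p i \<in> M}"
    have const: "a \<in> ?R" if "a \<in> M" for a
      using that sub(3) by (intro CollectI exI[of _ "[:a:]"]) (auto simp: coeff_pCons split: nat.splits)
    have "subring_over ?R"
      unfolding subring_over_def
    proof (intro conjI ballI)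
      show "range \<iota> \<subseteq> ?R" using const subring_emb[OF M(1)] by blast
    next
      fix a b assume "a \<in> ?R" "b \<in> ?R"
      then obtain p q where pq: "a = Polynomial.poly p z" "b = Polynomial.poly q z"
        "\<forall>i. Polynomial.coeff p i \<in> M" "\<forall>i. Polynomial.coeff q i \<in> M" by blast
      show "a - b \<in> ?R" using pq sub by (intro CollectI exI[of _ "p - q"]) auto
      show "a * b \<in> ?R" using pq sub
        by (intro CollectI exI[of _ "p * q"]) (auto simp: coeff_mult intro!: sub(7) sub(2))
    qed
    moreover have "z \<in> ?R" using sub(3,4)
      by (intro CollectI exI[of _ "[:0, 1:]"]) (auto simp: coeff_pCons split: nat.splits)
    ultimately have "?R \<notin> \<A>" using max[of ?R] const z by blast
    then have "w \<in> ?R" using \<open>subring_over ?R\<close> const[OF M(2)] unfolding \<A>_def by blast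
    then show ?thesis by blast
  qed
  \<comment> \<open>Put \<open>u = 1 - y * a\<close>. If \<open>1 / u\<close> were missing,
    adjoining it would produce w, so that \<open>w * u ^ n \<in> M\<close> after clearing
    denominators. Since \<open>y * w = 1\<close>, each factor u can be removed at the cost of an
    element of \<open>M\<close>, until w itself lies in \<open>M\<close>.\<close>
  have unit: "inverse (1 - y * a) \<in> M" if a: "a \<in> M" for a
  proof (rule ccontr)
    define u where "u = 1 - y * a"
    assume "inverse (1 - y * a) \<notin> M"
    then have u: "inverse u \<notin> M" by (simp add: u_def)
    then have "u \<noteq> 0" using sub(3) by auto
    have uM: "u \<in> M" using a M(2) sub by (simp add: u_def)
    obtain p where p: "\<forall>i. Polynomial.coeff p i \<in> M" "Polynomial.poly p (inverse u) = w"
      using adjoin[OF u] by blast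
    let ?n = "Polynomial.degree p"
    have "w * u ^ ?n = (\<Sum>i\<le>?n. Polynomial.coeff p i * u ^ (?n - i))"
      unfolding p(2)[symmetric] poly_altdef sum_distrib_right
      using \<open>u \<noteq> 0\<close> by (intro sum.cong refl) (simp add: power_diff field_simps)
    also have "\<dots> \<in> M" using p(1) uM sub by (intro sub(7) sub(2)) auto
    finally have "w * u ^ ?n \<in> M" .
    moreover have "w * u ^ k \<in> M \<Longrightarrow> w \<in> M" for k
    proof (induction k)
      case (Suc k)
      have "w * u ^ Suc k = w * u ^ k - (y * w) * (a * u ^ k)"
        by (simp add: u_def algebra_simps)
      then have "w * u ^ k = w * u ^ Suc k + a * u ^ k" by (simp add: yw)
      also have "\<dots> \<in> M" by (rule sub(5)[OF Suc.prems sub(2)[OF a sub(6)[OF uM]]])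
      finally show ?case by (rule Suc.IH)
    qed simp
    ultimately show False using M(3) by blast
  qed
  \<comment> \<open>Such relations arise by multiplying an expression of w as a polynomial in z over
    \<open>M\<close> by y. They show that the ideal generated by y becomes trivial in
    \<open>M[z]\<close>.\<close>
  define \<P> where "\<P> z = {p. (\<forall>i. \<exists>a\<in>M. Polynomial.coeff p i = y * a) \<and> Polynomial.poly p z = 1}" for z
  have nonempty: "\<exists>p. p \<in> \<P> z" if z: "z \<notin> M" for z
  proof -
    obtain p where "\<forall>i. Polynomial.coeff p i \<in> M" "Polynomial.poly p z = w"
      using adjoin[OF z] by blast
    then show ?thesis unfolding \<P>_def by (intro exI[of _ "Polynomial.smult y p"]) (auto simp: yw)
  qed
  have reduce: "\<exists>p'\<in>\<P> z. Polynomial.degree p' < Polynomial.degree p"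
    if p: "p \<in> \<P> z" and q: "q \<in> \<P> (inverse z)" and le: "Polynomial.degree q \<le> Polynomial.degree p"
      and z0: "z \<noteq> 0" for p q z
  proof -
    let ?n = "Polynomial.degree p" and ?m = "Polynomial.degree q"
    have "\<forall>i. \<exists>a. a \<in> M \<and> Polynomial.coeff p i = y * a" using p unfolding \<P>_def by blast
    then obtain a where a: "\<And>i. a i \<in> M" "\<And>i. Polynomial.coeff p i = y * a i" by metis
    have "\<forall>i. \<exists>b. b \<in> M \<and> Polynomial.coeff q i = y * b" using q unfolding \<P>_def by blast
    then obtain b where b: "\<And>i. b i \<in> M" "\<And>i. Polynomial.coeff q i = y * b i" by metis
    define c where "c = inverse (1 - y * b 0)"
    have c: "c \<in> M" using unit b(1) by (simp add: c_def)
    have not1: "1 \<noteq> y * a" if "a \<in> M" for a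
      using that M(3) yw by (metis mult.commute mult.right_neutral mult.left_commute)
    then have "c * (1 - y * b 0) = 1" using b(1) by (simp add: c_def)
    have n: "?n > 0"
    proof (rule ccontr)
      assume "\<not> ?n > 0"
      then have "Polynomial.poly p z = Polynomial.coeff p 0"
        by (simp add: poly_altdef)
      with p a not1 show False by (auto simp: \<P>_def)
    qed
    have "1 = (\<Sum>j\<le>?m. y * b j * inverse z ^ j)"
      using q by (simp add: \<P>_def poly_altdef b(2))
    also have "\<dots> = y * b 0 + (\<Sum>j=1..?m. y * b j * inverse z ^ j)"
      by (simp add: sum.atMost_shift atMost_atLeast0 sum.atLeast_Suc_atMost)
    finally have "1 - y * b 0 = (\<Sum>j=1..?m. y * b j * inverse z ^ j)" by (simp add: algebra_simps)
    then have one: "1 = c * (\<Sum>j=1..?m. y * b j * inverse z ^ j)"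
      using \<open>c * (1 - y * b 0) = 1\<close> by simp
    \<comment> \<open>Since \<open>1 - y * b 0\<close> is a unit, the relation for
      \<open>1 / z\<close> can be solved for 1 in terms of negative powers of z only. Multiplying
      the top term of \<open>p\<close> by this expression lowers its degree; the assumption on the
      degrees keeps all exponents nonnegative.\<close>
    define r where "r = (\<Sum>j=1..?m. Polynomial.monom (y * (a ?n * (c * (y * b j)))) (?n - j))"
    define p' where "p' = p - Polynomial.monom (y * a ?n) ?n + r"
    have "y * a ?n * z ^ ?n = y * a ?n * z ^ ?n * (c * (\<Sum>j=1..?m. y * b j * inverse z ^ j))"
      using one by simp
    also have "\<dots> = (\<Sum>j=1..?m. y * (a ?n * (c * (y * b j))) * (z ^ ?n * inverse z ^ j))"
      by (simp add: sum_distrib_left mult_ac)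
    also have "\<dots> = (\<Sum>j=1..?m. y * (a ?n * (c * (y * b j))) * z ^ (?n - j))"
      using le z0 by (intro sum.cong refl) (simp add: power_diff power_inverse field_simps)
    also have "\<dots> = Polynomial.poly r z" by (simp add: r_def poly_sum poly_monom)
    finally have "Polynomial.poly p' z = 1"
      using p by (simp add: p'_def poly_monom \<P>_def)
    moreover have "\<exists>d\<in>M. Polynomial.coeff p' i = y * d" for i
    proof (rule bexI)
      let ?d = "a i - (if i = ?n then a ?n else 0) +
        (\<Sum>j=1..?m. if ?n - j = i then a ?n * (c * (y * b j)) else 0)"
      show "Polynomial.coeff p' i = y * ?d"
        unfolding p'_def r_def coeff_add coeff_diff coeff_sum a(2)
        by (simp add: algebra_simps sum_distrib_left if_distrib cong: if_cong)
      show "?d \<in> M" using a(1) b(1) c M(2)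
        by (intro sub(5) sub(1) sub(7)) (auto intro!: sub(2) simp: sub(3))
    qed
    moreover have "Polynomial.coeff p' i = 0" if "i \<ge> ?n" for i
    proof -
      have "Polynomial.coeff r i = 0"
        unfolding r_def coeff_sum using that n by (intro sum.neutral) auto
      moreover have "Polynomial.coeff (p - Polynomial.monom (y * a ?n) ?n) i = 0"
        using that by (cases "i = ?n") (auto simp: a(2)[symmetric] coeff_eq_0)
      ultimately show ?thesis by (simp add: p'_def)
    qed
    then have "Polynomial.degree p' < ?n"
      using n by (intro degree_lessI) auto
    ultimately show ?thesis unfolding \<P>_def by blast
  qed
  have "z \<in> M \<or> inverse z \<in> M" if "z \<noteq> 0" for z
  proof (rule ccontr)
    assume no: "\<not> ?thesis"
    \<comment> \<open>A pair of relations for z and \<open>1 / z\<close> of minimal total degree is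
      contradictory, as the one of larger degree can be shortened by means of the other.\<close>
    let ?pred = "\<lambda>pq. fst pq \<in> \<P> z \<and> snd pq \<in> \<P> (inverse z)"
    obtain p0 q0 where "?pred (p0, q0)" using nonempty no by fastforce
    then obtain pq where pq: "?pred pq" and
      min: "\<And>pq'. ?pred pq' \<Longrightarrow> Polynomial.degree (fst pq) + Polynomial.degree (snd pq)
        \<le> Polynomial.degree (fst pq') + Polynomial.degree (snd pq')"
      using ex_has_least_nat[of ?pred "(p0, q0)" "\<lambda>pq. Polynomial.degree (fst pq) + Polynomial.degree (snd pq)"]
      by blast
    obtain p q where [simp]: "pq = (p, q)" by (cases pq)
    show False
    proof (cases "Polynomial.degree q \<le> Polynomial.degree p")
      case True
      obtain p' where "p' \<in> \<P> z" "Polynomial.degree p' < Polynomial.degree p"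
        using reduce[of p z q] pq True \<open>z \<noteq> 0\<close> by auto
      with min[of "(p', q)"] pq show False by simp
    next
      case False
      obtain q' where "q' \<in> \<P> (inverse z)" "Polynomial.degree q' < Polynomial.degree q"
        using reduce[of q "inverse z" p] pq False \<open>z \<noteq> 0\<close> by auto
      with min[of "(p, q')"] pq show False by simp
    qed
  qed
  moreover have "range \<iota> \<subset> M" using M(1,2) y unfolding subring_over_def by blast
  moreover have "M \<subset> UNIV" using M(3) by blast
  ultimately have "valuation_ring \<iota> M"
    using sub(1,2) unfolding valuation_ring_def by blast
  with M(3) show ?thesis by blast
qed

lemma ex_pole:
  assumes "w \<notin> range \<iota>"
  shows "\<exists>P. is_place \<iota> P \<and> \<not> val_ge P 0 w"
proof -
  obtain R where R: "valuation_ring \<iota> R" "w \<notin> R"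
    using ex_valuation_ring_avoiding[OF assms] by blast
  let ?P = "{z. z = 0 \<or> inverse z \<notin> R}"
  have "is_place \<iota> ?P" "place_ring ?P = R"
    using R is_place_nonunits place_ring_nonunits by auto
  with R(2) show ?thesis using val_ge_0_iff by blast
qed

subsection \<open>Riemann-Roch spaces\<close>

abbreviation L :: "('f set \<Rightarrow> int) \<Rightarrow> 'f set" where
  "L D \<equiv> riemann_roch_space \<iota> D"

lemma L_iff: "z \<in> L D \<longleftrightarrow> (\<forall>P. is_place \<iota> P \<longrightarrow> val_ge P (- D P) z)"
  by (auto simp: riemann_roch_space_def val_ge_def)

lemma subspace_L: "vs.subspace (L D)"
  by (rule vs.subspaceI) (auto simp: L_iff val_ge_add val_ge_scale)

lemma L_mono: "(\<And>P. is_place \<iota> P \<Longrightarrow> D P \<le> D' P) \<Longrightarrow> L D \<subseteq> L D'"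
  using val_ge_mono by (fastforce simp: L_iff)

lemma L_mult: "z \<in> L D \<Longrightarrow> w \<in> L E \<Longrightarrow> z * w \<in> L (\<lambda>P. D P + E P)"
  using val_ge_mult by (fastforce simp: L_iff)

text \<open>A nonconstant function has a pole, so functions integral everywhere are
  constant.\<close>

lemma L_0: "L (\<lambda>_. 0) = range \<iota>"
  using ex_pole val_ge_emb by (fastforce simp: L_iff)

text \<open>\<open>vs.dim\<close> takes the default value 0 on spaces of infinite dimension, so
  comparisons of dimensions have to be accompanied by this predicate.\<close>

definition fin_dim :: "'f set \<Rightarrow> bool" where
  "fin_dim V \<longleftrightarrow> (\<exists>B. finite B \<and> V \<subseteq> vs.span B)"

lemma fin_dim_subset: "fin_dim W \<Longrightarrow> V \<subseteq> W \<Longrightarrow> fin_dim V"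
  by (auto simp: fin_dim_def)

lemma fin_dim_basis:
  assumes "fin_dim V"
  shows "\<exists>B. finite B \<and> vs.independent B \<and> B \<subseteq> V \<and> V \<subseteq> vs.span B \<and> card B = vs.dim V"
proof -
  obtain C where C: "finite C" "V \<subseteq> vs.span C" using assms by (auto simp: fin_dim_def)
  obtain B where B: "B \<subseteq> V" "vs.independent B" "V \<subseteq> vs.span B" "card B = vs.dim V"
    using vs.basis_exists by blast
  have "finite B" using vs.independent_span_bound[OF C(1) B(2)] B(1) C(2) by blast
  with B show ?thesis by blast
qed

lemma independent_card_le_dim:
  assumes "fin_dim V" "vs.independent A" "A \<subseteq> V"
  shows "finite A" "card A \<le> vs.dim V"
proof -
  obtain B where "finite B" "V \<subseteq> vs.span B" "card B = vs.dim V"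
    using fin_dim_basis[OF assms(1)] by blast
  then show "finite A" "card A \<le> vs.dim V"
    using vs.independent_span_bound[of B A] assms by auto
qed

lemma dim_mono:
  assumes "fin_dim W" "V \<subseteq> W"
  shows "vs.dim V \<le> vs.dim W"
  using fin_dim_basis[OF fin_dim_subset[OF assms]] independent_card_le_dim(2)[OF assms(1)] assms(2)
  by (metis subset_trans)

lemma dim_eq_imp_eq:
  assumes "fin_dim W" "V \<subseteq> W" "vs.subspace V" "vs.dim V = vs.dim W"
  shows "V = W"
proof (rule ccontr)
  assume "V \<noteq> W"
  then obtain w where w: "w \<in> W" "w \<notin> V" using assms(2) by blast
  obtain B where B: "finite B" "vs.independent B" "B \<subseteq> V" "V \<subseteq> vs.span B" "card B = vs.dim V"
    using fin_dim_basis[OF fin_dim_subset[OF assms(1,2)]] by blast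
  have "w \<notin> vs.span B" using vs.span_minimal[OF B(3) assms(3)] w(2) by blast
  then have "vs.independent (insert w B)" "w \<notin> B" using B(2) vs.independent_insert vs.span_base by auto
  then have "card (insert w B) \<le> vs.dim W"
    using independent_card_le_dim(2)[OF assms(1)] B(3) w(1) assms(2) by blast
  then show False using \<open>w \<notin> B\<close> B assms(4) by simp
qed

lemma dim_extend:
  assumes "fin_dim V" "W \<subseteq> vs.span (insert w V)"
  shows "fin_dim W" "vs.dim W \<le> vs.dim V + 1"
proof -
  obtain B where B: "finite B" "vs.independent B" "B \<subseteq> V" "V \<subseteq> vs.span B" "card B = vs.dim V"
    using fin_dim_basis[OF assms(1)] by blast
  have "insert w V \<subseteq> vs.span (insert w B)"
    using B(4) vs.span_mono[of B "insert w B"] by (auto intro: vs.span_base)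
  then have W: "W \<subseteq> vs.span (insert w B)"
    using assms(2) vs.span_minimal vs.subspace_span by blast
  then show "fin_dim W" using B(1) unfolding fin_dim_def by blast
  have "vs.dim W \<le> card (insert w B)" using W B(1) by (intro vs.dim_le_card) auto
  also have "\<dots> \<le> card B + 1" by (metis Suc_eq_plus1 card_insert_le_m1 card_insert_disjoint insert_absorb le_SucI nle_le B(1))
  finally show "vs.dim W \<le> vs.dim V + 1" using B(5) by simp
qed

lemma indep_family_card_le_dim:
  assumes "finite I" "indep_family h I" "h ` I \<subseteq> V" "fin_dim V"
  shows "card I \<le> vs.dim V"
  using independent_card_le_dim(2)[OF assms(4) indep_family_independent[OF assms(1,2)] assms(3)]
    card_image[OF indep_family_inj[OF assms(1,2)]] by metis

lemma ell_eq_dim: "ell \<iota> D = vs.dim (L D)"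
  by (simp add: ell_def dim_over_def)

text \<open>By comparing leading coefficients at \<open>P\<close>, any two elements of the maximal
  pole order are proportional modulo \<open>L D\<close>. One additional vector therefore
  suffices.\<close>

lemma L_step:
  assumes P: "is_place \<iota> P"
  shows "\<exists>w. L (D(P := D P + 1)) \<subseteq> vs.span (insert w (L D))"
proof (cases "L (D(P := D P + 1)) \<subseteq> L D")
  case True
  then have "L (D(P := D P + 1)) \<subseteq> vs.span (insert 0 (L D))" by (auto intro: vs.span_base)
  then show ?thesis by blast
next
  case False
  then obtain w where w: "w \<in> L (D(P := D P + 1))" "w \<notin> L D" by blast
  then have other: "val_ge Q (- D Q) w" if "is_place \<iota> Q" "Q \<noteq> P" for Q
    using that by (auto simp: L_iff split: if_splits)
  then have "\<not> val_ge P (- D P) w" using w(2) unfolding L_iff by blast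
  moreover have "val_ge P (- (D P + 1)) w" using w(1) P unfolding L_iff by auto
  ultimately have w0: "w \<noteq> 0" and vw: "place_val P w = - (D P + 1)" by (auto simp: val_ge_def)
  have "z \<in> vs.span (insert w (L D))" if z: "z \<in> L (D(P := D P + 1))" for z
  proof -
    have "val_ge P (place_val P w) z" using z P unfolding L_iff vw by auto
    then obtain c where c: "val_ge P (place_val P w + 1) (z - \<iota> c * w)"
      using leading_coefficient[OF P w0] by blast
    have "z - \<iota> c * w \<in> L D"
      unfolding L_iff
    proof (intro allI impI)
      fix Q assume Q: "is_place \<iota> Q"
      show "val_ge Q (- D Q) (z - \<iota> c * w)"
      proof (cases "Q = P")
        case True
        then show ?thesis using c vw by simp
      next
        case False
        then have "val_ge Q (- D Q) z" using z Q by (auto simp: L_iff split: if_splits)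
        then show ?thesis using other[OF Q False] Q by (intro val_ge_diff val_ge_scale)
      qed
    qed
    then have "z - \<iota> c * w + \<iota> c * w \<in> vs.span (insert w (L D))"
      by (intro vs.span_add vs.span_scale vs.span_base) auto
    then show ?thesis by simp
  qed
  then show ?thesis by blast
qed

lemma ell_0: "fin_dim (L (\<lambda>_. 0))" "ell \<iota> (\<lambda>_. 0) = 1"
proof -
  have sub: "L (\<lambda>_. 0) \<subseteq> vs.span {1}"
    unfolding L_0 using vs.span_scale[OF vs.span_base[of 1 "{1}"]] by force
  then show fd: "fin_dim (L (\<lambda>_. 0))" unfolding fin_dim_def by blast
  have "vs.dim (L (\<lambda>_. 0)) \<le> card {1::'f}" using sub by (intro vs.dim_le_card) auto
  moreover have "card {1::'f} \<le> vs.dim (L (\<lambda>_. 0))"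
  proof (rule independent_card_le_dim(2)[OF fd])
    show "vs.independent {1::'f}" by simp
    show "{1} \<subseteq> L (\<lambda>_. 0)" unfolding L_0 using emb_1 by (metis empty_subsetI insert_subset rangeI)
  qed
  ultimately show "ell \<iota> (\<lambda>_. 0) = 1" by (simp add: ell_eq_dim)
qed

subsection \<open>Divisors\<close>

text \<open>If b1 and b2 have residues c1 and c2, then
  \<open>\<iota> c2 * b1 - \<iota> c1 * b2\<close> lies in \<open>P\<close>. So a residue basis
  cannot have two elements, and 1 is one.\<close>

lemma place_degree_eq_1:
  assumes P: "is_place \<iota> P"
  shows "place_degree \<iota> P = 1"
  unfolding place_degree_def
proof (rule the_equality)
  have "\<exists>c. z - \<iota> (c (1::'f)) \<in> P" if z: "z \<in> place_ring P" for z
  proof -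
    obtain c where "z - \<iota> c \<in> P" using residue_exists[OF P z] by blast
    then show ?thesis by (intro exI[of _ "\<lambda>_. c"])
  qed
  then have "residue_basis \<iota> P {1}"
    using P residue_exists[OF P] vr_1[OF valuation_ring_place_ring[OF P]] emb_place_iff[OF P]
    unfolding residue_basis_def by simp
  then show "\<exists>B. residue_basis \<iota> P B \<and> card B = 1" by (intro exI[of _ "{1}"]) auto
next
  fix n assume "\<exists>B. residue_basis \<iota> P B \<and> card B = n"
  then obtain B where B: "residue_basis \<iota> P B" "card B = n" by blast
  then have fin: "finite B" and BO: "B \<subseteq> place_ring P" by (auto simp: residue_basis_def)
  have indep: "\<forall>b\<in>B. c b = 0" if "(\<Sum>b\<in>B. \<iota> (c b) * b) \<in> P" for c
    using B that unfolding residue_basis_def by blast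
  have "B \<noteq> {}"
  proof
    assume "B = {}"
    then have "1 \<in> P"
      using B vr_1[OF valuation_ring_place_ring[OF P]] by (auto simp: residue_basis_def)
    then show False using emb_place_iff[OF P, of 1] by simp
  qed
  moreover have "b1 = b2" if b: "b1 \<in> B" "b2 \<in> B" for b1 b2
  proof (rule ccontr)
    assume ne: "b1 \<noteq> b2"
    obtain c1 where c1: "b1 - \<iota> c1 \<in> P" using residue_exists[OF P] BO b by blast
    obtain c2 where c2: "b2 - \<iota> c2 \<in> P" using residue_exists[OF P] BO b by blast
    have two: "(\<Sum>b\<in>B. \<iota> (if b = b1 then d1 else if b = b2 then d2 else 0) * b) = \<iota> d1 * b1 + \<iota> d2 * b2"
      for d1 d2
    proof -
      have "(\<Sum>b\<in>B. \<iota> (if b = b1 then d1 else if b = b2 then d2 else 0) * b) =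
          (\<Sum>b\<in>{b1, b2}. \<iota> (if b = b1 then d1 else if b = b2 then d2 else 0) * b)"
        using b fin by (intro sum.mono_neutral_right) auto
      then show ?thesis using ne by simp
    qed
    have "\<iota> c2 * (b1 - \<iota> c1) + \<iota> (- c1) * (b2 - \<iota> c2) \<in> P"
      using c1 c2 P vr_emb[OF valuation_ring_place_ring[OF P]] by (intro place_add place_mult)
    then have "\<iota> c2 * b1 + \<iota> (- c1) * b2 \<in> P" by (simp add: algebra_simps)
    from indep[OF this[folded two]] have "c1 = 0" using b ne by (metis neg_equal_0_iff_equal)
    then have "\<iota> 1 * b1 + \<iota> 0 * b2 \<in> P" using c1 by simp
    from indep[OF this[folded two]] show False using b by (metis zero_neq_one)
  qed
  ultimately have "card B = 1" by (metis card_1_singleton_iff is_singletonI' is_singleton_def One_nat_def)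
  then show "n = 1" using B by simp
qed

definition dg :: "('f set \<Rightarrow> int) \<Rightarrow> int" where
  "dg D = (\<Sum>P | D P \<noteq> 0. D P)"

lemma divisor_degree_eq: "divisor \<iota> D \<Longrightarrow> divisor_degree \<iota> D = dg D"
  unfolding divisor_degree_def dg_def
  by (intro sum.cong refl) (auto simp: divisor_def place_degree_eq_1)

lemma dg_superset: "finite S \<Longrightarrow> {P. D P \<noteq> 0} \<subseteq> S \<Longrightarrow> dg D = sum D S"
  unfolding dg_def by (rule sum.mono_neutral_left) auto

lemma divisor_finite: "divisor \<iota> D \<Longrightarrow> finite {P. D P \<noteq> 0}"
  and divisor_place: "divisor \<iota> D \<Longrightarrow> D P \<noteq> 0 \<Longrightarrow> is_place \<iota> P"
  by (auto simp: divisor_def)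

lemma divisor_0: "divisor \<iota> (\<lambda>_. 0)"
  by (simp add: divisor_def)

lemma divisor_add:
  assumes "divisor \<iota> D" "divisor \<iota> E"
  shows "divisor \<iota> (\<lambda>P. D P + E P)"
proof -
  have "finite {P. D P + E P \<noteq> 0}"
    by (rule finite_subset[of _ "{P. D P \<noteq> 0} \<union> {P. E P \<noteq> 0}"])
      (use assms divisor_finite in auto)
  moreover have "is_place \<iota> P" if "D P + E P \<noteq> 0" for P
    using that assms divisor_place[of D P] divisor_place[of E P] by (cases "D P = 0") auto
  ultimately show ?thesis by (simp add: divisor_def)
qed

lemma divisor_mult: "divisor \<iota> D \<Longrightarrow> divisor \<iota> (\<lambda>P. k * D P)"
  unfolding divisor_def by (auto elim!: finite_subset[rotated])

lemma divisor_diff: "divisor \<iota> D \<Longrightarrow> divisor \<iota> E \<Longrightarrow> divisor \<iota> (\<lambda>P. D P - E P)"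
  using divisor_add[of D "\<lambda>P. - 1 * E P"] divisor_mult[of E "- 1"] by simp

lemma divisor_sum: "(\<And>i. i \<in> I \<Longrightarrow> divisor \<iota> (h i)) \<Longrightarrow> divisor \<iota> (\<lambda>P. \<Sum>i\<in>I. h i P)"
  by (induction I rule: infinite_finite_induct) (auto simp: divisor_0 divisor_add)

lemma divisor_upd: "divisor \<iota> D \<Longrightarrow> is_place \<iota> P \<Longrightarrow> divisor \<iota> (D(P := n))"
  unfolding divisor_def by (auto elim!: finite_subset[rotated, OF finite.insertI[of _ P]])

lemma dg_add:
  assumes "divisor \<iota> D" "divisor \<iota> E"
  shows "dg (\<lambda>P. D P + E P) = dg D + dg E"
proof -
  let ?S = "{P. D P \<noteq> 0} \<union> {P. E P \<noteq> 0}"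
  have "finite ?S" using assms divisor_finite by blast
  then have "dg D = sum D ?S" "dg E = sum E ?S" "dg (\<lambda>P. D P + E P) = (\<Sum>P\<in>?S. D P + E P)"
    by (auto intro!: dg_superset)
  then show ?thesis by (simp add: sum.distrib)
qed

lemma dg_mult:
  assumes "divisor \<iota> D"
  shows "dg (\<lambda>P. k * D P) = k * dg D"
  using dg_superset[OF divisor_finite[OF assms], of "\<lambda>P. k * D P"]
    dg_superset[OF divisor_finite[OF assms] order_refl]
  by (simp add: sum_distrib_left) auto

lemma dg_diff: "divisor \<iota> D \<Longrightarrow> divisor \<iota> E \<Longrightarrow> dg (\<lambda>P. D P - E P) = dg D - dg E"
  using dg_add[of D "\<lambda>P. - 1 * E P"] dg_mult[of E "- 1"] divisor_mult[of E "- 1"] by simp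

lemma dg_nonneg: "(\<And>P. D P \<ge> 0) \<Longrightarrow> dg D \<ge> 0"
  unfolding dg_def by (intro sum_nonneg) auto

lemma dg_mono: "divisor \<iota> D \<Longrightarrow> divisor \<iota> E \<Longrightarrow> (\<And>P. D P \<le> E P) \<Longrightarrow> dg D \<le> dg E"
  using dg_diff[of E D] dg_nonneg[of "\<lambda>P. E P - D P"] by simp

lemma dg_ge_value:
  assumes "divisor \<iota> D" "\<And>P. D P \<ge> 0"
  shows "D P \<le> dg D"
proof (cases "D P = 0")
  case False
  then show ?thesis unfolding dg_def
    using assms divisor_finite[OF assms(1)] by (intro member_le_sum) auto
qed (use assms dg_nonneg in auto)

lemma dg_upd_add_1:
  assumes "divisor \<iota> D" "is_place \<iota> P"
  shows "dg (D(P := D P + 1)) = dg D + 1"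
proof -
  let ?S = "insert P {P. D P \<noteq> 0}"
  have fin: "finite ?S" using divisor_finite[OF assms(1)] by simp
  have "dg (D(P := D P + 1)) = sum (D(P := D P + 1)) ?S"
    using fin by (intro dg_superset) auto
  also have "\<dots> = D P + 1 + sum (D(P := D P + 1)) (?S - {P})"
    using fin by (subst sum.remove[of _ P]) auto
  also have "sum (D(P := D P + 1)) (?S - {P}) = sum D (?S - {P})"
    by (intro sum.cong) auto
  also have "D P + 1 + sum D (?S - {P}) = sum D ?S + 1"
    using fin by (subst (2) sum.remove[of _ P]) auto
  also have "sum D ?S = dg D" using fin by (intro dg_superset[symmetric]) auto
  finally show ?thesis .
qed

text \<open>Climb from \<open>D\<close> to \<open>D'\<close> one place at a time; since places have
  degree one, the number of steps is the difference of the degrees.\<close>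

lemma ell_bound_aux:
  assumes D: "divisor \<iota> D" "fin_dim (L D)"
  shows "divisor \<iota> D' \<Longrightarrow> (\<And>P. D P \<le> D' P) \<Longrightarrow> dg D' = dg D + int n \<Longrightarrow>
    fin_dim (L D') \<and> ell \<iota> D' \<le> ell \<iota> D + n"
proof (induction n arbitrary: D')
  case 0
  let ?E = "\<lambda>P. D' P - D P"
  have "?E P \<le> dg ?E" for P
    using 0 D by (intro dg_ge_value divisor_diff) auto
  then have "D' P \<le> D P" for P
    using dg_diff[OF 0(1) D(1)] 0(3) by (metis diff_ge_0_iff_ge add_0_right add_diff_cancel_left' eq_iff_diff_eq_0 int_ops(1) le_iff_diff_le_0)
  then have "D' = D" using 0(2) by (intro ext antisym)
  then show ?case using D by simp
next
  case (Suc n)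
  have "\<exists>P. D P < D' P"
  proof (rule ccontr)
    assume "\<not> ?thesis"
    then have "D' = D" using Suc.prems(2) by (intro ext antisym) (auto simp: not_less)
    then show False using Suc.prems(3) by simp
  qed
  then obtain P where P: "D P < D' P" by blast
  have pl: "is_place \<iota> P"
    using divisor_place[OF Suc.prems(1), of P] divisor_place[OF D(1), of P] P by fastforce
  define E where "E = D'(P := D' P - 1)"
  have E: "divisor \<iota> E" unfolding E_def using divisor_upd[OF Suc.prems(1) pl] .
  have D': "D' = E(P := E P + 1)" by (auto simp: E_def)
  have "dg E = dg D + int n" using dg_upd_add_1[OF E pl, folded D'] Suc.prems(3) by simp
  moreover have "D Q \<le> E Q" for Q using Suc.prems(2)[of Q] P by (auto simp: E_def)
  ultimately have IH: "fin_dim (L E)" "ell \<iota> E \<le> ell \<iota> D + n" using Suc.IH[OF E] by auto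
  obtain w where "L D' \<subseteq> vs.span (insert w (L E))" using L_step[OF pl, of E] D' by auto
  from dim_extend[OF IH(1) this] IH(2) show ?case by (simp add: ell_eq_dim)
qed

lemma fin_dim_L: "divisor \<iota> D \<Longrightarrow> fin_dim (L D)"
proof -
  assume D: "divisor \<iota> D"
  \<comment> \<open>The positive part lies above both \<open>D\<close> and the zero divisor, whose
    space is known to be finite-dimensional.\<close>
  let ?E = "\<lambda>P. max 0 (D P)"
  have E: "divisor \<iota> ?E"
    using D unfolding divisor_def by (auto elim!: finite_subset[rotated] split: if_splits simp: max_def)
  have "dg ?E \<ge> 0" by (rule dg_nonneg) simp
  then have "dg ?E = dg (\<lambda>_. 0) + int (nat (dg ?E))" by (simp add: dg_def)
  then have "fin_dim (L ?E)"
    using ell_bound_aux[OF divisor_0 ell_0(1) E, of "nat (dg ?E)"] by simp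
  then show ?thesis by (rule fin_dim_subset) (rule L_mono, simp)
qed

lemma
  assumes "divisor \<iota> D" "divisor \<iota> D'" "\<And>P. D P \<le> D' P"
  shows ell_mono: "ell \<iota> D \<le> ell \<iota> D'"
    and ell_le_add: "int (ell \<iota> D') - dg D' \<le> int (ell \<iota> D) - dg D"
proof -
  show "ell \<iota> D \<le> ell \<iota> D'"
    unfolding ell_eq_dim using assms by (intro dim_mono fin_dim_L L_mono) auto
  have "dg D' = dg D + int (nat (dg D' - dg D))" using dg_mono[OF assms] by simp
  from ell_bound_aux[OF assms(1) fin_dim_L[OF assms(1)] assms(2,3) this]
  show "int (ell \<iota> D') - dg D' \<le> int (ell \<iota> D) - dg D"
    using dg_mono[OF assms] by linarith
qed

lemma ell_le_dg:
  assumes "divisor \<iota> D" "\<And>P. D P \<ge> 0"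
  shows "int (ell \<iota> D) \<le> dg D + 1"
  using ell_le_add[OF divisor_0 assms] ell_0(2) by (simp add: dg_def)

subsection \<open>Principal divisors have degree zero\<close>

lemma divisor_principal: "z \<noteq> 0 \<Longrightarrow> divisor \<iota> (principal_divisor \<iota> z)"
  unfolding divisor_def principal_divisor_def
  using finite_support[of z] by (auto elim!: finite_subset[rotated] split: if_splits)

lemma divisor_pole: "z \<noteq> 0 \<Longrightarrow> divisor \<iota> (pole_divisor \<iota> z)"
  unfolding divisor_def pole_divisor_def
  using finite_support[of z] by (auto elim!: finite_subset[rotated] split: if_splits)

lemma pole_divisor_nonneg: "pole_divisor \<iota> z P \<ge> 0"
  by (simp add: pole_divisor_def)

lemma mem_L_pole: "z \<in> L (pole_divisor \<iota> z)"
  by (auto simp: L_iff pole_divisor_def val_ge_def)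

lemma L_power:
  assumes "z \<in> L D" "\<And>P. D P \<ge> 0" "j \<le> k"
  shows "z ^ j \<in> L (\<lambda>P. int k * D P)"
  unfolding L_iff
proof (intro allI impI)
  fix P assume P: "is_place \<iota> P"
  then have "val_ge P (int j * (- D P)) (z ^ j)"
    using assms(1) by (intro val_ge_power) (auto simp: L_iff)
  moreover have "int j * D P \<le> int k * D P"
    using assms by (intro mult_right_mono) auto
  ultimately show "val_ge P (- (int k * D P)) (z ^ j)" by (auto elim!: val_ge_mono)
qed

text \<open>The family attached to the zeros of x has as many members as x has zeros, counted with
  multiplicity, and is independent over K(x). Multiplying it by powers of x up to \<open>k\<close>
  gives independent functions whose poles are bounded by k times those of x plus the divisor
  \<open>C\<close> of all poles of the family.\<close>

lemma zeros_growth: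
  assumes x: "x \<noteq> 0"
  shows "\<exists>C. divisor \<iota> C \<and> (\<forall>P. C P \<ge> 0) \<and>
    (\<forall>k. (int k + 1) * dg (pole_divisor \<iota> (inverse x)) \<le> int (ell \<iota> (\<lambda>P. int k * pole_divisor \<iota> x P + C P)))"
proof -
  define S where "S = {P. is_place \<iota> P \<and> place_val P x > 0}"
  define e where "e P = nat (place_val P x)" for P
  let ?I = "Sigma S (\<lambda>P. {..<e P})"
  have S: "finite S" "\<And>P. P \<in> S \<Longrightarrow> is_place \<iota> P"
    using finite_zeros[OF x] by (auto simp: S_def)
  have "int (e P) \<le> place_val P x" if "P \<in> S" for P using that by (simp add: S_def e_def)
  then obtain h where h: "indep_over x h ?I" "\<forall>i\<in>?I. h i \<noteq> 0"
    using zero_family[OF S x, of e] by blast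
  define C where "C P = (\<Sum>i\<in>?I. pole_divisor \<iota> (h i) P)" for P
  have finI: "finite ?I" using S by simp
  have C: "divisor \<iota> C" "C P \<ge> 0" for P
    unfolding C_def using h(2) by (auto intro!: divisor_sum divisor_pole sum_nonneg pole_divisor_nonneg)
  have card_I: "int (card ?I) = dg (pole_divisor \<iota> (inverse x))"
  proof -
    have "dg (pole_divisor \<iota> (inverse x)) = sum (pole_divisor \<iota> (inverse x)) S"
      using S(1) x by (intro dg_superset) (auto simp: S_def pole_divisor_def place_val_inverse split: if_splits)
    also have "\<dots> = (\<Sum>P\<in>S. int (e P))"
      using x by (intro sum.cong refl) (auto simp: S_def pole_divisor_def place_val_inverse e_def)
    finally show ?thesis using S(1) by simp
  qed
  have hL: "h i \<in> L C" if "i \<in> ?I" for i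
  proof -
    have "pole_divisor \<iota> (h i) P \<le> C P" for P
      unfolding C_def using that finI by (intro member_le_sum pole_divisor_nonneg)
    then show ?thesis using L_mono mem_L_pole by blast
  qed
  have "(int k + 1) * dg (pole_divisor \<iota> (inverse x)) \<le> int (ell \<iota> (\<lambda>P. int k * pole_divisor \<iota> x P + C P))" for k
  proof -
    let ?D = "\<lambda>P. int k * pole_divisor \<iota> x P + C P"
    have "card (?I \<times> {..k}) \<le> vs.dim (L ?D)"
    proof (rule indep_family_card_le_dim)
      show "indep_family (\<lambda>(i, j). x ^ j * h i) (?I \<times> {..k})"
        by (rule indep_over_powers[OF finI h(1)])
      show "(\<lambda>(i, j). x ^ j * h i) ` (?I \<times> {..k}) \<subseteq> L ?D"
        using L_mult[OF L_power[OF mem_L_pole pole_divisor_nonneg] hL] by fastforce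
      show "fin_dim (L ?D)"
        using C x by (intro fin_dim_L divisor_add divisor_mult divisor_pole)
    qed (use finI in simp)
    then have "int (card ?I * (k + 1)) \<le> int (ell \<iota> ?D)"
      by (simp only: ell_eq_dim of_nat_le_iff card_cartesian_product card_atMost Suc_eq_plus1)
    then show ?thesis unfolding of_nat_mult card_I by (simp add: algebra_simps)
  qed
  with C show ?thesis by blast
qed

lemma dg_zeros_le_dg_poles:
  assumes x: "x \<noteq> 0"
  shows "dg (pole_divisor \<iota> (inverse x)) \<le> dg (pole_divisor \<iota> x)"
proof (rule ccontr)
  define e b where "e = dg (pole_divisor \<iota> (inverse x))" and "b = dg (pole_divisor \<iota> x)"
  assume "\<not> ?thesis"
  then have "b + 1 \<le> e" by (simp add: e_def b_def)
  obtain C where C: "divisor \<iota> C" "\<And>P. C P \<ge> 0"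
    "\<And>k. (int k + 1) * e \<le> int (ell \<iota> (\<lambda>P. int k * pole_divisor \<iota> x P + C P))"
    using zeros_growth[OF x] unfolding e_def by blast
  have c: "dg C \<ge> 0" and b: "b \<ge> 0"
    using C(2) pole_divisor_nonneg by (auto simp: b_def intro!: dg_nonneg)
  \<comment> \<open>The lower bound \<open>(k + 1) * (b + 1)\<close> and the upper bound
    \<open>k * b + dg C + 1\<close> for the same dimension are incompatible once \<open>k\<close>
    exceeds \<open>dg C\<close>.\<close>
  define k where "k = nat (dg C + 1)"
  have k: "int k = dg C + 1" using c by (simp add: k_def)
  have "(int k + 1) * (b + 1) \<le> (int k + 1) * e"
    using \<open>b + 1 \<le> e\<close> by (intro mult_left_mono) auto
  also have "\<dots> \<le> int (ell \<iota> (\<lambda>P. int k * pole_divisor \<iota> x P + C P))" by (rule C(3))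
  also have "\<dots> \<le> dg (\<lambda>P. int k * pole_divisor \<iota> x P + C P) + 1"
    using C x by (intro ell_le_dg divisor_add divisor_mult divisor_pole add_nonneg_nonneg mult_nonneg_nonneg pole_divisor_nonneg) auto
  also have "dg (\<lambda>P. int k * pole_divisor \<iota> x P + C P) = int k * b + dg C"
    using C x by (simp add: dg_add dg_mult divisor_mult divisor_pole b_def)
  finally show False using b k by (simp add: algebra_simps)
qed

lemma dg_zeros_eq_dg_poles: "x \<noteq> 0 \<Longrightarrow> dg (pole_divisor \<iota> (inverse x)) = dg (pole_divisor \<iota> x)"
  using dg_zeros_le_dg_poles[of x] dg_zeros_le_dg_poles[of "inverse x"] by simp

lemma dg_principal:
  assumes "x \<noteq> 0"
  shows "dg (principal_divisor \<iota> x) = 0"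
proof -
  have "principal_divisor \<iota> x = (\<lambda>P. pole_divisor \<iota> (inverse x) P - pole_divisor \<iota> x P)"
    using assms by (auto simp: fun_eq_iff principal_divisor_def pole_divisor_def place_val_inverse)
  then show ?thesis
    using assms by (simp add: dg_diff divisor_pole dg_zeros_eq_dg_poles)
qed

subsection \<open>Riemann's theorem\<close>

text \<open>Multiplication by \<open>1 / z\<close> maps \<open>L(D - (z))\<close> into
  \<open>L(D)\<close>. The opposite inequality is the same statement for
  \<open>1 / z\<close>.\<close>

lemma ell_diff_principal_le:
  assumes D: "divisor \<iota> D" and z: "z \<noteq> 0"
  shows "ell \<iota> (\<lambda>P. D P - principal_divisor \<iota> z P) \<le> ell \<iota> D"
proof -
  obtain B where B: "finite B" "L D \<subseteq> vs.span B" "card B = vs.dim (L D)"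
    using fin_dim_basis[OF fin_dim_L[OF D]] by blast
  have "vs.subspace {y. z * y \<in> vs.span ((*) z ` B)}"
    by (rule vs.subspaceI)
      (simp_all add: distrib_left mult.left_commute[of z] vs.span_add vs.span_scale vs.span_zero)
  then have span: "z * y \<in> vs.span ((*) z ` B)" if "y \<in> vs.span B" for y
    using vs.span_minimal[of B "{y. z * y \<in> vs.span ((*) z ` B)}"] that by (auto intro: vs.span_base)
  have "L (\<lambda>P. D P - principal_divisor \<iota> z P) \<subseteq> vs.span ((*) z ` B)"
  proof
    fix w assume w: "w \<in> L (\<lambda>P. D P - principal_divisor \<iota> z P)"
    have "inverse z * w \<in> L D"
      unfolding L_iff
    proof (intro allI impI)
      fix P assume P: "is_place \<iota> P"
      have "val_ge P (place_val P (inverse z) + - (D P - principal_divisor \<iota> z P)) (inverse z * w)"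
        using w P by (intro val_ge_mult val_ge_place_val) (auto simp: L_iff)
      then show "val_ge P (- D P) (inverse z * w)"
        using P z by (simp add: place_val_inverse principal_divisor_def)
    qed
    then have "z * (inverse z * w) \<in> vs.span ((*) z ` B)" using span B(2) by blast
    then show "w \<in> vs.span ((*) z ` B)" using z by (simp flip: mult.assoc)
  qed
  then have "vs.dim (L (\<lambda>P. D P - principal_divisor \<iota> z P)) \<le> card ((*) z ` B)"
    using B(1) by (intro vs.dim_le_card) auto
  also have "\<dots> \<le> card B" using B(1) by (rule card_image_le)
  finally show ?thesis using B(3) by (simp add: ell_eq_dim)
qed

text \<open>A nonzero \<open>z \<in> L(A - D)\<close> gives \<open>D - (z) \<le> A\<close>.\<close>

lemma dg_minus_ell_mono:
  assumes A: "divisor \<iota> A" and D: "divisor \<iota> D" and z: "z \<noteq> 0" "z \<in> L (\<lambda>P. A P - D P)"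
  shows "dg D - int (ell \<iota> D) \<le> dg A - int (ell \<iota> A)"
proof -
  define E where "E P = D P - principal_divisor \<iota> z P" for P
  have E: "divisor \<iota> E" "dg E = dg D"
    unfolding E_def using D z(1) by (simp_all add: divisor_diff divisor_principal dg_diff dg_principal)
  have "E P \<le> A P" for P
  proof (cases "is_place \<iota> P")
    case True
    then show ?thesis using z by (auto simp: E_def L_iff val_ge_def principal_divisor_def)
  next
    case False
    then show ?thesis using divisor_place[OF E(1), of P] divisor_place[OF A, of P] by force
  qed
  from ell_le_add[OF E(1) A this] E(2) ell_diff_principal_le[OF D z(1)] show ?thesis
    unfolding E_def by linarith
qed

lemma ell_pos_imp: "ell \<iota> D > 0 \<Longrightarrow> \<exists>z. z \<noteq> 0 \<and> z \<in> L D"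
proof (rule ccontr)
  assume pos: "ell \<iota> D > 0" and "\<not> (\<exists>z. z \<noteq> 0 \<and> z \<in> L D)"
  then have "L D \<subseteq> vs.span {}" by auto
  then have "vs.dim (L D) \<le> card ({} :: 'f set)" by (intro vs.dim_le_card) auto
  with pos show False by (simp add: ell_eq_dim)
qed

lemma ex_nonconstant: "\<exists>x. x \<notin> range \<iota>"
proof -
  obtain x where x: "transcendental_over \<iota> x"
    using function_field by (auto simp: function_field_def)
  have "x \<notin> range \<iota>"
  proof
    assume "x \<in> range \<iota>"
    then obtain c where "x = \<iota> c" by blast
    then have "ev [:- c, 1:] x = 0" by simp
    moreover have "[:- c, 1:] \<noteq> 0" by simp
    ultimately show False using x unfolding transcendental_over_def ev_def by blast
  qed
  then show ?thesis by blast
qed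

text \<open>For multiples of the pole divisor \<open>B\<close> of a nonconstant x the bound follows
  from \<open>zeros_growth\<close>, since removing \<open>C\<close> costs at most its degree. Any
  other \<open>D\<close> lies below a multiple of \<open>B\<close> up to a principal
  divisor.\<close>

lemma riemann_bounded: "\<exists>\<gamma>. \<forall>D. divisor \<iota> D \<longrightarrow> dg D - int (ell \<iota> D) \<le> \<gamma>"
proof -
  obtain x where x: "x \<notin> range \<iota>" using ex_nonconstant by blast
  then have x0: "x \<noteq> 0" using emb_0 by (metis rangeI)
  define B where "B = pole_divisor \<iota> x"
  have B: "divisor \<iota> B" "\<And>P. B P \<ge> 0"
    using divisor_pole[OF x0] pole_divisor_nonneg by (auto simp: B_def)
  obtain P where "is_place \<iota> P" "\<not> val_ge P 0 x" using ex_pole[OF x] by blast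
  then have "B P > 0" using x0 by (auto simp: B_def pole_divisor_def val_ge_def)
  then have b: "dg B > 0" using dg_ge_value[OF B, of P] by simp
  obtain C where C: "divisor \<iota> C" "\<And>P. C P \<ge> 0"
    "\<And>k. (int k + 1) * dg B \<le> int (ell \<iota> (\<lambda>P. int k * B P + C P))"
    using zeros_growth[OF x0] dg_zeros_eq_dg_poles[OF x0] unfolding B_def by auto
  define kB where "kB k P = int k * B P" for k P
  have kB: "divisor \<iota> (kB k)" "dg (kB k) = int k * dg B" for k
    unfolding kB_def using B by (auto simp: divisor_mult dg_mult)
  have ell_kB: "int (ell \<iota> (kB k)) \<ge> (int k + 1) * dg B - dg C" for k
  proof -
    have "int (ell \<iota> (\<lambda>P. kB k P + C P)) - dg (\<lambda>P. kB k P + C P) \<le> int (ell \<iota> (kB k)) - dg (kB k)"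
      using kB C by (intro ell_le_add divisor_add) auto
    then show ?thesis using C(3)[of k] dg_add[OF kB(1) C(1), of k] by (simp add: kB_def)
  qed
  have "dg D - int (ell \<iota> D) \<le> dg C" if D: "divisor \<iota> D" for D
  proof -
    define E where "E P = max 0 (D P)" for P
    have E: "divisor \<iota> E"
      using D unfolding divisor_def E_def
      by (auto elim!: finite_subset[rotated] split: if_splits simp: max_def)
    have E0: "dg E \<ge> 0" "dg C \<ge> 0" using C(2) by (auto intro!: dg_nonneg simp: E_def)
    \<comment> \<open>Because \<open>dg B\<close> is at least 1, this \<open>k\<close> gives
      \<open>L(kB - E)\<close> dimension at least 1.\<close>
    define k where "k = nat (dg C + dg E)"
    have k: "int k = dg C + dg E" using E0 by (simp add: k_def)
    have "int (ell \<iota> (kB k)) - dg (kB k)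
        \<le> int (ell \<iota> (\<lambda>P. kB k P - E P)) - dg (\<lambda>P. kB k P - E P)"
      by (intro ell_le_add divisor_diff kB E) (simp_all add: E_def)
    then have "int (ell \<iota> (\<lambda>P. kB k P - E P)) \<ge> (int k + 1) * dg B - dg C - dg E"
      using ell_kB[of k] by (simp add: dg_diff[OF kB(1) E])
    moreover have "(int k + 1) * 1 \<le> (int k + 1) * dg B" using b by (intro mult_left_mono) auto
    ultimately have "int (ell \<iota> (\<lambda>P. kB k P - E P)) > 0"
      unfolding k mult_1_right by linarith
    then have "ell \<iota> (\<lambda>P. kB k P - E P) > 0" by simp
    then obtain z where z: "z \<noteq> 0" "z \<in> L (\<lambda>P. kB k P - E P)" using ell_pos_imp by blast
    then have "z \<in> L (\<lambda>P. kB k P - D P)"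
      using L_mono[of "\<lambda>P. kB k P - E P" "\<lambda>P. kB k P - D P"] by (auto simp: E_def)
    from dg_minus_ell_mono[OF kB(1) D z(1) this] ell_kB[of k] kB(2)[of k] b
    show ?thesis by (simp add: algebra_simps)
  qed
  then show ?thesis by blast
qed

text \<open>\<open>GREATEST\<close> says something about the genus only after a maximum is known to
  exist. Measuring values by their distance below the bound \<open>\<gamma> + 1\<close> turns the
  greatest integer into a least natural number.\<close>

lemma
  shows riemann_inequality: "divisor \<iota> D \<Longrightarrow> dg D + 1 - genus \<iota> \<le> int (ell \<iota> D)"
    and genus_attained: "\<exists>A. divisor \<iota> A \<and> int (ell \<iota> A) = dg A + 1 - genus \<iota>"
proof -
  let ?G = "\<lambda>g. \<exists>D. divisor \<iota> D \<and> g = divisor_degree \<iota> D - int (ell \<iota> D) + 1"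
  obtain \<gamma> where \<gamma>: "\<And>D. divisor \<iota> D \<Longrightarrow> dg D - int (ell \<iota> D) \<le> \<gamma>"
    using riemann_bounded by blast
  have bound: "g \<le> \<gamma> + 1" if "?G g" for g
    using that \<gamma> divisor_degree_eq by fastforce
  have "\<exists>n. ?G (\<gamma> + 1 - int n)"
  proof
    have "?G (divisor_degree \<iota> (\<lambda>_. 0) - int (ell \<iota> (\<lambda>_. 0)) + 1)" using divisor_0 by blast
    then show "?G (\<gamma> + 1 - int (nat (\<gamma> + 1 - (divisor_degree \<iota> (\<lambda>_. 0) - int (ell \<iota> (\<lambda>_. 0)) + 1))))"
      using bound[of "divisor_degree \<iota> (\<lambda>_. 0) - int (ell \<iota> (\<lambda>_. 0)) + 1"] by simp
  qed
  then obtain n where n: "?G (\<gamma> + 1 - int n)" and min: "\<And>m. m < n \<Longrightarrow> \<not> ?G (\<gamma> + 1 - int m)"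
    using exists_least_iff[of "\<lambda>n. ?G (\<gamma> + 1 - int n)"] by blast
  have max: "g \<le> \<gamma> + 1 - int n" if g: "?G g" for g
  proof (rule ccontr)
    assume "\<not> ?thesis"
    then have "nat (\<gamma> + 1 - g) < n" "\<gamma> + 1 - int (nat (\<gamma> + 1 - g)) = g" using bound[OF g] by auto
    with min g show False by metis
  qed
  have genus: "genus \<iota> = \<gamma> + 1 - int n"
    unfolding genus_def using n max by (rule Greatest_equality)
  show "dg D + 1 - genus \<iota> \<le> int (ell \<iota> D)" if D: "divisor \<iota> D" for D
    using max[of "divisor_degree \<iota> D - int (ell \<iota> D) + 1"] D divisor_degree_eq[OF D]
    unfolding genus by force
  obtain A where "divisor \<iota> A" "\<gamma> + 1 - int n = divisor_degree \<iota> A - int (ell \<iota> A) + 1"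
    using n by blast
  then show "\<exists>A. divisor \<iota> A \<and> int (ell \<iota> A) = dg A + 1 - genus \<iota>"
    unfolding genus using divisor_degree_eq by (intro exI[of _ A]) auto
qed

text \<open>Let \<open>A\<close> attain the genus. If \<open>dg D \<ge> dg A + g\<close>, then
  \<open>L(D - A)\<close> is nonzero by Riemann's inequality, so \<open>D\<close> dominates a
  divisor equivalent to \<open>A\<close> and attains the genus as well.\<close>

lemma riemann_theorem: "\<exists>c. \<forall>D. divisor \<iota> D \<longrightarrow> dg D \<ge> c \<longrightarrow> int (ell \<iota> D) = dg D + 1 - genus \<iota>"
proof -
  obtain A where A: "divisor \<iota> A" "int (ell \<iota> A) = dg A + 1 - genus \<iota>"
    using genus_attained by blast
  have "int (ell \<iota> D) = dg D + 1 - genus \<iota>" if D: "divisor \<iota> D" "dg D \<ge> dg A + genus \<iota>" for D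
  proof -
    have "int (ell \<iota> (\<lambda>P. D P - A P)) \<ge> 1"
      using riemann_inequality[OF divisor_diff[OF D(1) A(1)]] D by (simp add: dg_diff[OF D(1) A(1)])
    then obtain z where z: "z \<noteq> 0" "z \<in> L (\<lambda>P. D P - A P)"
      using ell_pos_imp[of "\<lambda>P. D P - A P"] by auto
    from dg_minus_ell_mono[OF D(1) A(1) z] A(2) riemann_inequality[OF D(1)] show ?thesis by simp
  qed
  then show ?thesis by blast
qed

subsection \<open>Semilinear automorphisms and places\<close>

text \<open>\<open>\<phi>\<close> records the action on constants. Frobenius moves K, so these
  automorphisms need not be K-linear; they nevertheless permute the places and transport their
  valuations.\<close>

definition semilinear_aut :: "('f \<Rightarrow> 'f) \<Rightarrow> ('k \<Rightarrow> 'k) \<Rightarrow> bool" where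
  "semilinear_aut \<sigma> \<phi> \<longleftrightarrow> bij \<sigma> \<and> surj \<phi> \<and>
     (\<forall>a b. \<sigma> (a + b) = \<sigma> a + \<sigma> b) \<and> (\<forall>a b. \<sigma> (a * b) = \<sigma> a * \<sigma> b) \<and> (\<forall>c. \<sigma> (\<iota> c) = \<iota> (\<phi> c))"

lemma
  assumes "semilinear_aut \<sigma> \<phi>"
  shows aut_add: "\<sigma> (a + b) = \<sigma> a + \<sigma> b"
    and aut_mult: "\<sigma> (a * b) = \<sigma> a * \<sigma> b"
    and aut_emb: "\<sigma> (\<iota> c) = \<iota> (\<phi> c)"
    and aut_eq_iff: "\<sigma> a = \<sigma> b \<longleftrightarrow> a = b"
    and aut_surj: "\<exists>b. a = \<sigma> b"
    and aut_surj_const: "\<exists>d. c = \<phi> d"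
    and aut_mem_iff: "\<sigma> a \<in> \<sigma> ` A \<longleftrightarrow> a \<in> A"
  using assms bij_is_inj[of \<sigma>] bij_is_surj[of \<sigma>]
  unfolding semilinear_aut_def by (auto simp: inj_eq inj_image_mem_iff surj_def)

lemma
  assumes "semilinear_aut \<sigma> \<phi>"
  shows aut_0: "\<sigma> 0 = 0"
    and aut_1: "\<sigma> 1 = 1"
    and aut_diff: "\<sigma> (a - b) = \<sigma> a - \<sigma> b"
    and aut_inverse: "\<sigma> (inverse a) = inverse (\<sigma> a)"
    and aut_eq_0_iff: "\<sigma> a = 0 \<longleftrightarrow> a = 0"
    and aut_power: "\<sigma> (a ^ n) = \<sigma> a ^ n"
proof -
  note [simp] = aut_add[OF assms] aut_mult[OF assms] aut_eq_iff[OF assms]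
  show 0: "\<sigma> 0 = 0"
    using aut_add[OF assms, of 0 0] by (metis add_0_right add_cancel_right_right)
  show nz: "\<sigma> a = 0 \<longleftrightarrow> a = 0" for a using aut_eq_iff[OF assms, of a 0] 0 by simp
  show 1: "\<sigma> 1 = 1"
    using aut_mult[OF assms, of 1 1] nz[of 1] by (metis mult_1_right mult_cancel_left zero_neq_one)
  show "\<sigma> (a - b) = \<sigma> a - \<sigma> b"
    using aut_add[OF assms, of "a - b" b] by (simp del: aut_add add: eq_diff_eq)
  show "\<sigma> (inverse a) = inverse (\<sigma> a)"
  proof (cases "a = 0")
    case False
    then have "\<sigma> a * \<sigma> (inverse a) = 1" using 1 aut_mult[OF assms, of a "inverse a"] by simp
    then show ?thesis by (metis inverse_unique)
  qed (simp add: 0)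
  show "\<sigma> (a ^ n) = \<sigma> a ^ n" by (induction n) (simp_all add: 1)
qed

lemma aut_powi: "semilinear_aut \<sigma> \<phi> \<Longrightarrow> \<sigma> (a powi n) = \<sigma> a powi n"
  by (simp add: power_int_def aut_power aut_inverse)

lemma aut_funpow:
  assumes "semilinear_aut \<sigma> \<phi>"
  shows "semilinear_aut (\<sigma> ^^ n) (\<phi> ^^ n)"
proof -
  have "(\<sigma> ^^ n) (a + b) = (\<sigma> ^^ n) a + (\<sigma> ^^ n) b" "(\<sigma> ^^ n) (a * b) = (\<sigma> ^^ n) a * (\<sigma> ^^ n) b"
    "(\<sigma> ^^ n) (\<iota> c) = \<iota> ((\<phi> ^^ n) c)" for a b c
    by (induction n) (simp_all add: aut_add[OF assms] aut_mult[OF assms] aut_emb[OF assms])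
  moreover have "bij (\<sigma> ^^ n)" "surj (\<phi> ^^ n)"
    using assms by (simp_all add: semilinear_aut_def bij_fn surj_fn)
  ultimately show ?thesis unfolding semilinear_aut_def by blast
qed

lemma
  assumes \<sigma>: "semilinear_aut \<sigma> \<phi>" and P: "is_place \<iota> P"
  shows aut_place: "is_place \<iota> (\<sigma> ` P)"
    and aut_place_ring: "place_ring (\<sigma> ` P) = \<sigma> ` place_ring P"
    and aut_place_val: "z \<noteq> 0 \<Longrightarrow> place_val (\<sigma> ` P) (\<sigma> z) = place_val P z"
proof -
  define R where "R = place_ring P"
  have vr: "valuation_ring \<iota> R" using valuation_ring_place_ring[OF P] by (simp add: R_def)
  note mem = aut_mem_iff[OF \<sigma>]
  have "valuation_ring \<iota> (\<sigma> ` R)"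
    unfolding valuation_ring_def
  proof (intro conjI ballI allI impI)
    fix a b assume "a \<in> \<sigma> ` R" "b \<in> \<sigma> ` R"
    then obtain a' b' where ab: "a = \<sigma> a'" "a' \<in> R" "b = \<sigma> b'" "b' \<in> R" by blast
    show "a - b \<in> \<sigma> ` R" "a * b \<in> \<sigma> ` R"
      using vr_diff[OF vr ab(2,4)] vr_mult[OF vr ab(2,4)] ab
      by (simp_all add: mem aut_diff[OF \<sigma>, symmetric] aut_mult[OF \<sigma>, symmetric])
  next
    have "range \<iota> \<subseteq> \<sigma> ` R"
    proof
      fix z assume "z \<in> range \<iota>"
      then obtain c where "z = \<iota> c" by blast
      moreover obtain d where "c = \<phi> d" using aut_surj_const[OF \<sigma>] by blast
      ultimately have "z = \<sigma> (\<iota> d)" by (simp add: aut_emb[OF \<sigma>])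
      then show "z \<in> \<sigma> ` R" using vr_emb[OF vr] by blast
    qed
    moreover have "range \<iota> \<noteq> \<sigma> ` R"
    proof
      assume eq: "range \<iota> = \<sigma> ` R"
      have "R \<subseteq> range \<iota>"
      proof
        fix r assume "r \<in> R"
        then obtain c where "\<sigma> r = \<iota> c" using eq by blast
        moreover obtain d where "c = \<phi> d" using aut_surj_const[OF \<sigma>] by blast
        ultimately have "\<sigma> r = \<sigma> (\<iota> d)" by (simp add: aut_emb[OF \<sigma>])
        then show "r \<in> range \<iota>" by (simp add: aut_eq_iff[OF \<sigma>])
      qed
      then show False using vr unfolding valuation_ring_def by blast
    qed
    ultimately show "range \<iota> \<subset> \<sigma> ` R" by blast
  next
    obtain z where "z \<notin> R" using vr_proper[OF vr] by blast
    then have "\<sigma> z \<notin> \<sigma> ` R" by (simp add: mem)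
    then show "\<sigma> ` R \<subset> UNIV" by blast
  next
    fix z :: 'f
    obtain z' where "z = \<sigma> z'" using aut_surj[OF \<sigma>] by blast
    then show "z \<in> \<sigma> ` R \<or> inverse z \<in> \<sigma> ` R"
      using vr_or[OF vr, of z'] by (simp add: mem aut_inverse[OF \<sigma>, symmetric])
  qed
  moreover have "{z. z = 0 \<or> inverse z \<notin> \<sigma> ` R} = \<sigma> ` P"
  proof (intro Set.set_eqI)
    fix z :: 'f
    obtain z' where z: "z = \<sigma> z'" using aut_surj[OF \<sigma>] by blast
    show "z \<in> {z. z = 0 \<or> inverse z \<notin> \<sigma> ` R} \<longleftrightarrow> z \<in> \<sigma> ` P"
      unfolding z using place_eq_nonunits[OF P, of z']
      by (simp add: mem aut_inverse[OF \<sigma>, symmetric] aut_eq_0_iff[OF \<sigma>] R_def)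
  qed
  ultimately show *: "is_place \<iota> (\<sigma> ` P)" "place_ring (\<sigma> ` P) = \<sigma> ` place_ring P"
    using is_place_nonunits[of "\<sigma> ` R"] place_ring_nonunits[of "\<sigma> ` R"] by (simp_all add: R_def)
  assume z: "z \<noteq> 0"
  obtain u where u: "place_unit P u" "z = uniformizer P powi place_val P z * u"
    using place_val_decomposition[OF P z] by blast
  have "\<sigma> ` P = \<sigma> ` {uniformizer P * a | a. a \<in> place_ring P}"
    using uniformizer_generates[OF P] by (rule arg_cong)
  also have "\<dots> = {\<sigma> (uniformizer P) * a | a. a \<in> place_ring (\<sigma> ` P)}"
    unfolding *(2) by (simp add: Setcompr_eq_image image_image aut_mult[OF \<sigma>])
  finally have "\<sigma> ` P = {\<sigma> (uniformizer P) * a | a. a \<in> place_ring (\<sigma> ` P)}" .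
  moreover have "place_unit (\<sigma> ` P) (\<sigma> u)"
    using u(1) by (simp add: place_unit_def *(2) mem aut_eq_0_iff[OF \<sigma>] flip: aut_inverse[OF \<sigma>])
  ultimately have "place_val (\<sigma> ` P) (\<sigma> (uniformizer P) powi place_val P z * \<sigma> u) = place_val P z"
    by (rule place_val_eqI[OF *(1)])
  then show "place_val (\<sigma> ` P) (\<sigma> z) = place_val P z"
    using u(2) by (metis aut_mult[OF \<sigma>] aut_powi[OF \<sigma>])
qed

lemma aut_val_ge:
  assumes "semilinear_aut \<sigma> \<phi>" "is_place \<iota> P"
  shows "val_ge (\<sigma> ` P) n (\<sigma> z) \<longleftrightarrow> val_ge P n z"
  using aut_place_val[OF assms, of z] aut_eq_0_iff[OF assms(1), of z] by (auto simp: val_ge_def)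

lemma aut_inj_image: "semilinear_aut \<sigma> \<phi> \<Longrightarrow> \<sigma> ` P = \<sigma> ` Q \<longleftrightarrow> P = Q"
  by (simp add: semilinear_aut_def bij_is_inj inj_image_eq_iff)

lemma aut_inv:
  assumes "semilinear_aut \<sigma> \<phi>"
  shows "semilinear_aut (inv_into UNIV \<sigma>) (inv_into UNIV \<phi>)"
proof -
  have bij: "bij \<sigma>" "surj \<phi>" using assms by (auto simp: semilinear_aut_def)
  have f: "\<sigma> (inv_into UNIV \<sigma> a) = a" for a using bij by (simp add: bij_is_surj surj_f_inv_f)
  have I: "inv_into UNIV \<sigma> a = b" if "a = \<sigma> b" for a b using that bij by (simp add: bij_is_inj)
  have "surj (inv_into UNIV \<phi>)"
  proof -
    have "inj \<phi>"
    proof (rule injI)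
      fix c d assume "\<phi> c = \<phi> d"
      then have "\<sigma> (\<iota> c) = \<sigma> (\<iota> d)" by (simp add: aut_emb[OF assms])
      then show "c = d" by (simp add: aut_eq_iff[OF assms])
    qed
    then show ?thesis by (rule inj_imp_surj_inv)
  qed
  moreover have "\<phi> (inv_into UNIV \<phi> c) = c" for c using bij(2) by (simp add: surj_f_inv_f)
  ultimately show ?thesis
    unfolding semilinear_aut_def using bij(1)
    by (auto intro!: I bij_imp_bij_inv simp: f aut_add[OF assms] aut_mult[OF assms] aut_emb[OF assms])
qed

lemma aut_place_preimage:
  assumes "semilinear_aut \<sigma> \<phi>" "is_place \<iota> Q"
  shows "\<exists>P. is_place \<iota> P \<and> Q = \<sigma> ` P"
proof (intro exI conjI)
  show "is_place \<iota> (inv_into UNIV \<sigma> ` Q)" using aut_place[OF aut_inv[OF assms(1)] assms(2)] .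
  show "Q = \<sigma> ` inv_into UNIV \<sigma> ` Q"
    using assms(1) by (simp add: semilinear_aut_def bij_is_surj image_f_inv_f)
qed

lemma image_funpow:
  fixes \<sigma> :: "'f \<Rightarrow> 'f"
  shows "((`) \<sigma> ^^ n) P = (\<sigma> ^^ n) ` P"
  by (induction n) (auto simp: image_comp)

text \<open>The orbit of \<open>P\<close> stays inside the finite set of zeros of the fixed function
  z, and an injective map on a finite orbit is periodic.\<close>

lemma aut_finite_orbit:
  assumes \<sigma>: "semilinear_aut \<sigma> \<phi>" and z: "z \<noteq> 0" "\<sigma> z = z" and P: "is_place \<iota> P" "place_val P z > 0"
  shows "\<exists>n>0. (\<sigma> ^^ n) ` P = P"
proof -
  have orbit: "is_place \<iota> ((\<sigma> ^^ n) ` P) \<and> place_val ((\<sigma> ^^ n) ` P) z > 0" for n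
  proof -
    have "(\<sigma> ^^ n) z = z" by (induction n) (simp_all add: z(2))
    then show ?thesis
      using aut_place[OF aut_funpow[OF \<sigma>] P(1), of n] aut_place_val[OF aut_funpow[OF \<sigma>] P(1) z(1), of n] P(2)
      by simp
  qed
  have "inj ((`) \<sigma>)" by (rule injI) (simp add: aut_inj_image[OF \<sigma>])
  moreover have "finite {Q. \<exists>n. Q = ((`) \<sigma> ^^ n) P}"
    by (rule finite_subset[OF _ finite_zeros[OF z(1)]]) (use orbit in \<open>auto simp: image_funpow\<close>)
  ultimately show ?thesis
    using funpow_inj_finite[of "(`) \<sigma>" P] by (metis image_funpow)
qed

text \<open>The properties of Frobenius on the closure of a finite field that matter: every constant
  has a finite orbit, and every iterate fixes only finitely many constants. They pass to powers of
  the map.\<close>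

definition frobenius_like :: "('k \<Rightarrow> 'k) \<Rightarrow> bool" where
  "frobenius_like \<phi> \<longleftrightarrow> bij \<phi> \<and> (\<forall>a b. \<phi> (a + b) = \<phi> a + \<phi> b) \<and> (\<forall>a b. \<phi> (a * b) = \<phi> a * \<phi> b) \<and>
     (\<forall>c. \<exists>n>0. (\<phi> ^^ n) c = c) \<and> (\<forall>n>0. finite {c. (\<phi> ^^ n) c = c})"

lemma place_value_cases:
  assumes P: "is_place \<iota> P" and x: "x \<notin> range \<iota>"
  obtains (infinity) "place_val P (inverse x) > 0" | (finite) c where "place_val P (x - \<iota> c) > 0"
proof (cases "x \<in> place_ring P")
  case True
  then obtain c where "x - \<iota> c \<in> P" using residue_exists[OF P] by blast
  moreover have "x - \<iota> c \<noteq> 0" using x by auto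
  ultimately show ?thesis using place_val_pos_iff[OF P] finite by blast
next
  case False
  then have "inverse x \<in> P" "inverse x \<noteq> 0"
    using place_eq_nonunits[OF P, of "inverse x"] vr_0[OF valuation_ring_place_ring[OF P]] by auto
  then show ?thesis using place_val_pos_iff[OF P] infinity by blast
qed

text \<open>\<open>P\<close> is a zero of \<open>1 / x\<close> or of \<open>x - c\<close> for a
  constant c; some iterate of the automorphism fixes c and therefore this function.\<close>

lemma aut_place_periodic:
  assumes \<sigma>: "semilinear_aut \<sigma> \<phi>" and \<phi>: "frobenius_like \<phi>" and x: "x \<notin> range \<iota>" "\<sigma> x = x"
    and P: "is_place \<iota> P"
  shows "\<exists>n>0. (\<sigma> ^^ n) ` P = P"
  using P x(1)
proof (cases rule: place_value_cases)
  case infinity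
  have "x \<noteq> 0" using x(1) emb_0 by (metis rangeI)
  then show ?thesis
    using aut_finite_orbit[OF \<sigma> _ _ P infinity] x(2) by (simp add: aut_inverse[OF \<sigma>])
next
  case (finite c)
  obtain n where n: "n > 0" "(\<phi> ^^ n) c = c" using \<phi> unfolding frobenius_like_def by blast
  have "(\<sigma> ^^ n) x = x" by (induction n) (simp_all add: x(2))
  then have "(\<sigma> ^^ n) (x - \<iota> c) = x - \<iota> c"
    using n by (simp add: aut_diff[OF aut_funpow[OF \<sigma>]] aut_emb[OF aut_funpow[OF \<sigma>]])
  moreover have "x - \<iota> c \<noteq> 0" using x(1) by auto
  ultimately obtain m where "m > 0" "((\<sigma> ^^ n) ^^ m) ` P = P"
    using aut_finite_orbit[OF aut_funpow[OF \<sigma>] _ _ P finite] by blast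
  then show ?thesis using n(1) by (intro exI[of _ "n * m"]) (simp add: funpow_mult mult.commute)
qed

text \<open>At an invariant place the value c of x, if finite, satisfies
  \<open>\<phi> c = c\<close>. There are finitely many such c, and finitely many places above each
  of them and above infinity.\<close>

lemma finite_fixed_places:
  assumes \<sigma>: "semilinear_aut \<sigma> \<phi>" and fin: "finite {c. \<phi> c = c}" and x: "x \<notin> range \<iota>" "\<sigma> x = x"
  shows "finite {P. is_place \<iota> P \<and> \<sigma> ` P = P}"
proof -
  have x0: "inverse x \<noteq> 0" using x(1) emb_0 by (metis inverse_nonzero_iff_nonzero rangeI)
  have "P \<in> {P. is_place \<iota> P \<and> place_val P (inverse x) > 0} \<union>
      (\<Union>c\<in>{c. \<phi> c = c}. {P. is_place \<iota> P \<and> place_val P (x - \<iota> c) > 0})"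
    if P: "is_place \<iota> P" "\<sigma> ` P = P" for P
    using P(1) x(1)
  proof (cases rule: place_value_cases)
    case (finite c)
    have ne: "x - \<iota> c \<noteq> 0" using x(1) by auto
    have "x - \<iota> c \<in> P" using finite place_val_pos_iff[OF P(1) ne] by blast
    moreover from this have "\<sigma> (x - \<iota> c) \<in> P" using P(2) by blast
    then have "x - \<iota> (\<phi> c) \<in> P" by (simp add: aut_diff[OF \<sigma>] aut_emb[OF \<sigma>] x(2))
    ultimately have "(x - \<iota> c) + - (x - \<iota> (\<phi> c)) \<in> P" using place_add place_minus P(1) by blast
    then have "\<iota> (\<phi> c - c) \<in> P" by simp
    then have "\<phi> c = c" using emb_place_iff[OF P(1), of "\<phi> c - c"] by (simp del: emb_diff)
    then show ?thesis using finite P(1) by blast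
  qed (use P in blast)
  moreover have fin: "finite ({P. is_place \<iota> P \<and> place_val P (inverse x) > 0} \<union>
      (\<Union>c\<in>{c. \<phi> c = c}. {P. is_place \<iota> P \<and> place_val P (x - \<iota> c) > 0}))"
    using x(1) by (intro finite_UnI finite_UN_I finite_zeros fin x0) auto
  ultimately show ?thesis by (intro finite_subset[OF _ fin]) blast
qed

subsection \<open>Two-point divisors and the period\<close>

lemma two_point_simps [simp]:
  "P\<^sub>1 \<noteq> P\<^sub>2 \<Longrightarrow> two_point_divisor P\<^sub>1 P\<^sub>2 a b P\<^sub>1 = a"
  "P\<^sub>1 \<noteq> P\<^sub>2 \<Longrightarrow> two_point_divisor P\<^sub>1 P\<^sub>2 a b P\<^sub>2 = b"
  "Q \<noteq> P\<^sub>1 \<Longrightarrow> Q \<noteq> P\<^sub>2 \<Longrightarrow> two_point_divisor P\<^sub>1 P\<^sub>2 a b Q = 0"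
  by (auto simp: two_point_divisor_def point_divisor_def)

lemma
  assumes "is_place \<iota> P\<^sub>1" "is_place \<iota> P\<^sub>2" "P\<^sub>1 \<noteq> P\<^sub>2"
  shows divisor_two_point: "divisor \<iota> (two_point_divisor P\<^sub>1 P\<^sub>2 a b)"
    and dg_two_point: "dg (two_point_divisor P\<^sub>1 P\<^sub>2 a b) = a + b"
proof -
  have sub: "{P. two_point_divisor P\<^sub>1 P\<^sub>2 a b P \<noteq> 0} \<subseteq> {P\<^sub>1, P\<^sub>2}"
    using two_point_simps(3)[of _ P\<^sub>1 P\<^sub>2 a b] by blast
  then show "divisor \<iota> (two_point_divisor P\<^sub>1 P\<^sub>2 a b)"
    unfolding divisor_def using assms by (auto intro: finite_subset)
  have "dg (two_point_divisor P\<^sub>1 P\<^sub>2 a b) = sum (two_point_divisor P\<^sub>1 P\<^sub>2 a b) {P\<^sub>1, P\<^sub>2}"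
    using sub by (intro dg_superset) auto
  then show "dg (two_point_divisor P\<^sub>1 P\<^sub>2 a b) = a + b" using assms by simp
qed

lemma L_negative:
  assumes D: "divisor \<iota> D" "dg D < 0" and z: "z \<in> L D"
  shows "z = 0"
proof (rule ccontr)
  assume z0: "z \<noteq> 0"
  have "D P + principal_divisor \<iota> z P \<ge> 0" for P
  proof (cases "is_place \<iota> P")
    case True
    then have "val_ge P (- D P) z" using z L_iff by blast
    then show ?thesis using True z0 by (simp add: val_ge_def principal_divisor_def)
  next
    case False
    then have "D P = 0" using divisor_place[OF D(1), of P] by blast
    then show ?thesis using False by (simp add: principal_divisor_def)
  qed
  then have "dg (\<lambda>P. D P + principal_divisor \<iota> z P) \<ge> 0" by (rule dg_nonneg)
  then show False using D z0 by (simp add: dg_add divisor_principal dg_principal)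
qed

text \<open>For each \<open>n\<close> let \<open>m\<close> be maximal with \<open>L(nP\<^sub>1 - mP\<^sub>2) \<noteq> 0\<close>. This space is one-dimensional, so
  the effective divisor \<open>(f) + nP\<^sub>1 - mP\<^sub>2\<close> of its generator \<open>f\<close>, whose degree is at most the genus,
  is invariant under every semilinear automorphism fixing \<open>P\<^sub>1\<close> and \<open>P\<^sub>2\<close>. There are only
  finitely many such divisors, so two of them agree.\<close>

lemma invariant_effective_divisor:
  assumes P1: "is_place \<iota> P\<^sub>1" and P2: "is_place \<iota> P\<^sub>2" and ne: "P\<^sub>1 \<noteq> P\<^sub>2"
    and \<tau>: "semilinear_aut \<tau> \<phi>" "\<tau> ` P\<^sub>1 = P\<^sub>1" "\<tau> ` P\<^sub>2 = P\<^sub>2"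
  shows "\<exists>m f. f \<noteq> 0 \<and> n - m \<le> genus \<iota> \<and>
    (let E = (\<lambda>P. two_point_divisor P\<^sub>1 P\<^sub>2 n (- m) P + principal_divisor \<iota> f P) in
      divisor \<iota> E \<and> dg E = n - m \<and> (\<forall>P. E P \<ge> 0) \<and> (\<forall>P. is_place \<iota> P \<longrightarrow> E (\<tau> ` P) = E P))"
proof -
  let ?D = "\<lambda>m. two_point_divisor P\<^sub>1 P\<^sub>2 n (- m)"
  note dv = divisor_two_point[OF P1 P2 ne] and dgD = dg_two_point[OF P1 P2 ne]
  let ?Q = "\<lambda>m. \<exists>z. z \<noteq> 0 \<and> z \<in> L (?D m)"
  \<comment> \<open>For this \<open>m\<close> the divisor has degree g, so Riemann's inequality
    makes the dimension at least 1.\<close>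
  have "?Q (n - genus \<iota>)"
    using riemann_inequality[OF dv, of n "- (n - genus \<iota>)"] ell_pos_imp[of "?D (n - genus \<iota>)"]
    by (simp add: dgD)
  then have "?Q (n - int (nat (genus \<iota>))) \<or> ?Q (n - genus \<iota>)" by blast
  have bound: "m \<le> n" if "?Q m" for m
    using that L_negative[OF dv, of n "- m"] by (force simp: dgD)
  define m where "m = n - int (LEAST k. ?Q (n - int k))"
  have ex: "?Q (n - int (nat (genus \<iota>)))"
    using \<open>?Q (n - genus \<iota>)\<close> bound[OF \<open>?Q (n - genus \<iota>)\<close>] by simp
  have Qm: "?Q m" unfolding m_def by (rule LeastI[where P = "\<lambda>k. ?Q (n - int k)", OF ex])
  have mg: "n - m \<le> genus \<iota>"
    using Least_le[where P = "\<lambda>k. ?Q (n - int k)", OF ex] bound[OF \<open>?Q (n - genus \<iota>)\<close>]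
    unfolding m_def by linarith
  have mx: "\<not> ?Q (m + 1)"
  proof
    assume *: "?Q (m + 1)"
    then have "m + 1 \<le> n" by (rule bound)
    then have "m + 1 = n - int (nat (n - (m + 1)))" by simp
    with * have "?Q (n - int (nat (n - (m + 1))))" by simp
    from Least_le[where P = "\<lambda>k. ?Q (n - int k)", OF this] \<open>m + 1 \<le> n\<close> show False
      unfolding m_def by linarith
  qed
  obtain f where f: "f \<noteq> 0" "f \<in> L (?D m)" using Qm by blast
  \<comment> \<open>An element vanishing to one order more at the second place belongs to the space
    for \<open>m + 1\<close>, which is zero by maximality of \<open>m\<close>.\<close>
  have raise: "z = 0" if z: "z \<in> L (?D m)" "val_ge P\<^sub>2 (m + 1) z" for z
  proof -
    have "val_ge P (- ?D (m + 1) P) z" if "is_place \<iota> P" for P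
    proof (cases "P = P\<^sub>2")
      case True
      then show ?thesis using z(2) ne by (simp add: add.commute)
    next
      case False
      then have "?D (m + 1) P = ?D m P" by (simp add: two_point_divisor_def point_divisor_def)
      then show ?thesis using z(1) that by (simp add: L_iff)
    qed
    then show ?thesis using mx L_iff by blast
  qed
  have "val_ge P\<^sub>2 m f" using f(2)[unfolded L_iff, rule_format, OF P2] ne by simp
  moreover have "\<not> val_ge P\<^sub>2 (m + 1) f" using raise f by blast
  ultimately have vf: "place_val P\<^sub>2 f = m" using f(1) by (simp add: val_ge_def)
  have D_inv: "?D m (\<tau> ` P) = ?D m P" for P
    using aut_inj_image[OF \<tau>(1), of P P\<^sub>1] aut_inj_image[OF \<tau>(1), of P P\<^sub>2] \<tau>(2,3)
    by (simp add: two_point_divisor_def point_divisor_def)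
  have \<tau>f: "\<tau> f \<in> L (?D m)"
    unfolding L_iff
  proof (intro allI impI)
    fix Q assume "is_place \<iota> Q"
    then obtain P where "is_place \<iota> P" "Q = \<tau> ` P" using aut_place_preimage[OF \<tau>(1)] by blast
    then show "val_ge Q (- ?D m Q) (\<tau> f)"
      using f(2) by (simp add: D_inv aut_val_ge[OF \<tau>(1)] L_iff)
  qed
  have "val_ge P\<^sub>2 (place_val P\<^sub>2 f) (\<tau> f)"
    using aut_val_ge[OF \<tau>(1) P2, of "place_val P\<^sub>2 f" f] \<tau>(3) by (simp add: val_ge_place_val)
  \<comment> \<open>The image of f again lies in the space and has order at least \<open>m\<close>
    at the fixed second place. Subtracting the multiple of f with the same leading coefficient
    raises that order, so the difference vanishes and f is an eigenvector.\<close>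
  then obtain c where c: "val_ge P\<^sub>2 (m + 1) (\<tau> f - \<iota> c * f)"
    using leading_coefficient[OF P2 f(1)] vf by metis
  have "\<tau> f - \<iota> c * f \<in> L (?D m)"
    using \<tau>f f(2) by (intro vs.subspace_diff vs.subspace_scale subspace_L)
  then have "\<tau> f - \<iota> c * f = 0" using raise c by blast
  then have eq: "\<tau> f = \<iota> c * f" by simp
  have c0: "c \<noteq> 0" using eq f(1) aut_eq_0_iff[OF \<tau>(1), of f] by auto
  have inv: "place_val (\<tau> ` P) f = place_val P f" if P: "is_place \<iota> P" for P
    using aut_place_val[OF \<tau>(1) P f(1)] place_val_mult[OF aut_place[OF \<tau>(1) P], of "\<iota> c" f]
      place_val_emb[OF aut_place[OF \<tau>(1) P] c0] eq c0 f(1) by simp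
  define E where "E P = ?D m P + principal_divisor \<iota> f P" for P
  have E: "divisor \<iota> E" "dg E = n - m"
    unfolding E_def using f(1) by (simp_all add: divisor_add dv divisor_principal dg_add dg_principal dgD)
  have E_nonneg: "E P \<ge> 0" for P
  proof (cases "is_place \<iota> P")
    case True
    then have "val_ge P (- ?D m P) f" using f(2) L_iff by blast
    then show ?thesis using True f(1) by (simp add: E_def val_ge_def principal_divisor_def)
  next
    case False
    then show ?thesis using divisor_place[OF dv, of n "- m" P] by (force simp: E_def principal_divisor_def)
  qed
  have E_inv: "E (\<tau> ` P) = E P" if P: "is_place \<iota> P" for P
    using inv[OF P] P aut_place[OF \<tau>(1) P] by (simp add: E_def D_inv principal_divisor_def)
  show ?thesis
    by (rule exI[of _ m], rule exI[of _ f], unfold Let_def E_def[symmetric])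
      (intro conjI allI impI f(1) mg E E_nonneg E_inv)
qed

lemma period_exists_of_aut:
  assumes P1: "is_place \<iota> P\<^sub>1" and P2: "is_place \<iota> P\<^sub>2" and ne: "P\<^sub>1 \<noteq> P\<^sub>2"
    and \<sigma>: "semilinear_aut \<sigma> \<phi>" and \<phi>: "frobenius_like \<phi>" and x: "x \<notin> range \<iota>" "\<sigma> x = x"
  shows "\<exists>k>0. \<exists>z. z \<noteq> 0 \<and> two_point_divisor P\<^sub>1 P\<^sub>2 (int k) (- int k) = principal_divisor \<iota> z"
proof -
  obtain n1 where n1: "n1 > 0" "(\<sigma> ^^ n1) ` P\<^sub>1 = P\<^sub>1"
    using aut_place_periodic[OF \<sigma> \<phi> x P1] by blast
  obtain n2 where n2: "n2 > 0" "(\<sigma> ^^ n2) ` P\<^sub>2 = P\<^sub>2"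
    using aut_place_periodic[OF \<sigma> \<phi> x P2] by blast
  define N where "N = n1 * n2"
  define \<tau> where "\<tau> = \<sigma> ^^ N"
  have N: "N > 0" using n1 n2 by (simp add: N_def)
  have iter: "(\<rho> ^^ k) ` P = P" if "\<rho> ` P = P" for \<rho> :: "'f \<Rightarrow> 'f" and P k
  proof (induction k)
    case (Suc k)
    have "(\<rho> ^^ Suc k) ` P = \<rho> ` ((\<rho> ^^ k) ` P)" by (simp add: image_comp)
    with Suc that show ?case by simp
  qed simp
  have \<tau>: "semilinear_aut \<tau> (\<phi> ^^ N)" unfolding \<tau>_def by (rule aut_funpow[OF \<sigma>])
  have "\<tau> = (\<sigma> ^^ n1) ^^ n2" "\<tau> = (\<sigma> ^^ n2) ^^ n1"
    by (simp_all add: \<tau>_def N_def funpow_mult mult.commute)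
  then have \<tau>P: "\<tau> ` P\<^sub>1 = P\<^sub>1" "\<tau> ` P\<^sub>2 = P\<^sub>2" using iter n1(2) n2(2) by metis+
  define Q where "Q n m f \<longleftrightarrow> f \<noteq> 0 \<and> int n - m \<le> genus \<iota> \<and>
    (let E = (\<lambda>P. two_point_divisor P\<^sub>1 P\<^sub>2 (int n) (- m) P + principal_divisor \<iota> f P) in
      divisor \<iota> E \<and> dg E = int n - m \<and> (\<forall>P. E P \<ge> 0) \<and> (\<forall>P. is_place \<iota> P \<longrightarrow> E (\<tau> ` P) = E P))"
    for n m f
  have "\<exists>m f. Q n m f" for n
    unfolding Q_def by (rule invariant_effective_divisor[OF P1 P2 ne \<tau> \<tau>P])
  then obtain m f where mf: "\<And>n. Q n (m n) (f n)"
    by metis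
  define E where "E n P = two_point_divisor P\<^sub>1 P\<^sub>2 (int n) (- m n) P + principal_divisor \<iota> (f n) P" for n P
  have f: "f n \<noteq> 0" and E: "divisor \<iota> (E n)" "dg (E n) \<le> genus \<iota>" "E n P \<ge> 0"
    "is_place \<iota> P \<Longrightarrow> E n (\<tau> ` P) = E n P" for n P
    using mf[of n] unfolding Q_def Let_def E_def[symmetric] by auto
  define G where "G = nat (genus \<iota>)"
  have G: "int G = genus \<iota>" using E(2)[of 0] dg_nonneg[of "E 0"] E(3) by (simp add: G_def)
  \<comment> \<open>The support of \<open>E n\<close> is permuted by \<open>\<tau>\<close> and has
    at most \<open>G\<close> places, so all orbit lengths are at most \<open>G\<close> and divide
    \<open>fact G\<close>. One power of \<open>\<tau>\<close> thus fixes the supports of all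
    \<open>E n\<close> pointwise.\<close>
  define \<rho> where "\<rho> = \<tau> ^^ fact G"
  have supp: "\<rho> ` P = P" if EP: "E n P \<noteq> 0" for n P
  proof -
    have P: "is_place \<iota> P" using divisor_place[OF E(1) EP] .
    have orbit: "is_place \<iota> ((\<tau> ^^ k) ` P) \<and> E n ((\<tau> ^^ k) ` P) = E n P" for k
    proof (induction k)
      case (Suc k)
      have "(\<tau> ^^ Suc k) ` P = \<tau> ` ((\<tau> ^^ k) ` P)" by (simp add: image_comp)
      then show ?case using Suc aut_place[OF \<tau>] E(4) by simp
    qed (simp add: P)
    have "card {P. E n P \<noteq> 0} \<le> G"
    proof -
      have "int (card {P. E n P \<noteq> 0}) = (\<Sum>P\<in>{P. E n P \<noteq> 0}. 1)" by simp
      also have "\<dots> \<le> dg (E n)" unfolding dg_def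
      proof (rule sum_mono)
        fix P assume "P \<in> {P. E n P \<noteq> 0}"
        then show "1 \<le> E n P" using E(3)[of n P] by simp
      qed
      finally show ?thesis using E(2)[of n] G by linarith
    qed
    moreover have "(\<lambda>k. (\<tau> ^^ k) ` P) ` {..G} \<subseteq> {P. E n P \<noteq> 0}" using orbit EP by auto
    ultimately have "card ((\<lambda>k. (\<tau> ^^ k) ` P) ` {..G}) \<le> G"
      using card_mono[OF divisor_finite[OF E(1)]] order_trans by blast
    then have "\<not> inj_on (\<lambda>k. (\<tau> ^^ k) ` P) {..G}"
      using card_image[of "\<lambda>k. (\<tau> ^^ k) ` P" "{..G}"] by auto
    then obtain i j where ij: "i < j" "j \<le> G" "(\<tau> ^^ i) ` P = (\<tau> ^^ j) ` P"
      unfolding inj_on_def by (metis atMost_iff linorder_neqE_nat)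
    have "(\<tau> ^^ (i + (j - i))) ` P = (\<tau> ^^ i) ` ((\<tau> ^^ (j - i)) ` P)"
      unfolding funpow_add image_comp ..
    then have "(\<tau> ^^ j) ` P = (\<tau> ^^ i) ` ((\<tau> ^^ (j - i)) ` P)"
      using ij(1) by simp
    then have "(\<tau> ^^ (j - i)) ` P = P"
      using ij(3) aut_inj_image[OF aut_funpow[OF \<tau>]] by metis
    moreover have "(j - i) dvd fact G" using ij by (intro dvd_fact) auto
    then obtain l where "fact G = (j - i) * l" by blast
    ultimately show ?thesis
      using iter[of "\<tau> ^^ (j - i)" P l] by (simp add: \<rho>_def funpow_mult mult.commute)
  qed
  define S where "S = {P. is_place \<iota> P \<and> \<rho> ` P = P}"
  have "finite S"
    unfolding S_def
  proof (rule finite_fixed_places)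
    show "semilinear_aut \<rho> (\<phi> ^^ (N * fact G))"
      unfolding \<rho>_def \<tau>_def funpow_mult using aut_funpow[OF \<sigma>] by (simp add: mult.commute)
    show "finite {c. (\<phi> ^^ (N * fact G)) c = c}"
      using \<phi> N by (simp add: frobenius_like_def)
    show "\<rho> x = x"
    proof -
      have "(\<sigma> ^^ k) x = x" for k by (induction k) (simp_all add: x(2))
      then show ?thesis by (simp add: \<rho>_def \<tau>_def funpow_mult)
    qed
  qed (rule x(1))
  \<comment> \<open>The coefficients of \<open>E n\<close> are nonnegative and bounded by its
    degree, hence by the genus.\<close>
  moreover have "range E \<subseteq> {h. \<forall>P. (P \<in> S \<longrightarrow> h P \<in> {0..int G}) \<and> (P \<notin> S \<longrightarrow> h P = 0)}"
  proof -
    have "E n P \<le> int G" for n P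
      using dg_ge_value[OF E(1,3), of n P] E(2)[of n] G by simp
    moreover have "P \<in> S" if "E n P \<noteq> 0" for n P
      using supp[OF that] divisor_place[OF E(1) that] by (simp add: S_def)
    ultimately show ?thesis using E(3) by auto
  qed
  ultimately have "finite (range E)"
    using finite_set_of_finite_funs[of S "{0..int G}" 0] finite_subset by blast
  then have "\<not> inj E" using finite_imageD[of E UNIV] infinite_UNIV_nat by auto
  then obtain a b where ab: "a < b" "E a = E b"
    unfolding inj_on_def by (metis linorder_neqE_nat)
  \<comment> \<open>From \<open>E a = E b\<close> the quotient has divisor supported in the two
    places, with coefficient \<open>b - a\<close> at the first; degree zero determines the
    coefficient at the second.\<close>
  define z where "z = f a * inverse (f b)"
  have z: "z \<noteq> 0" "principal_divisor \<iota> z P = principal_divisor \<iota> (f a) P - principal_divisor \<iota> (f b) P" for P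
    using f by (auto simp: z_def principal_divisor_def place_val_mult place_val_inverse)
  have pz: "principal_divisor \<iota> z = two_point_divisor P\<^sub>1 P\<^sub>2 (int b - int a) (m a - m b)"
  proof
    fix P
    have "E a P = E b P" using ab(2) by simp
    then show "principal_divisor \<iota> z P = two_point_divisor P\<^sub>1 P\<^sub>2 (int b - int a) (m a - m b) P"
      unfolding E_def z(2) two_point_divisor_def by (simp add: algebra_simps)
  qed
  have "int b - int a + (m a - m b) = 0"
    using dg_principal[OF z(1)] unfolding pz dg_two_point[OF P1 P2 ne] .
  then have eqs: "m a - m b = - int (b - a)" "int b - int a = int (b - a)" using ab(1) by auto
  have "two_point_divisor P\<^sub>1 P\<^sub>2 (int (b - a)) (- int (b - a)) = principal_divisor \<iota> z"
    unfolding pz eqs ..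
  then show ?thesis using ab(1) z(1) by (intro exI[of _ "b - a"]) auto
qed

end

subsection \<open>The Frobenius automorphism\<close>

lemma funpow_fixed_mult:
  assumes "(\<phi> ^^ n) c = c"
  shows "(\<phi> ^^ (n * m)) c = c"
  using assms by (induction m) (simp_all add: funpow_add)

lemma funpow_binop:
  assumes "\<And>a b. \<phi> (h a b) = h (\<phi> a) (\<phi> b)"
  shows "(\<phi> ^^ n) (h a b) = h ((\<phi> ^^ n) a) ((\<phi> ^^ n) b)"
  by (induction n) (simp_all add: assms)

lemma common_period:
  assumes "finite C" "\<And>c. c \<in> C \<Longrightarrow> \<exists>n>0. (\<phi> ^^ n) c = c"
  shows "\<exists>n>0. \<forall>c\<in>C. (\<phi> ^^ n) c = c"
  using assms
proof (induction C)
  case empty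
  show ?case by (intro exI[of _ 1]) auto
next
  case (insert a C)
  then obtain n m where n: "n > 0" "\<forall>c\<in>C. (\<phi> ^^ n) c = c" and m: "m > 0" "(\<phi> ^^ m) a = a"
    by blast
  have "(\<phi> ^^ (n * m)) c = c" if "c \<in> insert a C" for c
    using that n(2) m(2) funpow_fixed_mult[of n \<phi> c m] funpow_fixed_mult[of m \<phi> a n]
    by (auto simp: mult.commute)
  with n(1) m(1) show ?case by (intro exI[of _ "n * m"]) auto
qed

lemma
  fixes \<phi> :: "'k::field \<Rightarrow> 'k"
  assumes add: "\<And>a b. \<phi> (a + b) = \<phi> a + \<phi> b" and mult: "\<And>a b. \<phi> (a * b) = \<phi> a * \<phi> b"
  shows map_poly_hom_0: "\<phi> 0 = 0"
    and map_poly_hom_add: "map_poly \<phi> (p + q) = map_poly \<phi> p + map_poly \<phi> q"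
    and map_poly_hom_mult: "map_poly \<phi> (p * q) = map_poly \<phi> p * map_poly \<phi> q"
proof -
  show 0: "\<phi> 0 = 0" using add[of 0 0] by (metis add_0_right add_cancel_right_right)
  show add': "map_poly \<phi> (p + q) = map_poly \<phi> p + map_poly \<phi> q" for p q
    by (rule poly_eqI) (simp add: coeff_map_poly 0 add)
  have sm: "map_poly \<phi> (Polynomial.smult a q) = Polynomial.smult (\<phi> a) (map_poly \<phi> q)" for a q
    by (rule poly_eqI) (simp add: coeff_map_poly 0 mult)
  show "map_poly \<phi> (p * q) = map_poly \<phi> p * map_poly \<phi> q"
    by (induction p) (simp_all add: add' sm map_poly_pCons[of \<phi>, OF 0] 0)
qed

text \<open>\<open>F\<close> has a basis \<open>S\<close> over \<open>K(x)\<close>. If \<open>\<phi>\<close> fixes the coefficients of the structure constants,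
  then \<open>\<phi>\<close>, acting on the coordinates, extends to an automorphism of \<open>F\<close>. Here \<open>D z\<close> and \<open>C z\<close> are a
  common denominator and the numerators of the coordinates of \<open>z\<close>.\<close>

locale function_field_basis = alg_closed_function_field \<iota>
  for \<iota> :: "'k::alg_closed_field \<Rightarrow> 'f::field" +
  fixes x :: 'f and S :: "'f set" and \<phi> :: "'k \<Rightarrow> 'k" and D :: "'f \<Rightarrow> 'k poly" and C :: "'f \<Rightarrow> 'f \<Rightarrow> 'k poly"
  assumes ev_x: "ev p x = 0 \<Longrightarrow> p = 0"
    and indep_S: "indep_over x (\<lambda>s. s) S"
    and rep_S: "\<exists>d p. d \<noteq> 0 \<and> ev d x * z = (\<Sum>s\<in>S. ev (p s) x * s)"
    and frobenius: "frobenius_like \<phi>"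
    and D_nonzero: "z \<in> insert 1 ((\<lambda>(s, t). s * t) ` (S \<times> S)) \<Longrightarrow> D z \<noteq> 0"
    and D_rep: "z \<in> insert 1 ((\<lambda>(s, t). s * t) ` (S \<times> S)) \<Longrightarrow> ev (D z) x * z = (\<Sum>s\<in>S. ev (C z s) x * s)"
    and D_fixed: "z \<in> insert 1 ((\<lambda>(s, t). s * t) ` (S \<times> S)) \<Longrightarrow> map_poly \<phi> (D z) = D z"
    and C_fixed: "z \<in> insert 1 ((\<lambda>(s, t). s * t) ` (S \<times> S)) \<Longrightarrow> s \<in> S \<Longrightarrow> map_poly \<phi> (C z s) = C z s"
begin

abbreviation "\<Phi> \<equiv> map_poly \<phi>"

lemma \<phi>_hom: "\<phi> (a + b) = \<phi> a + \<phi> b" "\<phi> (a * b) = \<phi> a * \<phi> b" and bij_\<phi>: "bij \<phi>"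
  using frobenius unfolding frobenius_like_def by blast+

lemmas \<phi>_0 = map_poly_hom_0[of \<phi>, OF \<phi>_hom]
lemmas \<Phi>_add = map_poly_hom_add[of \<phi>, OF \<phi>_hom]
lemmas \<Phi>_mult = map_poly_hom_mult[of \<phi>, OF \<phi>_hom]

lemma \<phi>_1: "\<phi> 1 = 1"
proof -
  have "\<phi> 1 \<noteq> \<phi> 0" using bij_\<phi> by (simp add: bij_is_inj inj_eq)
  then show ?thesis using \<phi>_hom(2)[of 1 1] \<phi>_0 by auto
qed

lemma \<Phi>_0 [simp]: "\<Phi> 0 = 0" by simp

lemma \<Phi>_const: "\<Phi> [:c:] = [:\<phi> c:]"
  by (simp add: map_poly_pCons \<phi>_0)

lemma \<Phi>_1 [simp]: "\<Phi> 1 = 1"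
  by (simp add: one_pCons \<Phi>_const \<phi>_1)

lemma \<Phi>_eq_0_iff: "\<Phi> p = 0 \<longleftrightarrow> p = 0"
proof
  assume "\<Phi> p = 0"
  then have "\<phi> (Polynomial.coeff p i) = \<phi> 0" for i
    by (metis coeff_0 coeff_map_poly \<phi>_0)
  then have "Polynomial.coeff p i = 0" for i using bij_\<phi> by (simp add: bij_is_inj inj_eq)
  then show "p = 0" by (simp add: poly_eq_iff)
qed simp

lemma ev_x_iff: "ev p x = 0 \<longleftrightarrow> p = 0"
  using ev_x by auto

definition rep :: "'k poly \<Rightarrow> ('f \<Rightarrow> 'k poly) \<Rightarrow> 'f \<Rightarrow> bool" where
  "rep d p z \<longleftrightarrow> d \<noteq> 0 \<and> ev d x * z = (\<Sum>s\<in>S. ev (p s) x * s)"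

definition \<sigma> :: "'f \<Rightarrow> 'f" where
  "\<sigma> z = (let (d, p) = (SOME (d, p). rep d p z) in (\<Sum>s\<in>S. ev (\<Phi> (p s)) x * s) / ev (\<Phi> d) x)"

text \<open>Two representations of z satisfy \<open>e * p s = d * q s\<close> by independence of
  \<open>S\<close>, and \<open>\<Phi>\<close> preserves this relation. The value of
  \<open>\<sigma>\<close> is therefore independent of the representation picked by
  \<open>SOME\<close>.\<close>

lemma \<sigma>_rep:
  assumes "rep d p z"
  shows "ev (\<Phi> d) x * \<sigma> z = (\<Sum>s\<in>S. ev (\<Phi> (p s)) x * s)"
proof -
  obtain e q where eq: "(SOME (d, p). rep d p z) = (e, q)" by fastforce
  have "rep e q z"
    using someI[of "\<lambda>(d, p). rep d p z" "(d, p)"] assms unfolding eq by simp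
  have \<sigma>z: "\<sigma> z = (\<Sum>s\<in>S. ev (\<Phi> (q s)) x * s) / ev (\<Phi> e) x"
    by (simp add: \<sigma>_def eq)
  have "(\<Sum>s\<in>S. ev (e * p s - d * q s) x * s) =
      ev e x * (\<Sum>s\<in>S. ev (p s) x * s) - ev d x * (\<Sum>s\<in>S. ev (q s) x * s)"
    by (simp add: sum_distrib_left sum_subtractf left_diff_distrib mult.assoc)
  also have "\<dots> = ev e x * (ev d x * z) - ev d x * (ev e x * z)"
    using assms \<open>rep e q z\<close> by (simp add: rep_def)
  finally have "(\<Sum>s\<in>S. ev (e * p s - d * q s) x * s) = 0" by simp
  then have "e * p s = d * q s" if "s \<in> S" for s
    using indep_S that unfolding indep_over_def
    by (auto dest!: spec[of _ "\<lambda>s. e * p s - d * q s"])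
  then have cross: "\<Phi> e * \<Phi> (p s) = \<Phi> d * \<Phi> (q s)" if "s \<in> S" for s
    using that by (metis \<Phi>_mult)
  have e0: "ev (\<Phi> e) x \<noteq> 0" using \<open>rep e q z\<close> by (simp add: rep_def ev_x_iff \<Phi>_eq_0_iff)
  have "ev (\<Phi> e) x * (ev (\<Phi> d) x * \<sigma> z) = ev (\<Phi> d) x * (\<Sum>s\<in>S. ev (\<Phi> (q s)) x * s)"
    using e0 unfolding \<sigma>z by simp
  also have "\<dots> = (\<Sum>s\<in>S. ev (\<Phi> d * \<Phi> (q s)) x * s)"
    by (simp add: sum_distrib_left mult.assoc)
  also have "\<dots> = (\<Sum>s\<in>S. ev (\<Phi> e * \<Phi> (p s)) x * s)"
    by (intro sum.cong refl) (simp only: cross)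
  also have "\<dots> = ev (\<Phi> e) x * (\<Sum>s\<in>S. ev (\<Phi> (p s)) x * s)"
    by (simp add: sum_distrib_left mult.assoc)
  finally show ?thesis using e0 by simp
qed

lemma \<sigma>_unique:
  assumes "rep d p z" "ev (\<Phi> d) x * w = (\<Sum>s\<in>S. ev (\<Phi> (p s)) x * s)"
  shows "\<sigma> z = w"
proof -
  have "ev (\<Phi> d) x \<noteq> 0" using assms(1) by (simp add: rep_def ev_x_iff \<Phi>_eq_0_iff)
  moreover have "ev (\<Phi> d) x * \<sigma> z = ev (\<Phi> d) x * w" using \<sigma>_rep[OF assms(1)] assms(2) by simp
  ultimately show ?thesis by simp
qed

lemma ex_rep: "\<exists>d p. rep d p z"
  using rep_S by (simp add: rep_def)

lemma \<sigma>_add: "\<sigma> (z + w) = \<sigma> z + \<sigma> w"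
proof -
  obtain d p e q where z: "rep d p z" and w: "rep e q w" using ex_rep by meson
  show ?thesis
  proof (rule \<sigma>_unique)
    have "ev (d * e) x * (z + w) = ev e x * (ev d x * z) + ev d x * (ev e x * w)"
      by (simp add: algebra_simps)
    then show "rep (d * e) (\<lambda>s. e * p s + d * q s) (z + w)"
      using z w by (simp add: rep_def sum_distrib_left sum.distrib distrib_right mult.assoc)
    have "ev (\<Phi> (d * e)) x * (\<sigma> z + \<sigma> w) =
        ev (\<Phi> e) x * (ev (\<Phi> d) x * \<sigma> z) + ev (\<Phi> d) x * (ev (\<Phi> e) x * \<sigma> w)"
      by (simp add: \<Phi>_mult algebra_simps)
    then show "ev (\<Phi> (d * e)) x * (\<sigma> z + \<sigma> w) = (\<Sum>s\<in>S. ev (\<Phi> (e * p s + d * q s)) x * s)"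
      unfolding \<sigma>_rep[OF z] \<sigma>_rep[OF w]
      by (simp add: \<Phi>_mult \<Phi>_add sum_distrib_left sum.distrib distrib_right mult.assoc)
  qed
qed

lemma \<sigma>_ev: "\<sigma> (ev r x * z) = ev (\<Phi> r) x * \<sigma> z"
proof -
  obtain d p where z: "rep d p z" using ex_rep by meson
  show ?thesis
  proof (rule \<sigma>_unique)
    have eq: "ev d x * (ev r x * z) = ev r x * (\<Sum>s\<in>S. ev (p s) x * s)"
      using z by (simp add: rep_def mult.left_commute)
    show "rep d (\<lambda>s. r * p s) (ev r x * z)"
      using z unfolding rep_def eq by (simp add: sum_distrib_left mult.assoc)
    have "ev (\<Phi> d) x * (ev (\<Phi> r) x * \<sigma> z) = ev (\<Phi> r) x * (ev (\<Phi> d) x * \<sigma> z)" by (simp add: mult_ac)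
    then show "ev (\<Phi> d) x * (ev (\<Phi> r) x * \<sigma> z) = (\<Sum>s\<in>S. ev (\<Phi> (r * p s)) x * s)"
      unfolding \<sigma>_rep[OF z] by (simp add: \<Phi>_mult sum_distrib_left mult.assoc)
  qed
qed

lemma \<sigma>_0: "\<sigma> 0 = 0"
  using \<sigma>_add[of 0 0] by (metis add_0_right add_cancel_right_right)

lemma \<sigma>_sum: "\<sigma> (sum h A) = (\<Sum>a\<in>A. \<sigma> (h a))"
  by (induction A rule: infinite_finite_induct) (simp_all add: \<sigma>_add \<sigma>_0)

text \<open>Multiplicativity of \<open>\<sigma>\<close> is checked by expanding a product over pairs
  of basis elements; there only the products of two basis elements and the unit 1 matter, and their
  coordinates are fixed by \<open>\<Phi>\<close>.\<close>

lemma \<sigma>_structure: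
  assumes "z \<in> insert 1 ((\<lambda>(s, t). s * t) ` (S \<times> S))"
  shows "\<sigma> z = z"
proof (rule \<sigma>_unique)
  show "rep (D z) (C z) z" using D_nonzero[OF assms] D_rep[OF assms] by (simp add: rep_def)
  have "(\<Sum>s\<in>S. ev (\<Phi> (C z s)) x * s) = (\<Sum>s\<in>S. ev (C z s) x * s)"
    by (intro sum.cong refl) (simp only: C_fixed[OF assms])
  then show "ev (\<Phi> (D z)) x * z = (\<Sum>s\<in>S. ev (\<Phi> (C z s)) x * s)"
    using D_rep[OF assms] by (simp add: D_fixed[OF assms])
qed

lemma \<sigma>_1: "\<sigma> 1 = 1"
  by (rule \<sigma>_structure) simp

lemma \<sigma>_ev': "\<sigma> (ev r x) = ev (\<Phi> r) x"
  using \<sigma>_ev[of r 1] by (simp add: \<sigma>_1)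

lemma \<sigma>_emb: "\<sigma> (\<iota> c) = \<iota> (\<phi> c)"
  using \<sigma>_ev'[of "[:c:]"] by (simp add: \<Phi>_const)

lemma \<sigma>_x: "\<sigma> x = x"
  using \<sigma>_ev'[of "[:0, 1:]"] by (simp add: map_poly_pCons \<phi>_0 \<phi>_1)

lemma \<sigma>_mult: "\<sigma> (z * w) = \<sigma> z * \<sigma> w"
proof -
  obtain d p e q where z: "rep d p z" and w: "rep e q w" using ex_rep by meson
  have "ev (d * e) x * (z * w) = (ev d x * z) * (ev e x * w)" by (simp add: mult_ac)
  also have "\<dots> = (\<Sum>s\<in>S. \<Sum>t\<in>S. ev (p s * q t) x * (s * t))"
    using z w by (simp add: rep_def sum_product mult_ac)
  finally have "\<sigma> (ev (d * e) x * (z * w)) = \<sigma> (\<Sum>s\<in>S. \<Sum>t\<in>S. ev (p s * q t) x * (s * t))" by simp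
  also have "\<dots> = (\<Sum>s\<in>S. \<Sum>t\<in>S. ev (\<Phi> (p s * q t)) x * (s * t))"
  proof -
    have "\<sigma> (ev (p s * q t) x * (s * t)) = ev (\<Phi> (p s * q t)) x * (s * t)" if "s \<in> S" "t \<in> S" for s t
      using \<sigma>_structure[of "s * t"] that unfolding \<sigma>_ev by auto
    then show ?thesis unfolding \<sigma>_sum by (intro sum.cong refl)
  qed
  also have "\<dots> = (ev (\<Phi> d) x * \<sigma> z) * (ev (\<Phi> e) x * \<sigma> w)"
    unfolding \<sigma>_rep[OF z] \<sigma>_rep[OF w] by (simp add: \<Phi>_mult sum_product mult_ac)
  finally have "ev (\<Phi> d) x * ev (\<Phi> e) x * \<sigma> (z * w) = ev (\<Phi> d) x * ev (\<Phi> e) x * (\<sigma> z * \<sigma> w)"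
    unfolding \<sigma>_ev by (simp add: \<Phi>_mult mult_ac)
  moreover have "ev (\<Phi> d) x * ev (\<Phi> e) x \<noteq> 0"
    using z w by (simp add: rep_def ev_x_iff \<Phi>_eq_0_iff)
  ultimately show ?thesis by (metis mult_left_cancel)
qed

lemma \<Phi>_surj: "\<exists>q. \<Phi> q = p"
proof
  let ?\<psi> = "inv_into UNIV \<phi>"
  have \<phi>\<psi>: "\<phi> (?\<psi> c) = c" for c using bij_\<phi> by (simp add: bij_is_surj surj_f_inv_f)
  have "?\<psi> 0 = 0" using bij_\<phi> \<phi>_0 by (metis bij_is_inj inv_f_f)
  then show "\<Phi> (map_poly ?\<psi> p) = p"
    by (intro poly_eqI) (simp add: coeff_map_poly \<phi>_0 \<phi>\<psi>)
qed

lemma semilinear_aut_\<sigma>: "semilinear_aut \<sigma> \<phi>"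
proof -
  have "inj \<sigma>"
  proof (rule injI)
    fix z w assume eq: "\<sigma> z = \<sigma> w"
    show "z = w"
    proof (rule ccontr)
      assume "z \<noteq> w"
      have "\<sigma> (z - w) + \<sigma> w = \<sigma> z" by (simp flip: \<sigma>_add)
      then have "\<sigma> (z - w) = 0" using eq by simp
      then have "\<sigma> ((z - w) * inverse (z - w)) = 0" by (simp add: \<sigma>_mult)
      then show False using \<open>z \<noteq> w\<close> \<sigma>_1 by simp
    qed
  qed
  moreover have "surj \<sigma>"
    unfolding surj_def
  proof
    fix w
    obtain d p where w: "rep d p w" using ex_rep by meson
    obtain e where e: "\<Phi> e = d" using \<Phi>_surj by blast
    have "\<exists>q. \<forall>s. \<Phi> (q s) = p s" by (rule choice) (rule allI, rule \<Phi>_surj)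
    then obtain q where q: "\<And>s. \<Phi> (q s) = p s" by blast
    have "e \<noteq> 0" using w e by (auto simp: rep_def)
    define z where "z = (\<Sum>s\<in>S. ev (q s) x * s) / ev e x"
    have "rep e q z" using \<open>e \<noteq> 0\<close> by (simp add: rep_def z_def ev_x_iff)
    then have "\<sigma> z = w" using w by (intro \<sigma>_unique) (auto simp: e q rep_def)
    then show "\<exists>z. w = \<sigma> z" by blast
  qed
  ultimately show ?thesis
    unfolding semilinear_aut_def bij_def using bij_\<phi>
    by (simp add: \<sigma>_add \<sigma>_mult \<sigma>_emb bij_is_surj)
qed

end

context alg_closed_function_field
begin

text \<open>An independent set of maximal size exists by the uniform bound, and a relation produced
  by adding z expresses z with denominator \<open>p z\<close>.\<close>

lemma ex_basis:
  assumes ev_x: "\<And>p. ev p x = 0 \<Longrightarrow> p = 0"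
  shows "\<exists>S. finite S \<and> indep_over x (\<lambda>s. s) S \<and>
    (\<forall>z. \<exists>d p. d \<noteq> 0 \<and> ev d x * z = (\<Sum>s\<in>S. ev (p s) x * s))"
proof -
  obtain N where N: "\<And>(I::'f set) h. finite I \<Longrightarrow> indep_over x h I \<Longrightarrow> card I \<le> N"
    using indep_over_bounded by blast
  let ?Q = "\<lambda>S. finite S \<and> indep_over x (\<lambda>s. s) S"
  have "?Q {}" by (simp add: indep_over_def)
  then obtain S where S: "?Q S" and max: "\<And>T. ?Q T \<Longrightarrow> card T \<le> card S"
    using ex_has_greatest_nat[of ?Q "{}" card "Suc N"] N by (auto simp: less_Suc_eq_le)
  have "\<exists>d p. d \<noteq> 0 \<and> ev d x * z = (\<Sum>s\<in>S. ev (p s) x * s)" for z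
  proof (cases "z \<in> S")
    case True
    have "(\<Sum>s\<in>S. ev (if s = z then 1 else 0) x * s) = z"
      using True S by (simp add: if_distrib[of "\<lambda>p. ev p x"] if_distrib[of "\<lambda>u. u * _"] cong: if_cong)
    then show ?thesis
      by (intro exI[of _ 1] exI[of _ "\<lambda>s. if s = z then 1 else 0"]) simp
  next
    case False
    then have "\<not> ?Q (insert z S)" using max[of "insert z S"] S by auto
    then obtain p where p: "(\<Sum>s\<in>insert z S. ev (p s) x * s) = 0" "\<exists>s\<in>insert z S. p s \<noteq> 0"
      using S unfolding indep_over_def by auto
    have sum: "ev (p z) x * z + (\<Sum>s\<in>S. ev (p s) x * s) = 0"
      using p(1) S False by simp
    have "p z \<noteq> 0"
    proof
      assume "p z = 0"
      then have "\<forall>s\<in>S. p s = 0" using sum S unfolding indep_over_def by simp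
      with \<open>p z = 0\<close> p(2) show False by auto
    qed
    moreover have "ev (p z) x * z = (\<Sum>s\<in>S. ev (- p s) x * s)"
      using sum by (simp add: sum_negf eq_neg_iff_add_eq_0)
    ultimately show ?thesis by (intro exI[of _ "p z"] exI[of _ "\<lambda>s. - p s"]) blast
  qed
  with S show ?thesis by blast
qed

lemma frobenius_like_funpow:
  assumes "frobenius_like \<phi>" "N > 0"
  shows "frobenius_like (\<phi> ^^ N)"
proof -
  have "\<exists>n>0. ((\<phi> ^^ N) ^^ n) c = c" for c
  proof -
    obtain n where n: "n > 0" "(\<phi> ^^ n) c = c" using assms unfolding frobenius_like_def by blast
    have "((\<phi> ^^ N) ^^ n) c = c"
      using funpow_fixed_mult[OF n(2), of N] by (simp add: funpow_mult mult.commute)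
    with n(1) show ?thesis by blast
  qed
  then show ?thesis
    using assms funpow_binop[of \<phi> "(+)"] funpow_binop[of \<phi> "(*)"]
    unfolding frobenius_like_def by (simp add: bij_fn funpow_mult)
qed

lemma ex_semilinear_aut:
  assumes \<phi>: "frobenius_like \<phi>"
  shows "\<exists>N x \<sigma>. frobenius_like (\<phi> ^^ N) \<and> semilinear_aut \<sigma> (\<phi> ^^ N) \<and> x \<notin> range \<iota> \<and> \<sigma> x = x"
proof -
  obtain x where "transcendental_over \<iota> x"
    using function_field by (auto simp: function_field_def)
  then have ev_x: "p = 0" if "ev p x = 0" for p
    using that by (auto simp: transcendental_over_def ev_def)
  obtain S where S: "finite S" "indep_over x (\<lambda>s. s) S"
    "\<And>z. \<exists>d p. d \<noteq> 0 \<and> ev d x * z = (\<Sum>s\<in>S. ev (p s) x * s)"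
    using ex_basis[OF ev_x] by blast
  obtain D C where DC: "\<And>z. D z \<noteq> 0 \<and> ev (D z) x * z = (\<Sum>s\<in>S. ev (C z s) x * s)"
    using S(3) by metis
  let ?Z = "insert 1 ((\<lambda>(s, t). s * t) ` (S \<times> S))"
  let ?coeffs = "\<lambda>p. Polynomial.coeff p ` {..Polynomial.degree p}"
  \<comment> \<open>The coordinates of 1 and of all products of basis elements involve only finitely
    many constants, so a single power of \<open>\<phi>\<close> fixes all of them.\<close>
  define A where "A = (\<Union>z\<in>?Z. ?coeffs (D z)) \<union> (\<Union>z\<in>?Z. \<Union>s\<in>S. ?coeffs (C z s))"
  have "finite A" using S(1) by (auto simp: A_def)
  then obtain N where N: "N > 0" "\<forall>c\<in>A. (\<phi> ^^ N) c = c"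
    using common_period[of A \<phi>] \<phi> unfolding frobenius_like_def by blast
  have \<phi>N: "frobenius_like (\<phi> ^^ N)" by (rule frobenius_like_funpow[OF \<phi> N(1)])
  then have hom0: "(\<phi> ^^ N) 0 = 0"
    using map_poly_hom_0[of "\<phi> ^^ N"] unfolding frobenius_like_def by blast
  have fixed: "map_poly (\<phi> ^^ N) p = p" if "?coeffs p \<subseteq> A" for p
  proof (rule poly_eqI)
    fix i
    show "Polynomial.coeff (map_poly (\<phi> ^^ N) p) i = Polynomial.coeff p i"
      using that N(2) by (cases "i \<le> Polynomial.degree p") (auto simp: coeff_map_poly hom0 coeff_eq_0)
  qed
  interpret function_field_basis \<iota> x S "\<phi> ^^ N" D C
  proof
    show "ev p x = 0 \<Longrightarrow> p = 0" for p by (rule ev_x)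
    show "map_poly (\<phi> ^^ N) (D z) = D z" if "z \<in> ?Z" for z
      by (rule fixed, unfold A_def) (use that in blast)
    show "map_poly (\<phi> ^^ N) (C z s) = C z s" if "z \<in> ?Z" "s \<in> S" for z s
      by (rule fixed, unfold A_def) (use that in blast)
  qed (use S DC \<phi>N in auto)
  have "x \<notin> range \<iota>"
  proof
    assume "x \<in> range \<iota>"
    then obtain c where "x = \<iota> c" by blast
    then have "ev [:- c, 1:] x = 0" by simp
    from ev_x[OF this] show False by simp
  qed
  with \<phi>N semilinear_aut_\<sigma> \<sigma>_x show ?thesis by blast
qed

lemma period_exists:
  assumes "frobenius_like \<phi>" "is_place \<iota> P\<^sub>1" "is_place \<iota> P\<^sub>2" "P\<^sub>1 \<noteq> P\<^sub>2"
  shows "\<exists>k>0. \<exists>z. z \<noteq> 0 \<and> two_point_divisor P\<^sub>1 P\<^sub>2 (int k) (- int k) = principal_divisor \<iota> z"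
proof -
  obtain N x \<sigma> where "frobenius_like (\<phi> ^^ N)" "semilinear_aut \<sigma> (\<phi> ^^ N)" "x \<notin> range \<iota>" "\<sigma> x = x"
    using ex_semilinear_aut[OF assms(1)] by blast
  then show ?thesis using period_exists_of_aut[OF assms(2-4)] by blast
qed

lemma frobenius_likeI:
  fixes \<phi> :: "'k \<Rightarrow> 'k"
  assumes "\<And>c. \<phi> c = c ^ p" "prime p" "CHAR('k) = p" "\<And>c. \<exists>n>0. (\<phi> ^^ n) c = c"
  shows "frobenius_like \<phi>"
proof -
  have add: "\<phi> (a + b) = \<phi> a + \<phi> b" for a b
    using assms by (simp add: freshmans_dream)
  have mult: "\<phi> (a * b) = \<phi> a * \<phi> b" for a b
    using assms by (simp add: power_mult_distrib)
  have p: "p > 1" using assms(2) prime_gt_1_nat by blast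
  have "inj \<phi>"
  proof (rule injI)
    fix a b assume "\<phi> a = \<phi> b"
    moreover have "\<phi> (a - b) + \<phi> b = \<phi> a" by (simp flip: add)
    ultimately have "(a - b) ^ p = 0" using assms(1) by (metis add_cancel_left_left)
    then show "a = b" using p by simp
  qed
  moreover have "surj \<phi>"
    unfolding surj_def using nth_root_exists[of p] p assms(1) by (metis less_trans zero_less_one)
  ultimately have bij: "bij \<phi>" by (simp add: bij_def)
  have "finite {c. (\<phi> ^^ n) c = c}" if n: "n > 0" for n
  proof -
    have pow: "(\<phi> ^^ n) c = c ^ (p ^ n)" for n c
      by (induction n) (simp_all add: assms(1) power_mult[symmetric] mult.commute)
    \<comment> \<open>The fixed points of the \<open>n\<close>-th iterate are the roots of
      \<open>X ^ (p ^ n) - X\<close>, which is nonzero because \<open>p ^ n > 1\<close>.\<close>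
    let ?q = "Polynomial.monom 1 (p ^ n) - Polynomial.monom (1 :: 'k) 1"
    have "1 < p ^ n" using p n by (rule one_less_power)
    then have "Polynomial.coeff ?q 1 \<noteq> Polynomial.coeff 0 1" using p n by simp
    then have "?q \<noteq> 0" by metis
    then have "finite {c. Polynomial.poly ?q c = 0}" by (rule poly_roots_finite)
    then show ?thesis by (simp add: pow poly_monom)
  qed
  with bij add mult assms(4) show ?thesis unfolding frobenius_like_def by blast
qed

end

text \<open>Some power of Frobenius fixes the finite base field elementwise. It then maps roots of a
  polynomial over that field to roots of the same polynomial, so the orbit of an algebraic element
  is finite.\<close>

lemma alg_closure_frobenius_periodic:
  fixes c :: "'q::{field, finite} alg_closure"
  defines "\<phi> \<equiv> \<lambda>c :: 'q alg_closure. c ^ CHAR('q)"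
  shows "\<exists>n>0. (\<phi> ^^ n) c = c"
proof -
  define p where "p = CHAR('q)"
  have p: "prime p" unfolding p_def
    using finite_imp_CHAR_pos[where ?'a = 'q] prime_CHAR_semidom[where ?'a = 'q] by simp
  have add: "\<phi> (a + b) = \<phi> a + \<phi> b" for a b
    unfolding \<phi>_def by (rule freshmans_dream) (use p in \<open>simp_all add: p_def\<close>)
  have mult: "\<phi> (a * b) = \<phi> a * \<phi> b" for a b
    by (simp add: \<phi>_def power_mult_distrib)
  have p0: "p > 0" using p prime_gt_0_nat by blast
  then have zero: "\<phi> 0 = 0" by (simp add: \<phi>_def p_def)
  have inj_\<phi>: "inj \<phi>"
  proof (rule injI)
    fix a b assume "\<phi> a = \<phi> b"
    moreover have "\<phi> (a - b) + \<phi> b = \<phi> a" by (simp flip: add)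
    ultimately have "\<phi> (a - b) = 0" by (metis add_cancel_left_left)
    then show "a = b" using p0 by (simp add: \<phi>_def p_def)
  qed
  have to_ac: "\<phi> (to_ac a) = to_ac (a ^ p)" for a :: 'q by (simp add: \<phi>_def p_def)
  have per: "\<exists>n>0. (\<phi> ^^ n) b = b" if b: "b \<in> range (to_ac :: 'q \<Rightarrow> _)" for b
  proof -
    have orbit: "(\<phi> ^^ n) b \<in> range (to_ac :: 'q \<Rightarrow> _)" for n
    proof (induction n)
      case (Suc n)
      then obtain a :: 'q where "(\<phi> ^^ n) b = to_ac a" by blast
      then have "(\<phi> ^^ Suc n) b = to_ac (a ^ p)" using to_ac[of a] by simp
      then show ?case by blast
    qed (use b in simp)
    have "finite {y. \<exists>n. y = (\<phi> ^^ n) b}"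
    proof (rule finite_subset)
      show "{y. \<exists>n. y = (\<phi> ^^ n) b} \<subseteq> range (to_ac :: 'q \<Rightarrow> _)" using orbit by blast
    qed simp
    then show ?thesis using funpow_inj_finite[OF inj_\<phi>, of b] by blast
  qed
  obtain m where m: "m > 0" "\<forall>b\<in>range (to_ac :: 'q \<Rightarrow> _). (\<phi> ^^ m) b = b"
    using common_period[of "range (to_ac :: 'q \<Rightarrow> _)" \<phi>] per by auto
  obtain f :: "'q poly" where f: "f \<noteq> 0" "Polynomial.poly (map_poly to_ac f) c = 0"
    using alg_closure_algebraic by blast
  let ?f = "map_poly to_ac f"
  let ?\<psi> = "\<phi> ^^ m"
  have hom: "?\<psi> (a + b) = ?\<psi> a + ?\<psi> b" "?\<psi> (a * b) = ?\<psi> a * ?\<psi> b" "?\<psi> 0 = 0" for a b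
    by (induction m) (simp_all add: add mult zero)
  have root: "Polynomial.poly (map_poly to_ac g) (?\<psi> a) = ?\<psi> (Polynomial.poly (map_poly to_ac g) a)" for g :: "'q poly" and a
    by (induction g) (use m(2) in \<open>simp_all add: hom map_poly_pCons\<close>)
  have "?f \<noteq> 0" using f(1) by (simp add: map_poly_eq_0_iff)
  then have fin: "finite {a. Polynomial.poly ?f a = 0}" by (rule poly_roots_finite)
  have orbit: "Polynomial.poly ?f ((?\<psi> ^^ n) c) = 0" for n
    by (induction n) (simp_all add: f(2) root hom(3))
  have finite_orbit: "finite {y. \<exists>n. y = (?\<psi> ^^ n) c}"
    by (rule finite_subset[OF _ fin]) (use orbit in blast)
  obtain n where "n > 0" "(?\<psi> ^^ n) c = c"
    by (rule funpow_inj_finite[OF inj_fn[OF inj_\<phi>] finite_orbit])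
  then show ?thesis using m(1) by (intro exI[of _ "m * n"]) (simp add: funpow_mult mult.commute)
qed

subsection \<open>Counting inversions by blocks\<close>

lemma int_least_upward:
  fixes Q :: "int \<Rightarrow> bool"
  assumes up: "\<And>b. Q b \<Longrightarrow> Q (b + 1)" and "Q b1" and low: "\<And>b. b < b0 \<Longrightarrow> \<not> Q b"
  shows "\<exists>t. \<forall>b. Q b \<longleftrightarrow> t \<le> b"
proof -
  have up': "Q (b + int n)" if "Q b" for b n
  proof (induction n)
    case (Suc n)
    from up[OF this] show ?case by (simp add: add_ac)
  qed (simp add: that)
  define n where "n = (LEAST n. Q (b0 + int n))"
  have "Q (b0 + int (nat (b1 - b0)))" using assms(2) low[of b1] by (cases "b1 < b0") auto
  then have n: "Q (b0 + int n)" unfolding n_def by (rule LeastI)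
  have "Q b \<longleftrightarrow> b0 + int n \<le> b" for b
  proof
    assume "b0 + int n \<le> b"
    then show "Q b" using up'[OF n, of "nat (b - (b0 + int n))"] by simp
  next
    assume Q: "Q b"
    then have b: "b0 \<le> b" using low[of b] by linarith
    with Q have "Q (b0 + int (nat (b - b0)))" by simp
    then have "n \<le> nat (b - b0)" unfolding n_def by (rule Least_le)
    with b show "b0 + int n \<le> b" by linarith
  qed
  then show ?thesis by blast
qed

text \<open>Blocks are open on the left and closed on the right, so the index of the block
  containing a is obtained by dividing \<open>a - 1\<close>, not a.\<close>

lemma pred_div_eq_iff: "(a - 1) div int p = int k \<longleftrightarrow> int (k * p) < a \<and> a \<le> int ((k + 1) * p)" if "p > 0"
proof
  assume eq: "(a - 1) div int p = int k"
  have "a - 1 = int p * int k + (a - 1) mod int p" unfolding eq[symmetric] by simp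
  moreover have "0 \<le> (a - 1) mod int p" "(a - 1) mod int p < int p" using that by simp_all
  ultimately show "int (k * p) < a \<and> a \<le> int ((k + 1) * p)" by (simp add: algebra_simps)
next
  assume "int (k * p) < a \<and> a \<le> int ((k + 1) * p)"
  then show "(a - 1) div int p = int k"
    by (intro int_div_pos_eq[of _ _ _ "a - 1 - int (k * p)"]) (auto simp: algebra_simps)
qed

text \<open>Here p stands for the point (p, s - p) of a chain. The condition on the coordinate
  measured from the end of the shorter chain is implied by the other one, so what is counted is a
  triangle with rows 1, ..., \<open>min s s'\<close>.\<close>

lemma card_strict_pairs:
  "(\<Sum>p\<le>s. \<Sum>p'\<le>s'. of_bool (p < p' \<and> s' - p' < s - p)) = (\<Sum>k<min s s'. k + 1 :: nat)"
proof -
  have triangle: "(\<Sum>p\<le>m. \<Sum>p'\<le>m'. of_bool (p < p')) = (\<Sum>k<m'. k + 1 :: nat)" if "m' \<le> m" for m m'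
  proof -
    have "(\<Sum>p\<le>m. of_bool (p < p')) = (if p' = 0 then 0 else p' :: nat)" if "p' \<le> m'" for p'
    proof -
      have "{..m} \<inter> {p. p < p'} = {..<p'}" using that \<open>m' \<le> m\<close> by auto
      then show ?thesis by (simp add: of_bool_def sum.If_cases)
    qed
    then have "(\<Sum>p\<le>m. \<Sum>p'\<le>m'. of_bool (p < p')) = (\<Sum>p'\<le>m'. p')"
      by (subst sum.swap) (intro sum.cong, auto)
    also have "\<dots> = (\<Sum>k<m'. k + 1)"
      by (simp add: sum.atMost_shift)
    finally show ?thesis .
  qed
  show ?thesis
  proof (cases "s' \<le> s")
    case True
    have "(\<Sum>p\<le>s. \<Sum>p'\<le>s'. of_bool (p < p' \<and> s' - p' < s - p)) = (\<Sum>p\<le>s. \<Sum>p'\<le>s'. of_bool (p < p') :: nat)"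
      using True by (intro sum.cong refl arg_cong[of _ _ of_bool]) auto
    then show ?thesis using triangle[OF True] True by (simp add: min_absorb2)
  next
    case False
    have rev: "(\<Sum>p\<le>m. h (m - p)) = (\<Sum>p\<le>m. h p)" for h :: "nat \<Rightarrow> nat" and m
      using sum.nat_diff_reindex[of h "Suc m"] by (simp add: lessThan_Suc_atMost)
    have "(\<Sum>p\<le>s. \<Sum>p'\<le>s'. of_bool (p < p' \<and> s' - p' < s - p)) = (\<Sum>p\<le>s. \<Sum>p'\<le>s'. of_bool (s' - p' < s - p) :: nat)"
      using False by (intro sum.cong refl arg_cong[of _ _ of_bool]) auto
    also have "\<dots> = (\<Sum>p\<le>s. \<Sum>p'\<le>s'. of_bool (p' < p))"
      using rev[of "\<lambda>p. \<Sum>p'\<le>s'. of_bool (s' - p' < p)" s] rev[of "\<lambda>p'. of_bool (p' < _)" s'] by simp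
    also have "\<dots> = (\<Sum>p'\<le>s'. \<Sum>p\<le>s. of_bool (p' < p))" by (rule sum.swap)
    finally show ?thesis using triangle[of s s'] False by (simp add: min_absorb1)
  qed
qed

text \<open>Lengthening both chains by one point and shifting \<open>p'\<close> by one turns weak
  inequalities into strict ones; the extra boundary terms vanish.\<close>

lemma card_weak_pairs:
  "(\<Sum>p\<le>s. \<Sum>p'\<le>s'. of_bool (p \<le> p' \<and> s' - p' \<le> s - p)) = (\<Sum>k<min (Suc s) (Suc s'). k + 1 :: nat)"
proof -
  have split: "(\<Sum>p\<le>Suc s. h p) = h 0 + (\<Sum>p\<le>s. h (Suc p))" for h :: "nat \<Rightarrow> nat" and s
    by (rule sum.atMost_Suc_shift)
  have "(\<Sum>p\<le>Suc s. \<Sum>p'\<le>Suc s'. of_bool (p < p' \<and> Suc s' - p' < Suc s - p)) =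
      (\<Sum>p\<le>s. \<Sum>p'\<le>s'. of_bool (p < Suc p' \<and> s' - p' < Suc s - p) :: nat)"
  proof -
    have "(\<Sum>p'\<le>Suc s'. of_bool (p < p' \<and> Suc s' - p' < Suc s - p)) =
        (\<Sum>p'\<le>s'. of_bool (p < Suc p' \<and> s' - p' < Suc s - p) :: nat)" for p
      unfolding split by simp
    then show ?thesis by simp
  qed
  also have "\<dots> = (\<Sum>p\<le>s. \<Sum>p'\<le>s'. of_bool (p \<le> p' \<and> s' - p' \<le> s - p))"
    by (intro sum.cong refl arg_cong[of _ _ of_bool]) auto
  finally show ?thesis unfolding card_strict_pairs by (rule sym)
qed

text \<open>The inner sum counts the \<open>r\<close> with \<open>v (sz r)\<close> above level k, so
  its square counts pairs for which the minimum exceeds k; then the sums are interchanged.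
  \<open>v\<close> is the identity for the strict sum and \<open>Suc\<close> for the weak
  one.\<close>

lemma Sum_any_squares:
  fixes sz :: "'r \<Rightarrow> nat" and v :: "nat \<Rightarrow> nat"
  assumes R: "finite R" and n: "\<And>k. n k = card {r \<in> R. sz r = k}"
  shows "Sum_any (\<lambda>k. (k + 1) * (Sum_any (\<lambda>j. if k < v j then n j else 0))\<^sup>2) =
    (\<Sum>r\<in>R. \<Sum>r'\<in>R. \<Sum>k<min (v (sz r)) (v (sz r')). k + 1)"
proof -
  define m where "m k = (\<Sum>r\<in>R. of_bool (k < v (sz r)) :: nat)" for k
  have inner: "Sum_any (\<lambda>j. if k < v j then n j else 0) = m k" for k
  proof -
    have "Sum_any (\<lambda>j. if k < v j then n j else 0) = (\<Sum>j\<in>sz ` R. if k < v j then n j else 0)"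
      using R by (intro Sum_any.expand_superset) (auto simp: n card_gt_0_iff)
    also have "\<dots> = (\<Sum>j\<in>sz ` R. \<Sum>r\<in>{r \<in> R. sz r = j}. of_bool (k < v (sz r)))"
      by (intro sum.cong refl) (simp add: n)
    also have "\<dots> = m k"
      unfolding m_def by (rule sum.image_gen[OF R, symmetric])
    finally show ?thesis .
  qed
  \<comment> \<open>\<open>Sum_any\<close> defaults to 0 on functions with infinite support, so a
    finite range outside which \<open>m\<close> vanishes is needed.\<close>
  define M where "M = Suc (\<Sum>r\<in>R. v (sz r))"
  have M: "v (sz r) \<le> M" if "r \<in> R" for r
    using member_le_sum[of r R "\<lambda>r. v (sz r)"] that R unfolding M_def by simp
  have "m k = 0" if "k \<ge> M" for k
    unfolding m_def by (rule sum.neutral) (use M that in fastforce)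
  then have m_bound: "k < M" if "m k \<noteq> 0" for k using that not_less by blast
  have "Sum_any (\<lambda>k. (k + 1) * (m k)\<^sup>2) = (\<Sum>k<M. (k + 1) * (m k)\<^sup>2)"
    by (intro Sum_any.expand_superset) (use m_bound in force)+
  also have "\<dots> = (\<Sum>k<M. \<Sum>r\<in>R. \<Sum>r'\<in>R. (k + 1) * of_bool (k < min (v (sz r)) (v (sz r'))))"
    unfolding m_def power2_eq_square sum_product
    by (simp add: sum_distrib_left flip: of_bool_conj)
  also have "\<dots> = (\<Sum>r\<in>R. \<Sum>r'\<in>R. \<Sum>k<M. (k + 1) * of_bool (k < min (v (sz r)) (v (sz r'))))"
    by (subst sum.swap, intro sum.cong refl sum.swap)
  also have "\<dots> = (\<Sum>r\<in>R. \<Sum>r'\<in>R. \<Sum>k<min (v (sz r)) (v (sz r')). k + 1)"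
  proof (rule sum.cong[OF refl], rule sum.cong[OF refl])
    fix r r' assume "r \<in> R" "r' \<in> R"
    then have le: "min (v (sz r)) (v (sz r')) \<le> M" using M[of r] by linarith
    show "(\<Sum>k<M. (k + 1) * of_bool (k < min (v (sz r)) (v (sz r')))) = (\<Sum>k<min (v (sz r)) (v (sz r')). k + 1)"
      by (rule sum.mono_neutral_cong_right) (use le in auto)
  qed
  finally show ?thesis unfolding inner .
qed

text \<open>Only the following properties of \<open>l a b = \<ell>(a P\<^sub>1 + b P\<^sub>2)\<close> matter. For every \<open>a\<close> there is an
  integer \<open>T a\<close> such that a function in \<open>L(a P\<^sub>1 + b P\<^sub>2)\<close> with pole order exactly \<open>a\<close> at \<open>P\<^sub>1\<close> exists
  if and only if \<open>T a \<le> b\<close>. On the gaps of \<open>P\<^sub>1\<close>, \<open>T\<close> is the map \<open>\<tau>\<close>.\<close>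

locale ell_function =
  fixes l :: "int \<Rightarrow> int \<Rightarrow> int" and g c :: int and \<pi> :: nat
  assumes step1: "l (a - 1) b \<le> l a b" "l a b \<le> l (a - 1) b + 1"
    and step2: "l a (b - 1) \<le> l a b" "l a b \<le> l a (b - 1) + 1"
    and supermodular: "l a b - l (a - 1) b \<le> l a (b + 1) - l (a - 1) (b + 1)"
    and negative: "a + b < 0 \<Longrightarrow> l a b = 0"
    and large: "c \<le> a + b \<Longrightarrow> l a b = a + b + 1 - g"
    and origin: "l 0 0 = 1"
    and \<pi>_pos: "\<pi> > 0"
    and periodic: "l (a + int \<pi>) (b - int \<pi>) = l a b"
begin

definition T :: "int \<Rightarrow> int" where
  "T a = (SOME t. \<forall>b. l a b \<noteq> l (a - 1) b \<longleftrightarrow> t \<le> b)"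

definition U :: "int \<Rightarrow> int" where
  "U b = (SOME t. \<forall>a. l a b \<noteq> l a (b - 1) \<longleftrightarrow> t \<le> a)"

text \<open>The jump \<open>l a b - l (a - 1) b\<close> is 0 or 1, does not decrease with
  \<open>b\<close>, vanishes for \<open>a + b < 0\<close> and equals 1 for large \<open>b\<close>;
  hence there is a threshold.\<close>

lemma T_le_iff: "T a \<le> b \<longleftrightarrow> l a b \<noteq> l (a - 1) b"
proof -
  have "\<exists>t. \<forall>b. l a b \<noteq> l (a - 1) b \<longleftrightarrow> t \<le> b"
  proof (rule int_least_upward)
    show "l a (b + 1) \<noteq> l (a - 1) (b + 1)" if "l a b \<noteq> l (a - 1) b" for b
      using that step1[of a b] supermodular[of a b] by linarith
    show "l a (c - a + 1) \<noteq> l (a - 1) (c - a + 1)"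
      using large[of a "c - a + 1"] large[of "a - 1" "c - a + 1"] by simp
    show "\<not> l a b \<noteq> l (a - 1) b" if "b < - a" for b
      using that negative[of a b] negative[of "a - 1" b] by simp
  qed
  from someI_ex[OF this] show ?thesis unfolding T_def by blast
qed

lemma U_le_iff: "U b \<le> a \<longleftrightarrow> l a b \<noteq> l a (b - 1)"
proof -
  have "\<exists>t. \<forall>a. l a b \<noteq> l a (b - 1) \<longleftrightarrow> t \<le> a"
  proof (rule int_least_upward)
    \<comment> \<open>Supermodularity says that a mixed second difference is nonnegative, which is
      symmetric in the two variables.\<close>
    show "l (a + 1) b \<noteq> l (a + 1) (b - 1)" if "l a b \<noteq> l a (b - 1)" for a
      using that step2[of a b] supermodular[of "a + 1" "b - 1"] by simp
    show "l (c - b + 1) b \<noteq> l (c - b + 1) (b - 1)"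
      using large[of "c - b + 1" b] large[of "c - b + 1" "b - 1"] by simp
    show "\<not> l a b \<noteq> l a (b - 1)" if "a < - b" for a
      using that negative[of a b] negative[of a "b - 1"] by simp
  qed
  from someI_ex[OF this] show ?thesis unfolding U_def by blast
qed

text \<open>In the unit square with upper corner \<open>(a, T a)\<close> the step in the first
  variable is 1 on the upper side and 0 on the lower side. As all steps are 0 or 1, the step in the
  second variable is 1 at \<open>a\<close> and 0 at \<open>a - 1\<close>, so the threshold
  \<open>U\<close> is met exactly at \<open>a\<close>.\<close>

lemma U_T [simp]: "U (T a) = a"
proof (rule antisym)
  let ?b = "T a"
  have ne: "l a ?b \<noteq> l (a - 1) ?b" and eq: "l a (?b - 1) = l (a - 1) (?b - 1)"
    using T_le_iff[of a ?b] T_le_iff[of a "?b - 1"] by auto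
  show "U ?b \<le> a" unfolding U_le_iff
    using ne eq step1[of a ?b] step2[of "a - 1" ?b] by linarith
  have "\<not> U ?b \<le> a - 1" unfolding U_le_iff
    using ne eq step1[of a ?b] step2[of a ?b] step2[of "a - 1" ?b] by linarith
  then show "a \<le> U ?b" by simp
qed

lemma T_U [simp]: "T (U b) = b"
proof (rule antisym)
  let ?a = "U b"
  have ne: "l ?a b \<noteq> l ?a (b - 1)" and eq: "l (?a - 1) b = l (?a - 1) (b - 1)"
    using U_le_iff[of b ?a] U_le_iff[of b "?a - 1"] by auto
  show "T ?a \<le> b" unfolding T_le_iff
    using ne eq step2[of ?a b] step1[of ?a "b - 1"] by linarith
  have "\<not> T ?a \<le> b - 1" unfolding T_le_iff
    using ne eq step2[of ?a b] step1[of ?a b] step1[of ?a "b - 1"] by linarith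
  then show "b \<le> T ?a" by simp
qed

lemma T_0: "T 0 = 0"
proof (rule antisym)
  show "T 0 \<le> 0" unfolding T_le_iff using origin negative[of "-1" 0] by simp
  have "\<not> T 0 \<le> - 1" unfolding T_le_iff using negative[of 0 "-1"] negative[of "-1" "-1"] by simp
  then show "0 \<le> T 0" by simp
qed

lemma T_shift: "T (a + int \<pi>) = T a - int \<pi>"
proof -
  have "T (a + int \<pi>) \<le> b \<longleftrightarrow> T a - int \<pi> \<le> b" for b
  proof -
    have "T a - int \<pi> \<le> b \<longleftrightarrow> T a \<le> b + int \<pi>" by linarith
    then show ?thesis
      unfolding T_le_iff using periodic[of a "b + int \<pi>"] periodic[of "a - 1" "b + int \<pi>"]
      by (simp add: algebra_simps)
  qed
  then show ?thesis by (meson antisym order_refl)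
qed

lemma T_shift_mult: "T (a + int \<pi> * int k) = T a - int \<pi> * int k"
proof (induction k)
  case (Suc k)
  have eq: "a + int \<pi> * int (Suc k) = (a + int \<pi> * int k) + int \<pi>" by (simp add: algebra_simps)
  show ?case unfolding eq T_shift Suc.IH by (simp add: algebra_simps)
qed simp

text \<open>\<open>T a \<le> 0\<close> means that some function has pole order exactly
  \<open>a\<close> at the first place and no other pole. The gaps are thus the positive
  \<open>a\<close> with \<open>T a > 0\<close>.\<close>

definition gap_set :: "int set" where
  "gap_set = {a. a > 0 \<and> T a > 0}"

lemma T_le_of_large: "c < a + b \<Longrightarrow> T a \<le> b"
  unfolding T_le_iff using large[of a b] large[of "a - 1" b] by simp

lemma gap_set_subset: "gap_set \<subseteq> {1..c}"
proof
  fix a assume "a \<in> gap_set"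
  then have "\<not> c < a" "a > 0" using T_le_of_large[of a 0] by (auto simp: gap_set_def)
  then show "a \<in> {1..c}" by simp
qed

lemma finite_gap_set: "finite gap_set"
  using gap_set_subset by (rule finite_subset) simp

text \<open>Going up from \<open>l 0 0 = 1\<close>, each \<open>a\<close> that is not a gap adds one
  to the dimension \<open>l n 0\<close>; beyond \<open>c\<close> that dimension is
  \<open>n + 1 - g\<close>.\<close>

lemma card_gap_set: "int (card gap_set) = g"
proof -
  have l_eq: "l (int n) 0 = 1 + int n - int (card {a \<in> {1..int n}. T a > 0})" for n
  proof (induction n)
    case (Suc n)
    let ?A = "{a \<in> {1..int n}. T a > 0}"
    have "{1..int (Suc n)} = insert (int (Suc n)) {1..int n}" by auto
    then have set_eq: "{a \<in> {1..int (Suc n)}. T a > 0} =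
        (if T (int (Suc n)) > 0 then insert (int (Suc n)) ?A else ?A)" by auto
    have step: "l (int (Suc n)) 0 = l (int n) 0 + (if T (int (Suc n)) > 0 then 0 else 1)"
      using T_le_iff[of "int (Suc n)" 0] step1[of "int (Suc n)" 0] by auto
    have "int (Suc n) \<notin> ?A" by simp
    moreover have "finite ?A" by (rule finite_subset[of _ "{1..int n}"]) auto
    ultimately
    show ?case using Suc step unfolding set_eq by simp
  qed (simp add: origin)
  define n where "n = nat c"
  have "{a \<in> {1..int n}. T a > 0} = gap_set"
    using gap_set_subset by (auto simp: gap_set_def n_def)
  then show ?thesis using l_eq[of n] large[of "int n" 0] by (simp add: n_def)
qed

text \<open>The indices of the block containing the point \<open>(a, T a)\<close>. Both are
  nonnegative exactly when \<open>a\<close> is a gap.\<close>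

definition row :: "int \<Rightarrow> int" where "row a = (a - 1) div int \<pi>"
definition col :: "int \<Rightarrow> int" where "col a = (T a - 1) div int \<pi>"

lemma div_nonneg_iff: "0 \<le> (a - 1) div int \<pi> \<longleftrightarrow> a > 0"
  using \<pi>_pos pos_imp_zdiv_nonneg_iff[of "int \<pi>" "a - 1"] by auto

lemma gap_set_iff: "a \<in> gap_set \<longleftrightarrow> row a \<ge> 0 \<and> col a \<ge> 0"
  unfolding gap_set_def row_def col_def div_nonneg_iff by simp

text \<open>One representative for each residue class modulo the period that contains a gap. Moving
  by one period raises the row by 1 and lowers the column by 1, so the gaps in the class of
  \<open>r\<close> are \<open>elt (r, p)\<close> for \<open>p \<le> len r\<close>, with constant sum
  of row and column.\<close>

definition reps :: "int set" where
  "reps = {r \<in> {1..int \<pi>}. col r \<ge> 0}"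

definition len :: "int \<Rightarrow> nat" where
  "len r = nat (col r)"

definition elt :: "int \<times> nat \<Rightarrow> int" where
  "elt = (\<lambda>(r, p). r + int \<pi> * int p)"

lemma
  assumes "r \<in> {1..int \<pi>}"
  shows row_elt: "row (elt (r, p)) = int p"
    and col_elt: "col (elt (r, p)) = col r - int p"
proof -
  have r: "(r - 1) div int \<pi> = 0" using assms by (simp add: div_pos_pos_trivial)
  have "row (elt (r, p)) = (r - 1 + int p * int \<pi>) div int \<pi>"
    by (simp add: row_def elt_def algebra_simps)
  also have "\<dots> = int p + (r - 1) div int \<pi>" using \<pi>_pos by (subst div_mult_self1) auto
  finally show "row (elt (r, p)) = int p" using r by simp
  have "col (elt (r, p)) = (T r - 1 + (- int p) * int \<pi>) div int \<pi>"
    by (simp add: col_def elt_def T_shift_mult algebra_simps)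
  also have "\<dots> = - int p + (T r - 1) div int \<pi>" using \<pi>_pos by (subst div_mult_self1) auto
  finally show "col (elt (r, p)) = col r - int p" by (simp add: col_def)
qed

lemma elt_surj: "\<exists>r\<in>{1..int \<pi>}. row a \<ge> 0 \<longrightarrow> a = elt (r, nat (row a))"
proof
  define r where "r = (a - 1) mod int \<pi> + 1"
  have "0 \<le> (a - 1) mod int \<pi>" "(a - 1) mod int \<pi> < int \<pi>" using \<pi>_pos by simp_all
  then show "r \<in> {1..int \<pi>}" by (simp add: r_def)
  have "a = r + int \<pi> * row a"
    using mult_div_mod_eq[of "int \<pi>" "a - 1"] by (simp add: r_def row_def)
  then show "row a \<ge> 0 \<longrightarrow> a = elt (r, nat (row a))" by (simp add: elt_def)
qed

lemma finite_reps: "finite reps"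
  unfolding reps_def by (rule finite_subset[of _ "{1..int \<pi>}"]) auto

abbreviation "points \<equiv> Sigma reps (\<lambda>r. {..len r})"

lemma points_D: "(r, p) \<in> points \<Longrightarrow> r \<in> {1..int \<pi>} \<and> col r \<ge> 0 \<and> int (len r) = col r \<and> p \<le> len r"
  by (auto simp: reps_def len_def)

lemma bij_elt: "bij_betw elt points gap_set"
proof (rule bij_betw_imageI)
  show "inj_on elt points"
  proof (rule inj_onI)
    fix x y assume xy: "x \<in> points" "y \<in> points" "elt x = elt y"
    obtain r p r' p' where [simp]: "x = (r, p)" "y = (r', p')" by (cases x, cases y)
    have "int p = int p'"
      using row_elt[of r p] row_elt[of r' p'] points_D[of r p] points_D[of r' p'] xy by simp
    then show "x = y" using xy(3) by (simp add: elt_def)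
  qed
  show "elt ` points = gap_set"
  proof (intro equalityI subsetI)
    fix a assume "a \<in> elt ` points"
    then obtain r p where a: "a = elt (r, p)" "(r, p) \<in> points" by auto
    then show "a \<in> gap_set"
      using row_elt[of r p] col_elt[of r p] points_D[OF a(2)] by (simp add: gap_set_iff)
  next
    fix a assume "a \<in> gap_set"
    then have a: "row a \<ge> 0" "col a \<ge> 0" by (simp_all add: gap_set_iff)
    obtain r where r: "r \<in> {1..int \<pi>}" "a = elt (r, nat (row a))" using elt_surj[of a] a(1) by blast
    have "col a = col r - int (nat (row a))" using col_elt[OF r(1), of "nat (row a)"] r(2) by simp
    then have "col r \<ge> 0" "nat (row a) \<le> len r" using a by (auto simp: len_def)
    then have "(r, nat (row a)) \<in> points" using r(1) by (simp add: reps_def)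
    with r(2) show "a \<in> elt ` points" by blast
  qed
qed

text \<open>Only the last point of a chain has column 0, and its row is the parameter
  \<open>len r\<close>. The blocks with second index 0 therefore record how many chains there are of
  each length.\<close>

lemma card_first_block: "card {a \<in> gap_set. row a = int k \<and> col a = 0} = card {r \<in> reps. len r = k}"
proof -
  have "bij_betw (\<lambda>r. elt (r, k)) {r \<in> reps. len r = k} {a \<in> gap_set. row a = int k \<and> col a = 0}"
  proof (rule bij_betw_imageI)
    show "inj_on (\<lambda>r. elt (r, k)) {r \<in> reps. len r = k}" by (rule inj_onI) (simp add: elt_def)
    show "(\<lambda>r. elt (r, k)) ` {r \<in> reps. len r = k} = {a \<in> gap_set. row a = int k \<and> col a = 0}"
    proof (intro equalityI subsetI)
      fix a assume "a \<in> (\<lambda>r. elt (r, k)) ` {r \<in> reps. len r = k}"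
      then obtain r where r: "r \<in> reps" "len r = k" "a = elt (r, k)" by blast
      then have "r \<in> {1..int \<pi>}" "col r = int k" by (auto simp: reps_def len_def)
      then show "a \<in> {a \<in> gap_set. row a = int k \<and> col a = 0}"
        using r(3) row_elt[of r k] col_elt[of r k] by (simp add: gap_set_iff)
    next
      fix a assume "a \<in> {a \<in> gap_set. row a = int k \<and> col a = 0}"
      then have a: "row a = int k" "col a = 0" by simp_all
      obtain r where r: "r \<in> {1..int \<pi>}" "a = elt (r, k)" using elt_surj[of a] a(1) by auto
      then have "col r = int k" using col_elt[OF r(1), of k] a(2) by simp
      then show "a \<in> (\<lambda>r. elt (r, k)) ` {r \<in> reps. len r = k}"
        using r by (auto simp: reps_def len_def)
    qed
  qed
  then show ?thesis by (rule bij_betw_same_card[symmetric])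
qed

text \<open>Pairs of gaps are sorted by their pair of chains; \<open>Q\<close> stays arbitrary so
  that strict and weak inversion of blocks are covered together.\<close>

lemma card_pairs:
  "card {(a, a') \<in> gap_set \<times> gap_set. Q (row a) (col a) (row a') (col a')} =
    (\<Sum>r\<in>reps. \<Sum>r'\<in>reps. \<Sum>p\<le>len r. \<Sum>p'\<le>len r'.
      of_bool (Q (int p) (int (len r) - int p) (int p') (int (len r') - int p')))"
proof -
  have Sigma_sum: "(\<Sum>x\<in>points. h x) = (\<Sum>r\<in>reps. \<Sum>p\<le>len r. h (r, p))" for h :: "_ \<Rightarrow> nat"
    by (subst sum.Sigma) (auto simp: finite_reps case_prod_unfold)
  let ?q = "\<lambda>x y. of_bool (Q (row (elt x)) (col (elt x)) (row (elt y)) (col (elt y))) :: nat"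
  have "card {(a, a') \<in> gap_set \<times> gap_set. Q (row a) (col a) (row a') (col a')} =
      (\<Sum>aa\<in>gap_set \<times> gap_set. of_bool (Q (row (fst aa)) (col (fst aa)) (row (snd aa)) (col (snd aa))))"
  proof -
    have "{(a, a') \<in> gap_set \<times> gap_set. Q (row a) (col a) (row a') (col a')} =
        (gap_set \<times> gap_set) \<inter> {aa. Q (row (fst aa)) (col (fst aa)) (row (snd aa)) (col (snd aa))}" by auto
    then show ?thesis using finite_gap_set by (simp add: of_bool_def sum.If_cases)
  qed
  also have "\<dots> = (\<Sum>a\<in>gap_set. \<Sum>a'\<in>gap_set. of_bool (Q (row a) (col a) (row a') (col a')))"
    by (simp add: sum.cartesian_product case_prod_unfold)
  also have "\<dots> = (\<Sum>x\<in>points. \<Sum>y\<in>points. ?q x y)"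
    by (simp add: sum.reindex_bij_betw[OF bij_elt, symmetric])
  also have "\<dots> = (\<Sum>r\<in>reps. \<Sum>p\<le>len r. \<Sum>r'\<in>reps. \<Sum>p'\<le>len r'. ?q (r, p) (r', p'))"
    unfolding Sigma_sum ..
  also have "\<dots> = (\<Sum>r\<in>reps. \<Sum>r'\<in>reps. \<Sum>p\<le>len r. \<Sum>p'\<le>len r'. ?q (r, p) (r', p'))"
    by (intro sum.cong refl sum.swap)
  also have "\<dots> = (\<Sum>r\<in>reps. \<Sum>r'\<in>reps. \<Sum>p\<le>len r. \<Sum>p'\<le>len r'.
      of_bool (Q (int p) (int (len r) - int p) (int p') (int (len r') - int p')))"
    by (intro sum.cong refl) (auto simp: reps_def row_elt col_elt len_def)
  finally show ?thesis .
qed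

section \<open>Inversions compared with the two block sums\<close>

definition inversions :: "(int \<times> int) set" where
  "inversions = {(a, a') \<in> gap_set \<times> gap_set. a < a' \<and> T a' < T a}"

lemma finite_inversions: "finite inversions"
  by (rule finite_subset[of _ "gap_set \<times> gap_set"]) (auto simp: inversions_def finite_gap_set)

lemma strict_block_sum_le:
  assumes n: "\<And>k. n k = card {a \<in> gap_set. row a = int k \<and> col a = 0}"
  shows "Sum_any (\<lambda>k. (k + 1) * (Sum_any (\<lambda>j. if k < j then n j else 0))\<^sup>2) \<le> card inversions"
proof -
  have "n k = card {r \<in> reps. len r = k}" for k using n card_first_block by simp
  then have "Sum_any (\<lambda>k. (k + 1) * (Sum_any (\<lambda>j. if k < j then n j else 0))\<^sup>2) =
      (\<Sum>r\<in>reps. \<Sum>r'\<in>reps. \<Sum>k<min (len r) (len r'). k + 1)"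
    using Sum_any_squares[OF finite_reps, of n len "\<lambda>j. j"] by simp
  also have "\<dots> = (\<Sum>r\<in>reps. \<Sum>r'\<in>reps. \<Sum>p\<le>len r. \<Sum>p'\<le>len r'. of_bool (p < p' \<and> len r' - p' < len r - p))"
    by (simp only: card_strict_pairs)
  also have "\<dots> = card {(a, a') \<in> gap_set \<times> gap_set. row a < row a' \<and> col a' < col a}"
    unfolding card_pairs[where Q = "\<lambda>i j i' j'. i < i' \<and> j' < j"]
    by (intro sum.cong refl arg_cong[of _ _ of_bool]) auto
  also have "\<dots> \<le> card inversions"
  proof (rule card_mono[OF finite_inversions], clarify)
    fix a a' assume a: "a \<in> gap_set" "a' \<in> gap_set" "row a < row a'" "col a' < col a"
    have "a < a'"
    proof (rule ccontr)
      assume "\<not> a < a'"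
      then show False using a(3) zdiv_mono1[of "a' - 1" "a - 1" "int \<pi>"] \<pi>_pos by (simp add: row_def)
    qed
    moreover have "T a' < T a"
    proof (rule ccontr)
      assume "\<not> T a' < T a"
      then show False using a(4) zdiv_mono1[of "T a - 1" "T a' - 1" "int \<pi>"] \<pi>_pos by (simp add: col_def)
    qed
    ultimately show "(a, a') \<in> inversions" using a by (simp add: inversions_def)
  qed
  finally show ?thesis .
qed

lemma le_weak_block_sum:
  assumes n: "\<And>k. n k = card {a \<in> gap_set. row a = int k \<and> col a = 0}"
  shows "int (card inversions) + g \<le> int (Sum_any (\<lambda>k. (k + 1) * (Sum_any (\<lambda>j. if k \<le> j then n j else 0))\<^sup>2))"
proof -
  let ?W = "{(a, a') \<in> gap_set \<times> gap_set. row a \<le> row a' \<and> col a' \<le> col a}"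
  have "n k = card {r \<in> reps. len r = k}" for k using n card_first_block by simp
  then have "Sum_any (\<lambda>k. (k + 1) * (Sum_any (\<lambda>j. if k \<le> j then n j else 0))\<^sup>2) =
      (\<Sum>r\<in>reps. \<Sum>r'\<in>reps. \<Sum>k<min (Suc (len r)) (Suc (len r')). k + 1)"
    using Sum_any_squares[OF finite_reps, of n len Suc] by (simp only: less_Suc_eq_le)
  also have "\<dots> = (\<Sum>r\<in>reps. \<Sum>r'\<in>reps. \<Sum>p\<le>len r. \<Sum>p'\<le>len r'. of_bool (p \<le> p' \<and> len r' - p' \<le> len r - p))"
    by (simp only: card_weak_pairs)
  also have "\<dots> = card ?W"
    unfolding card_pairs[where Q = "\<lambda>i j i' j'. i \<le> i' \<and> j' \<le> j"]
    by (intro sum.cong refl arg_cong[of _ _ of_bool]) auto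
  finally have W: "Sum_any (\<lambda>k. (k + 1) * (Sum_any (\<lambda>j. if k \<le> j then n j else 0))\<^sup>2) = card ?W" .
  let ?\<Delta> = "(\<lambda>a. (a, a)) ` gap_set"
  have "finite ?W" by (rule finite_subset[of _ "gap_set \<times> gap_set"]) (auto simp: finite_gap_set)
  moreover have "inversions \<union> ?\<Delta> \<subseteq> ?W"
    using \<pi>_pos by (auto simp: inversions_def row_def col_def intro!: zdiv_mono1)
  ultimately have "card (inversions \<union> ?\<Delta>) \<le> card ?W" by (rule card_mono)
  moreover have "card (inversions \<union> ?\<Delta>) = card inversions + card gap_set"
    using finite_inversions finite_gap_set
    by (subst card_Un_disjoint) (auto simp: inversions_def card_image inj_on_def)
  ultimately show ?thesis using W card_gap_set by linarith
qed

text \<open>An inversion \<open>(a, a')\<close> corresponds to the pair \<open>(a, T a')\<close>: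
  since \<open>U\<close> inverts \<open>T\<close>, the condition \<open>a < a'\<close> becomes
  \<open>U t > s\<close> for \<open>t = T a'\<close>, and \<open>T a' < T a\<close> becomes
  \<open>T s > t\<close>.\<close>

lemma bij_inversions:
  "bij_betw (\<lambda>(a, a'). (nat a, nat (T a'))) inversions {(s, t). T (int s) > int t \<and> U (int t) > int s}"
proof (rule bij_betw_imageI)
  show "inj_on (\<lambda>(a, a'). (nat a, nat (T a'))) inversions"
  proof (rule inj_onI, clarify)
    fix a a' b b' assume *: "(a, a') \<in> inversions" "(b, b') \<in> inversions" "nat a = nat b" "nat (T a') = nat (T b')"
    then have "a = b" "T a' = T b'" by (auto simp: inversions_def gap_set_def)
    then show "a = b \<and> a' = b'" using U_T by metis
  qed
  show "(\<lambda>(a, a'). (nat a, nat (T a'))) ` inversions = {(s, t). T (int s) > int t \<and> U (int t) > int s}"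
  proof (intro equalityI subsetI)
    fix x assume "x \<in> (\<lambda>(a, a'). (nat a, nat (T a'))) ` inversions"
    then show "x \<in> {(s, t). T (int s) > int t \<and> U (int t) > int s}"
      by (auto simp: inversions_def gap_set_def)
  next
    fix x assume "x \<in> {(s, t). T (int s) > int t \<and> U (int t) > int s}"
    then obtain s t where x: "x = (s, t)" "T (int s) > int t" "U (int t) > int s" by blast
    \<comment> \<open>Both coordinates are positive because \<open>T\<close> and \<open>U\<close>
      vanish at 0; this is what places \<open>s\<close> and \<open>U t\<close> in
      \<open>gap_set\<close>.\<close>
    have "s \<noteq> 0" using x(2) T_0 by (metis less_le_not_le of_nat_0 of_nat_0_le_iff)
    moreover have "t \<noteq> 0" using x(3) T_0 U_T[of 0] by (metis less_le_not_le of_nat_0 of_nat_0_le_iff)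
    ultimately have "(int s, U (int t)) \<in> inversions" using x by (simp add: inversions_def gap_set_def)
    moreover have "x = (\<lambda>(a, a'). (nat a, nat (T a'))) (int s, U (int t))" using x(1) by simp
    ultimately show "x \<in> (\<lambda>(a, a'). (nat a, nat (T a'))) ` inversions" by blast
  qed
qed

end

subsection \<open>Pure gaps at two places\<close>

text \<open>The bound \<open>c\<close> and the existence of a period are assumptions here. Riemann's
  theorem supplies the first, and the Frobenius argument supplies the second when K is the closure
  of a finite field.\<close>

locale two_places = alg_closed_function_field \<iota>
  for \<iota> :: "'k::alg_closed_field \<Rightarrow> 'f::field" +
  fixes P\<^sub>1 P\<^sub>2 :: "'f set" and c :: int
  assumes P1: "is_place \<iota> P\<^sub>1" and P2: "is_place \<iota> P\<^sub>2" and ne: "P\<^sub>1 \<noteq> P\<^sub>2"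
    and riemann: "divisor \<iota> D \<Longrightarrow> c \<le> dg D \<Longrightarrow> int (ell \<iota> D) = dg D + 1 - genus \<iota>"
    and ex_period: "\<exists>k>0. \<exists>z. z \<noteq> 0 \<and> two_point_divisor P\<^sub>1 P\<^sub>2 (int k) (- int k) = principal_divisor \<iota> z"
begin

abbreviation tp :: "int \<Rightarrow> int \<Rightarrow> 'f set \<Rightarrow> int" where
  "tp \<equiv> two_point_divisor P\<^sub>1 P\<^sub>2"

lemmas divisor_tp = divisor_two_point[OF P1 P2 ne]
lemmas dg_tp = dg_two_point[OF P1 P2 ne]

definition l :: "int \<Rightarrow> int \<Rightarrow> int" where
  "l a b = int (ell \<iota> (tp a b))"

lemma tp_mono: "a \<le> a' \<Longrightarrow> b \<le> b' \<Longrightarrow> tp a b P \<le> tp a' b' P"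
  by (simp add: two_point_divisor_def point_divisor_def)

lemma L_tp_iff: "z \<in> L (tp a b) \<longleftrightarrow> val_ge P\<^sub>1 (- a) z \<and> val_ge P\<^sub>2 (- b) z \<and>
    (\<forall>Q. is_place \<iota> Q \<longrightarrow> Q \<noteq> P\<^sub>1 \<longrightarrow> Q \<noteq> P\<^sub>2 \<longrightarrow> val_ge Q 0 z)"
  (is "_ \<longleftrightarrow> ?r")
proof
  assume "z \<in> L (tp a b)"
  then have *: "val_ge Q (- tp a b Q) z" if "is_place \<iota> Q" for Q using that by (simp add: L_iff)
  have "val_ge Q 0 z" if "is_place \<iota> Q" "Q \<noteq> P\<^sub>1" "Q \<noteq> P\<^sub>2" for Q
    using *[OF that(1)] two_point_simps(3)[OF that(2,3), of a b] by simp
  then show ?r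
    using *[OF P1] *[OF P2] two_point_simps(1)[OF ne, of a b] two_point_simps(2)[OF ne, of a b] by simp
next
  assume r: ?r
  show "z \<in> L (tp a b)"
    unfolding L_iff
  proof (intro allI impI)
    fix Q assume Q: "is_place \<iota> Q"
    consider "Q = P\<^sub>1" | "Q = P\<^sub>2" | "Q \<noteq> P\<^sub>1" "Q \<noteq> P\<^sub>2" by blast
    then show "val_ge Q (- tp a b Q) z"
    proof cases
      case 3
      then show ?thesis using r Q two_point_simps(3)[OF 3, of a b] by simp
    qed (use r two_point_simps(1)[OF ne, of a b] two_point_simps(2)[OF ne, of a b] in simp_all)
  qed
qed

lemma l_step:
  "a \<le> a' \<Longrightarrow> b \<le> b' \<Longrightarrow> l a b \<le> l a' b' \<and> l a' b' \<le> l a b + (a' - a) + (b' - b)"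
  using ell_mono[OF divisor_tp divisor_tp tp_mono] ell_le_add[OF divisor_tp divisor_tp tp_mono]
  unfolding l_def dg_tp by fastforce

text \<open>Nested finite-dimensional spaces have equal dimension only if they coincide, and an
  element of the difference must have the extremal order at the first place.\<close>

lemma l_ne_iff: "l a b \<noteq> l (a - 1) b \<longleftrightarrow> (\<exists>z. z \<noteq> 0 \<and> z \<in> L (tp a b) \<and> place_val P\<^sub>1 z = - a)"
proof -
  have sub: "L (tp (a - 1) b) \<subseteq> L (tp a b)" by (rule L_mono, rule tp_mono) auto
  have "l a b = l (a - 1) b \<longleftrightarrow> L (tp (a - 1) b) = L (tp a b)"
    using dim_eq_imp_eq[OF fin_dim_L[OF divisor_tp] sub subspace_L] by (auto simp: l_def ell_eq_dim)
  also have "\<dots> \<longleftrightarrow> (\<forall>z. z \<in> L (tp a b) \<longrightarrow> val_ge P\<^sub>1 (1 - a) z)"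
  proof -
    have "z \<in> L (tp (a - 1) b) \<longleftrightarrow> val_ge P\<^sub>1 (1 - a) z" if "z \<in> L (tp a b)" for z
      using that unfolding L_tp_iff by simp
    with sub show ?thesis by blast
  qed
  also have "\<dots> \<longleftrightarrow> \<not> (\<exists>z. z \<noteq> 0 \<and> z \<in> L (tp a b) \<and> place_val P\<^sub>1 z = - a)"
  proof -
    have "val_ge P\<^sub>1 (1 - a) z \<longleftrightarrow> \<not> (z \<noteq> 0 \<and> place_val P\<^sub>1 z = - a)" if "z \<in> L (tp a b)" for z
    proof -
      have "val_ge P\<^sub>1 (- a) z" using that unfolding L_tp_iff by blast
      then show ?thesis unfolding val_ge_def by linarith
    qed
    then show ?thesis by blast
  qed
  finally show ?thesis by blast
qed

lemma period_spec:
  "period \<iota> P\<^sub>1 P\<^sub>2 > 0"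
  "\<exists>z. z \<noteq> 0 \<and> tp (int (period \<iota> P\<^sub>1 P\<^sub>2)) (- int (period \<iota> P\<^sub>1 P\<^sub>2)) = principal_divisor \<iota> z"
  using LeastI_ex[OF ex_period] unfolding period_def by blast+

lemma l_periodic: "l (a + int (period \<iota> P\<^sub>1 P\<^sub>2)) (b - int (period \<iota> P\<^sub>1 P\<^sub>2)) = l a b"
proof -
  let ?p = "int (period \<iota> P\<^sub>1 P\<^sub>2)"
  obtain z where z: "z \<noteq> 0" "tp ?p (- ?p) = principal_divisor \<iota> z" using period_spec(2) by blast
  have "principal_divisor \<iota> (inverse z) P = - tp ?p (- ?p) P" for P
    unfolding z(2) using z(1) by (simp add: principal_divisor_def place_val_inverse)
  then have "(\<lambda>P. tp a b P - principal_divisor \<iota> (inverse z) P) = tp (a + ?p) (b - ?p)"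
    by (simp add: fun_eq_iff two_point_divisor_def algebra_simps)
  moreover have "(\<lambda>P. tp (a + ?p) (b - ?p) P - principal_divisor \<iota> z P) = tp a b"
    unfolding z(2)[symmetric] by (simp add: fun_eq_iff two_point_divisor_def algebra_simps)
  ultimately show ?thesis
    using ell_diff_principal_le[OF divisor_tp, of z "a + ?p" "b - ?p"]
      ell_diff_principal_le[OF divisor_tp, of "inverse z" a b] z(1)
    by (simp add: l_def)
qed

sublocale ell_function l "genus \<iota>" c "period \<iota> P\<^sub>1 P\<^sub>2"
proof
  show "l (a - 1) b \<le> l a b" "l a b \<le> l (a - 1) b + 1" for a b using l_step[of "a - 1" a b b] by auto
  show "l a (b - 1) \<le> l a b" "l a b \<le> l a (b - 1) + 1" for a b using l_step[of a a "b - 1" b] by auto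
  show "l a b - l (a - 1) b \<le> l a (b + 1) - l (a - 1) (b + 1)" for a b
  proof (cases "l a b = l (a - 1) b")
    case False
    \<comment> \<open>A function that witnesses the jump at \<open>b\<close> also lies in the larger
      space for \<open>b + 1\<close>, with the same order at the first place.\<close>
    moreover have "L (tp a b) \<subseteq> L (tp a (b + 1))" by (rule L_mono, rule tp_mono) auto
    ultimately have "l a (b + 1) \<noteq> l (a - 1) (b + 1)" unfolding l_ne_iff by blast
    then show ?thesis using l_step[of "a - 1" a b b] l_step[of "a - 1" a "b + 1" "b + 1"] by linarith
  qed (use l_step[of "a - 1" a "b + 1" "b + 1"] in auto)
  show "l a b = 0" if "a + b < 0" for a b
    using L_negative[OF divisor_tp, of a b] that ell_pos_imp[of "tp a b"]
    by (auto simp: l_def dg_tp)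
  show "l a b = a + b + 1 - genus \<iota>" if "c \<le> a + b" for a b
    using riemann[OF divisor_tp, of a b] that by (simp add: l_def dg_tp)
  have "tp 0 0 = (\<lambda>_. 0)" by (simp add: fun_eq_iff two_point_divisor_def)
  then show "l 0 0 = 1" by (simp add: l_def ell_0)
qed (rule period_spec l_periodic)+

section \<open>Gaps, \<open>tau\<close> and pure gaps expressed through \<open>T\<close> and
  \<open>U\<close>\<close>

lemma pole_divisor_eq_tp_iff:
  "pole_divisor \<iota> z = tp (int s) (int t) \<longleftrightarrow>
    int s = max 0 (- place_val P\<^sub>1 z) \<and> int t = max 0 (- place_val P\<^sub>2 z) \<and>
    (\<forall>Q. is_place \<iota> Q \<longrightarrow> Q \<noteq> P\<^sub>1 \<longrightarrow> Q \<noteq> P\<^sub>2 \<longrightarrow> place_val Q z \<ge> 0)" (is "_ \<longleftrightarrow> ?r")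
proof
  assume eq: "pole_divisor \<iota> z = tp (int s) (int t)"
  have "place_val Q z \<ge> 0" if "is_place \<iota> Q" "Q \<noteq> P\<^sub>1" "Q \<noteq> P\<^sub>2" for Q
  proof -
    have "pole_divisor \<iota> z Q = 0" unfolding eq by (rule two_point_simps(3)[OF that(2,3)])
    then show ?thesis using that(1) by (simp add: pole_divisor_def split: if_splits)
  qed
  moreover have "pole_divisor \<iota> z P\<^sub>1 = int s" "pole_divisor \<iota> z P\<^sub>2 = int t" unfolding eq using ne by simp_all
  ultimately show ?r
    using P1 P2 by (simp add: pole_divisor_def max_def split: if_splits)
next
  assume r: ?r
  show "pole_divisor \<iota> z = tp (int s) (int t)"
  proof
    fix Q
    consider "Q = P\<^sub>1" | "Q = P\<^sub>2" | "Q \<noteq> P\<^sub>1" "Q \<noteq> P\<^sub>2" by blast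
    then show "pole_divisor \<iota> z Q = tp (int s) (int t) Q"
    proof cases
      case 3
      then show ?thesis using r by (force simp: pole_divisor_def)
    qed (use r ne P1 P2 in \<open>auto simp: pole_divisor_def\<close>)
  qed
qed

lemma T_le_iff_function: "T a \<le> b \<longleftrightarrow> (\<exists>z. z \<noteq> 0 \<and> place_val P\<^sub>1 z = - a \<and> place_val P\<^sub>2 z \<ge> - b \<and>
    (\<forall>Q. is_place \<iota> Q \<longrightarrow> Q \<noteq> P\<^sub>1 \<longrightarrow> Q \<noteq> P\<^sub>2 \<longrightarrow> place_val Q z \<ge> 0))"
  unfolding T_le_iff l_ne_iff L_tp_iff val_ge_def by auto

lemma gaps_iff: "s \<in> gaps \<iota> P\<^sub>1 \<longleftrightarrow> int s \<in> gap_set"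
\<comment> \<open>Zero is treated apart, since a function without a pole at the first place may have
  a zero there and its order is not determined by \<open>s\<close>.\<close>
proof (cases "s = 0")
  case True
  have "place_val Q 1 = 0" if "is_place \<iota> Q" for Q using place_val_emb[OF that, of 1] by simp
  then have "pole_divisor \<iota> 1 = (\<lambda>Q. int s * point_divisor P\<^sub>1 Q)"
    using True by (auto simp: pole_divisor_def fun_eq_iff)
  then have "s \<in> pole_numbers \<iota> P\<^sub>1" unfolding pole_numbers_def by (intro CollectI exI[of _ 1]) simp
  then show ?thesis using True by (simp add: gaps_def gap_set_def)
next
  case False
  have tp: "(\<lambda>Q. int s * point_divisor P\<^sub>1 Q) = tp (int s) (int 0)"
    by (simp add: fun_eq_iff two_point_divisor_def)
  have "s \<in> pole_numbers \<iota> P\<^sub>1 \<longleftrightarrow> T (int s) \<le> 0"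
    unfolding pole_numbers_def mem_Collect_eq tp pole_divisor_eq_tp_iff T_le_iff_function
    using False by (intro iff_exI) (auto simp: max_def split: if_splits)
  then show ?thesis using False by (auto simp: gaps_def gap_set_def)
qed

lemma tau_eq:
  assumes "s \<in> gaps \<iota> P\<^sub>1"
  shows "tau \<iota> P\<^sub>1 P\<^sub>2 s = nat (T (int s))"
  unfolding tau_def
proof (rule Least_equality)
  have s: "int s > 0" "T (int s) > 0" using assms gaps_iff by (auto simp: gap_set_def)
  have iff: "(s, t) \<in> pole_pairs \<iota> P\<^sub>1 P\<^sub>2 \<longleftrightarrow> (\<exists>z. z \<noteq> 0 \<and> place_val P\<^sub>1 z = - int s \<and>
      int t = max 0 (- place_val P\<^sub>2 z) \<and>
      (\<forall>Q. is_place \<iota> Q \<longrightarrow> Q \<noteq> P\<^sub>1 \<longrightarrow> Q \<noteq> P\<^sub>2 \<longrightarrow> place_val Q z \<ge> 0))" for t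
    unfolding pole_pairs_def mem_Collect_eq prod.case pole_divisor_eq_tp_iff
    using s(1) by (intro iff_exI) (auto simp: max_def split: if_splits)
  obtain z where z: "z \<noteq> 0" "place_val P\<^sub>1 z = - int s" "place_val P\<^sub>2 z \<ge> - T (int s)"
    "\<forall>Q. is_place \<iota> Q \<longrightarrow> Q \<noteq> P\<^sub>1 \<longrightarrow> Q \<noteq> P\<^sub>2 \<longrightarrow> place_val Q z \<ge> 0"
    using T_le_iff_function[of "int s" "T (int s)"] by auto
  \<comment> \<open>Minimality of \<open>T\<close> makes the pole order at the second place exactly
    \<open>T (int s)\<close>. For a gap this is positive, so it is a genuine pole and the truncation
    at 0 has no effect.\<close>
  then have "T (int s) \<le> - place_val P\<^sub>2 z" unfolding T_le_iff_function by auto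
  with z(3) have "place_val P\<^sub>2 z = - T (int s)" by linarith
  with z s(2) show "(s, nat (T (int s))) \<in> pole_pairs \<iota> P\<^sub>1 P\<^sub>2" unfolding iff by auto
  fix t assume "(s, t) \<in> pole_pairs \<iota> P\<^sub>1 P\<^sub>2"
  then have "T (int s) \<le> int t" unfolding iff T_le_iff_function by auto
  then show "nat (T (int s)) \<le> t" by simp
qed

lemma card_Gamma_block: "card (Gamma_block \<iota> P\<^sub>1 P\<^sub>2 k 0) = card {a \<in> gap_set. row a = int k \<and> col a = 0}"
proof -
  let ?p = "period \<iota> P\<^sub>1 P\<^sub>2" and ?f = "\<lambda>a. (nat a, nat (T a))"
  have row: "row a = int k \<longleftrightarrow> int (k * ?p) < a \<and> a \<le> int ((k + 1) * ?p)" for a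
    unfolding row_def by (rule pred_div_eq_iff[OF period_spec(1)])
  have col: "col a = 0 \<longleftrightarrow> 0 < T a \<and> T a \<le> int ?p" for a
    unfolding col_def using pred_div_eq_iff[OF period_spec(1), of "T a" 0] by simp
  have "bij_betw ?f {a \<in> gap_set. row a = int k \<and> col a = 0} (Gamma_block \<iota> P\<^sub>1 P\<^sub>2 k 0)"
  proof (rule bij_betw_imageI)
    show "inj_on ?f {a \<in> gap_set. row a = int k \<and> col a = 0}"
      by (rule inj_onI) (auto simp: gap_set_def)
    show "?f ` {a \<in> gap_set. row a = int k \<and> col a = 0} = Gamma_block \<iota> P\<^sub>1 P\<^sub>2 k 0"
    proof (intro equalityI subsetI)
      fix x assume "x \<in> ?f ` {a \<in> gap_set. row a = int k \<and> col a = 0}"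
      then obtain a where a: "x = ?f a" "a \<in> gap_set" "row a = int k" "col a = 0" by blast
      then have pos: "a > 0" "T a > 0" by (auto simp: gap_set_def)
      then have gap: "nat a \<in> gaps \<iota> P\<^sub>1" using a(2) by (simp add: gaps_iff)
      moreover have "tau \<iota> P\<^sub>1 P\<^sub>2 (nat a) = nat (T a)" using tau_eq[OF gap] pos by simp
      ultimately have "x \<in> Gamma \<iota> P\<^sub>1 P\<^sub>2" unfolding Gamma_def using a(1) by force
      moreover have "k * ?p < nat a" "nat a \<le> (k + 1) * ?p" "nat (T a) \<le> ?p"
        using a(3,4) unfolding row col by linarith+
      ultimately show "x \<in> Gamma_block \<iota> P\<^sub>1 P\<^sub>2 k 0"
        using pos a(1) by (simp add: Gamma_block_def Let_def)
    next
      fix x assume x: "x \<in> Gamma_block \<iota> P\<^sub>1 P\<^sub>2 k 0"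
      then obtain s where s: "x = (s, tau \<iota> P\<^sub>1 P\<^sub>2 s)" "s \<in> gaps \<iota> P\<^sub>1"
        by (auto simp: Gamma_block_def Gamma_def Let_def)
      then have gap: "int s \<in> gap_set" "T (int s) > 0" "x = ?f (int s)"
        using tau_eq[OF s(2)] by (auto simp: gaps_iff gap_set_def)
      have "k * ?p < s" "s \<le> (k + 1) * ?p" "nat (T (int s)) \<le> ?p"
        using x gap(3) by (simp_all add: Gamma_block_def Let_def)
      then have "row (int s) = int k" "col (int s) = 0"
        unfolding row col using gap(2) by (simp_all only: of_nat_less_iff of_nat_le_iff nat_le_iff simp_thms)
      with gap show "x \<in> ?f ` {a \<in> gap_set. row a = int k \<and> col a = 0}" by blast
    qed
  qed
  then show ?thesis by (rule bij_betw_same_card[symmetric])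
qed

lemma pure_gaps_eq: "pure_gaps \<iota> P\<^sub>1 P\<^sub>2 = {(s, t). T (int s) > int t \<and> U (int t) > int s}"
proof -
  have "ell \<iota> (tp (int s) (int t)) = ell \<iota> (tp (int s - 1) (int t)) \<longleftrightarrow> T (int s) > int t" for s t
    using T_le_iff[of "int s" "int t"] by (auto simp: l_def)
  moreover have "ell \<iota> (tp (int s) (int t)) = ell \<iota> (tp (int s) (int t - 1)) \<longleftrightarrow> U (int t) > int s" for s t
    using U_le_iff[of "int t" "int s"] by (auto simp: l_def)
  ultimately show ?thesis by (simp add: pure_gaps_def)
qed

lemma pure_gaps_bounds:
  "finite (pure_gaps \<iota> P\<^sub>1 P\<^sub>2)"
  "Sum_any (\<lambda>k. (k + 1) * (Sum_any (\<lambda>j. if k < j then card (Gamma_block \<iota> P\<^sub>1 P\<^sub>2 j 0) else 0))\<^sup>2)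
    \<le> card (pure_gaps \<iota> P\<^sub>1 P\<^sub>2)"
  "int (card (pure_gaps \<iota> P\<^sub>1 P\<^sub>2)) + genus \<iota>
    \<le> int (Sum_any (\<lambda>k. (k + 1) * (Sum_any (\<lambda>j. if k \<le> j then card (Gamma_block \<iota> P\<^sub>1 P\<^sub>2 j 0) else 0))\<^sup>2))"
proof -
  have "bij_betw (\<lambda>(a, a'). (nat a, nat (T a'))) inversions (pure_gaps \<iota> P\<^sub>1 P\<^sub>2)"
    using bij_inversions by (simp only: pure_gaps_eq)
  then have card: "card (pure_gaps \<iota> P\<^sub>1 P\<^sub>2) = card inversions"
    and "finite (pure_gaps \<iota> P\<^sub>1 P\<^sub>2)"
    using bij_betw_same_card bij_betw_finite finite_inversions by metis+
  then show "finite (pure_gaps \<iota> P\<^sub>1 P\<^sub>2)" by blast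
  show "Sum_any (\<lambda>k. (k + 1) * (Sum_any (\<lambda>j. if k < j then card (Gamma_block \<iota> P\<^sub>1 P\<^sub>2 j 0) else 0))\<^sup>2)
      \<le> card (pure_gaps \<iota> P\<^sub>1 P\<^sub>2)"
    unfolding card by (rule strict_block_sum_le) (rule card_Gamma_block)
  show "int (card (pure_gaps \<iota> P\<^sub>1 P\<^sub>2)) + genus \<iota>
      \<le> int (Sum_any (\<lambda>k. (k + 1) * (Sum_any (\<lambda>j. if k \<le> j then card (Gamma_block \<iota> P\<^sub>1 P\<^sub>2 j 0) else 0))\<^sup>2))"
    unfolding card by (rule le_weak_block_sum) (rule card_Gamma_block)
qed

end

theorem proposition3p7:
  fixes \<iota> :: "'q::{field, finite} alg_closure \<Rightarrow> 'f::field"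
    and P\<^sub>1 P\<^sub>2 :: "'f set" and g :: int
  assumes "function_field \<iota>"
    and "genus \<iota> = g"
    and "is_place \<iota> P\<^sub>1" and "is_place \<iota> P\<^sub>2" and "P\<^sub>1 \<noteq> P\<^sub>2"
  shows "finite (pure_gaps \<iota> P\<^sub>1 P\<^sub>2) \<and>
    int (Sum_any (\<lambda>k::nat. (k + 1) *
      (Sum_any (\<lambda>k\<^sub>1::nat. if k < k\<^sub>1 then card (Gamma_block \<iota> P\<^sub>1 P\<^sub>2 k\<^sub>1 0) else 0))\<^sup>2))
      \<le> int (card (pure_gaps \<iota> P\<^sub>1 P\<^sub>2)) \<and>
    int (card (pure_gaps \<iota> P\<^sub>1 P\<^sub>2)) \<le>
    int (Sum_any (\<lambda>k::nat. (k + 1) *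
      (Sum_any (\<lambda>k\<^sub>1::nat. if k \<le> k\<^sub>1 then card (Gamma_block \<iota> P\<^sub>1 P\<^sub>2 k\<^sub>1 0) else 0))\<^sup>2)) - g"
proof -
  interpret alg_closed_function_field \<iota> by standard (rule assms(1))
  have "prime CHAR('q)"
    using finite_imp_CHAR_pos[where ?'a = 'q] prime_CHAR_semidom[where ?'a = 'q] by simp
  then have "frobenius_like (\<lambda>c. c ^ CHAR('q))"
    using alg_closure_frobenius_periodic by (intro frobenius_likeI) auto
  note period = period_exists[OF this assms(3-5)]
  obtain c where "\<forall>D. divisor \<iota> D \<longrightarrow> dg D \<ge> c \<longrightarrow> int (ell \<iota> D) = dg D + 1 - genus \<iota>"
    using riemann_theorem by blast
  then interpret two_places \<iota> P\<^sub>1 P\<^sub>2 c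
    by unfold_locales (use assms period in auto)
  show ?thesis using pure_gaps_bounds assms(2) by simp
qed

end
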